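(* Let $\mathcal{P}=\langle a_1,\ldots,a_n\mid u_1=v_1,\ldots,u_k=v_k\rangle$ be an Adian presentation with $H_1(G(\mathcal{P}))$ nontrivial free abelian of rank $n-k$, and such that $\ell(u_i)=\ell(v_i)$ for every $i$. If either $I(\mathcal{P})$ or $T(\mathcal{P})$ has no cycles, then the standard $2$-complex $\mathcal{K}_{\mathcal{P}}$ has the non-positive immersion property.
   Context: An Adian presentation is a (finite) group presentation $\langle a_1,\ldots,a_n\mid u_1=v_1,\ldots,u_k=v_k\rangle$ where each $u_i$ and $v_i$ is a nontrivial positive word on $A=\{a_1,\ldots,a_n\}$. $G(\mathcal{P})$ is the group presented by $\mathcal{P}$, and $\ell$ denotes word length. The graphs $T(\mathcal{P})$ and $I(\mathcal{P})$ both have vertex set $A$ and one edge for each $i=1,\ldots,k$ (so multiple edges and loops may occur, and these count as cycles): in $T(\mathcal{P})$ the $i$-th edge joins the first letter of $u_i$ to the first letter of $v_i$; in $I(\mathcal{P})$ it joins the last letter of $u_i$ to the last letter of $v_i$. The standard $2$-complex $\mathcal{K}_{\mathcal{P}}$ has one $0$-cell, one $1$-cell for each generator and one $2$-cell for each relation $u_i=v_i$, attached along $u_iv_i^{-1}$. Maps between $2$-complexes are combinatorial (open $n$-cells are sent homeomorphically onto open $n$-cells); an immersion is a locally injective such map. A $2$-complex $X$ has the non-positive immersion property if for every immersion $Y\to X$ with $Y$ compact and connected, either $\chi(Y)\le 0$ or $Y$ is contractible. *)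

theory Defs
  imports "HOL-Analysis.Analysis" "HOL-Algebra.Generated_Groups" "HOL-Algebra.Free_Abelian_Groups"
begin

section \<open>Positive presentations and the groups they present\<close>

text \<open>The relations form a list rather than a set: they are indexed by \<open>i < k\<close>, and
  a relation may be repeated.\<close>

record 'a presentation =
  gens :: "'a set"
  rels :: "('a list \<times> 'a list) list"

definition adian_presentation :: "'a presentation \<Rightarrow> bool" where
  "adian_presentation P \<longleftrightarrow> finite (gens P) \<and>
     (\<forall>(u, v) \<in> set (rels P).
        u \<noteq> [] \<and> v \<noteq> [] \<and> u \<in> lists (gens P) \<and> v \<in> lists (gens P))"

text \<open>A group word is a list of letters \<open>(a, True)\<close>, standing for \<open>a\<close>, and \<open>(a, False)\<close>,
  standing for the inverse of \<open>a\<close>.\<close>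

definition pos_word :: "'a list \<Rightarrow> ('a \<times> bool) list" where
  "pos_word u = map (\<lambda>a. (a, True)) u"

definition inv_word :: "('a \<times> bool) list \<Rightarrow> ('a \<times> bool) list" where
  "inv_word w = rev (map (\<lambda>(a, s). (a, \<not> s)) w)"

abbreviation group_words :: "'a presentation \<Rightarrow> ('a \<times> bool) list set" where
  "group_words P \<equiv> lists (gens P \<times> UNIV)"

inductive pres_eq :: "'a presentation \<Rightarrow> ('a \<times> bool) list \<Rightarrow> ('a \<times> bool) list \<Rightarrow> bool"
  for P where
  refl: "w \<in> group_words P \<Longrightarrow> pres_eq P w w"
| sym: "pres_eq P w w' \<Longrightarrow> pres_eq P w' w"
| trans: "pres_eq P w w' \<Longrightarrow> pres_eq P w' w'' \<Longrightarrow> pres_eq P w w''"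
| cancel: "x \<in> group_words P \<Longrightarrow> y \<in> group_words P \<Longrightarrow> a \<in> gens P \<Longrightarrow>
    pres_eq P (x @ [(a, s), (a, \<not> s)] @ y) (x @ y)"
| relation: "x \<in> group_words P \<Longrightarrow> y \<in> group_words P \<Longrightarrow> (u, v) \<in> set (rels P) \<Longrightarrow>
    u \<in> lists (gens P) \<Longrightarrow> v \<in> lists (gens P) \<Longrightarrow>
    pres_eq P (x @ pos_word u @ y) (x @ pos_word v @ y)"

definition word_class :: "'a presentation \<Rightarrow> ('a \<times> bool) list \<Rightarrow> ('a \<times> bool) list set" where
  "word_class P w = {w'. pres_eq P w w'}"

definition presented_group :: "'a presentation \<Rightarrow> ('a \<times> bool) list set monoid" where
  "presented_group P =
     \<lparr>carrier = word_class P ` group_words P,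
      monoid.mult = (\<lambda>X Y. {w. \<exists>x\<in>X. \<exists>y\<in>Y. pres_eq P (x @ y) w}),
      one = word_class P []\<rparr>"

lemma pres_eq_words: "pres_eq P w w' \<Longrightarrow> w \<in> group_words P \<and> w' \<in> group_words P"
  by (induction rule: pres_eq.induct) (auto simp: pos_word_def)

lemma pres_eq_append_context:
  "pres_eq P w w' \<Longrightarrow> p \<in> group_words P \<Longrightarrow> q \<in> group_words P \<Longrightarrow>
    pres_eq P (p @ w @ q) (p @ w' @ q)"
proof (induction rule: pres_eq.induct)
  case (refl w)
  then show ?case by (intro pres_eq.refl) auto
next
  case (sym w w')
  then show ?case by (blast intro: pres_eq.sym)
next
  case (trans w w' w'')
  then show ?case by (blast intro: pres_eq.trans)
next
  case (cancel x y a s)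
  then show ?case using pres_eq.cancel[of "p @ x" P "y @ q" a s] by simp
next
  case (relation x y u v)
  then show ?case using pres_eq.relation[of "p @ x" P "y @ q" u v] by simp
qed

lemma pres_eq_append:
  assumes "pres_eq P w w'" "pres_eq P z z'"
  shows "pres_eq P (w @ z) (w' @ z')"
  using pres_eq_append_context[OF assms(1), of "[]" z] pres_eq_append_context[OF assms(2), of w' "[]"]
    pres_eq_words[OF assms(1)] pres_eq_words[OF assms(2)]
  by (auto intro: pres_eq.trans)

lemma word_class_eq_iff:
  assumes "w \<in> group_words P"
  shows "word_class P w = word_class P w' \<longleftrightarrow> pres_eq P w w'"
  using assms by (auto simp: word_class_def intro: pres_eq.refl pres_eq.sym pres_eq.trans)

lemma mult_word_class:
  assumes "w \<in> group_words P" "z \<in> group_words P"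
  shows "word_class P w \<otimes>\<^bsub>presented_group P\<^esub> word_class P z = word_class P (w @ z)"
  using assms
  by (auto simp: presented_group_def word_class_def
      intro: pres_eq.refl pres_eq.trans pres_eq_append)

lemma pres_eq_inv_word:
  "w \<in> group_words P \<Longrightarrow> pres_eq P (inv_word w @ w) []"
proof (induction w)
  case Nil
  then show ?case by (simp add: inv_word_def pres_eq.refl)
next
  case (Cons c w)
  obtain a s where c: "c = (a, s)" by fastforce
  have w: "w \<in> group_words P" "a \<in> gens P" using Cons.prems c by auto
  have "inv_word w \<in> group_words P" using w by (auto simp: inv_word_def in_lists_conv_set)
  from pres_eq.cancel[OF this w(1) w(2), of "\<not> s"] Cons.IH[OF w(1)]
  show ?case by (auto simp: c inv_word_def intro: pres_eq.trans)
qed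

lemma carrier_presented_group: "carrier (presented_group P) = word_class P ` group_words P"
  and one_presented_group: "\<one>\<^bsub>presented_group P\<^esub> = word_class P []"
  by (simp_all add: presented_group_def)

lemma group_presented_group: "group (presented_group P)"
proof (rule groupI, unfold carrier_presented_group one_presented_group)
  fix X assume "X \<in> word_class P ` group_words P"
  then obtain w where w: "w \<in> group_words P" "X = word_class P w" by blast
  have nil: "[] \<in> group_words P" by simp
  show "word_class P [] \<otimes>\<^bsub>presented_group P\<^esub> X = X"
    using mult_word_class[OF nil w(1)] w(2) by simp
  have iw: "inv_word w \<in> group_words P" using w by (auto simp: inv_word_def in_lists_conv_set)
  have "inv_word w @ w \<in> group_words P" using w iw by simp
  then have "word_class P (inv_word w) \<otimes>\<^bsub>presented_group P\<^esub> X = word_class P []"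
    using w(2) mult_word_class[OF iw w(1)] pres_eq_inv_word[OF w(1)] word_class_eq_iff by metis
  with iw show "\<exists>Y\<in>word_class P ` group_words P. Y \<otimes>\<^bsub>presented_group P\<^esub> X = word_class P []"
    by blast
  fix Y assume "Y \<in> word_class P ` group_words P"
  then obtain y where y: "y \<in> group_words P" "Y = word_class P y" by blast
  have wy: "w @ y \<in> group_words P" using w(1) y(1) by simp
  show "X \<otimes>\<^bsub>presented_group P\<^esub> Y \<in> word_class P ` group_words P"
    using w(2) y(2) mult_word_class[OF w(1) y(1)] wy by blast
  fix Z assume "Z \<in> word_class P ` group_words P"
  then obtain z where z: "z \<in> group_words P" "Z = word_class P z" by blast
  have yz: "y @ z \<in> group_words P" using y(1) z(1) by simp
  show "X \<otimes>\<^bsub>presented_group P\<^esub> Y \<otimes>\<^bsub>presented_group P\<^esub> Z =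
      X \<otimes>\<^bsub>presented_group P\<^esub> (Y \<otimes>\<^bsub>presented_group P\<^esub> Z)"
    unfolding w(2) y(2) z(2) mult_word_class[OF w(1) y(1)] mult_word_class[OF y(1) z(1)]
      mult_word_class[OF wy z(1)] mult_word_class[OF w(1) yz] by simp
qed auto

definition abelianization :: "('g, 'm) monoid_scheme \<Rightarrow> 'g set monoid" where
  "abelianization G = G Mod derived G (carrier G)"

definition free_abelian_of_rank :: "('g, 'm) monoid_scheme \<Rightarrow> nat \<Rightarrow> bool" where
  "free_abelian_of_rank G r \<longleftrightarrow> G \<cong> free_Abelian_group {..<r}"


section \<open>The graphs of an Adian presentation\<close>

text \<open>A multigraph is given by the list of the end points of its edges; the order of the two
  end points is immaterial. Cycles of length 1 (loops) and 2 (two edges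
  with the same end points) are included.\<close>

definition is_cycle :: "('v \<times> 'v) list \<Rightarrow> 'v list \<Rightarrow> nat list \<Rightarrow> bool" where
  "is_cycle E vs es \<longleftrightarrow>
     vs \<noteq> [] \<and> length es = length vs \<and> distinct vs \<and> distinct es \<and>
     set es \<subseteq> {..<length E} \<and>
     (\<forall>j<length vs. {fst (E ! (es ! j)), snd (E ! (es ! j))} = {vs ! j, vs ! (Suc j mod length vs)})"

definition no_cycles :: "('v \<times> 'v) list \<Rightarrow> bool" where
  "no_cycles E \<longleftrightarrow> (\<nexists>vs es. is_cycle E vs es)"

definition T_graph :: "'a presentation \<Rightarrow> ('a \<times> 'a) list" where
  "T_graph P = map (\<lambda>(u, v). (hd u, hd v)) (rels P)"

definition I_graph :: "'a presentation \<Rightarrow> ('a \<times> 'a) list" where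
  "I_graph P = map (\<lambda>(u, v). (last u, last v)) (rels P)"


section \<open>Combinatorial 2-complexes\<close>

text \<open>A 2-cell is attached along a closed edge path of positive length; in a path, \<open>(e, True)\<close>
  traverses \<open>e\<close> from its source to its target and \<open>(e, False)\<close> traverses it backwards.\<close>

record ('v, 'e, 'f) complex2 =
  verts :: "'v set"
  edges :: "'e set"
  faces :: "'f set"
  src :: "'e \<Rightarrow> 'v"
  tgt :: "'e \<Rightarrow> 'v"
  bdry :: "'f \<Rightarrow> ('e \<times> bool) list"

definition init_vert :: "('v, 'e, 'f) complex2 \<Rightarrow> 'e \<times> bool \<Rightarrow> 'v" where
  "init_vert K = (\<lambda>(e, s). if s then src K e else tgt K e)"

definition term_vert :: "('v, 'e, 'f) complex2 \<Rightarrow> 'e \<times> bool \<Rightarrow> 'v" where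
  "term_vert K = (\<lambda>(e, s). if s then tgt K e else src K e)"

definition closed_edge_path :: "('v, 'e, 'f) complex2 \<Rightarrow> ('e \<times> bool) list \<Rightarrow> bool" where
  "closed_edge_path K p \<longleftrightarrow> p \<noteq> [] \<and> set p \<subseteq> edges K \<times> UNIV \<and>
     (\<forall>i<length p. term_vert K (p ! i) = init_vert K (p ! (Suc i mod length p)))"

definition two_complex :: "('v, 'e, 'f) complex2 \<Rightarrow> bool" where
  "two_complex K \<longleftrightarrow>
     (\<forall>e\<in>edges K. src K e \<in> verts K \<and> tgt K e \<in> verts K) \<and>
     (\<forall>c\<in>faces K. closed_edge_path K (bdry K c))"

text \<open>The geometric realization. Every point lies in a unique open cell, so the points are the
  0-cells, the points \<open>Edge_pt e t\<close> with \<open>0 < t < 1\<close> and the points \<open>Face_pt c z\<close> with \<open>z\<close> in the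
  open unit disc. The gluing is encoded in the characteristic maps below.\<close>

datatype ('v, 'e, 'f) cpoint = Vert_pt 'v | Edge_pt 'e real | Face_pt 'f complex

definition open_cells :: "('v, 'e, 'f) complex2 \<Rightarrow> nat \<Rightarrow> ('v, 'e, 'f) cpoint set set" where
  "open_cells K n =
     (if n = 0 then (\<lambda>v. {Vert_pt v}) ` verts K
      else if n = 1 then (\<lambda>e. Edge_pt e ` {0<..<1}) ` edges K
      else if n = 2 then (\<lambda>c. Face_pt c ` ball 0 1) ` faces K
      else {})"

definition points :: "('v, 'e, 'f) complex2 \<Rightarrow> ('v, 'e, 'f) cpoint set" where
  "points K = \<Union>(open_cells K 0 \<union> open_cells K 1 \<union> open_cells K 2)"

definition edge_char :: "('v, 'e, 'f) complex2 \<Rightarrow> 'e \<Rightarrow> real \<Rightarrow> ('v, 'e, 'f) cpoint" where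
  "edge_char K e t =
     (if t = 0 then Vert_pt (src K e) else if t = 1 then Vert_pt (tgt K e) else Edge_pt e t)"

text \<open>\<open>path_point K p x\<close> runs through the \<open>i\<close>-th edge of \<open>p\<close> at unit speed
  for \<open>x\<close> in \<open>{i..<i + 1}\<close>.\<close>

definition path_point :: "('v, 'e, 'f) complex2 \<Rightarrow> ('e \<times> bool) list \<Rightarrow> real \<Rightarrow> ('v, 'e, 'f) cpoint" where
  "path_point K p x =
     (let (e, s) = p ! nat \<lfloor>x\<rfloor> in edge_char K e (if s then frac x else 1 - frac x))"

definition face_char :: "('v, 'e, 'f) complex2 \<Rightarrow> 'f \<Rightarrow> complex \<Rightarrow> ('v, 'e, 'f) cpoint" where
  "face_char K c z =
     (if norm z < 1 then Face_pt c z
      else path_point K (bdry K c) (real (length (bdry K c)) * Arg2pi z / (2 * pi)))"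

text \<open>The weak topology determined by the characteristic maps, i.e. the quotient topology of the
  disjoint union of the 0-cells, closed intervals and closed discs.\<close>

definition open_in_complex :: "('v, 'e, 'f) complex2 \<Rightarrow> ('v, 'e, 'f) cpoint set \<Rightarrow> bool" where
  "open_in_complex K U \<longleftrightarrow> U \<subseteq> points K \<and>
     (\<forall>e\<in>edges K. openin (top_of_set {0..1}) {t \<in> {0..1}. edge_char K e t \<in> U}) \<and>
     (\<forall>c\<in>faces K. openin (top_of_set (cball 0 1)) {z \<in> cball 0 1. face_char K c z \<in> U})"

definition realization :: "('v, 'e, 'f) complex2 \<Rightarrow> ('v, 'e, 'f) cpoint topology" where
  "realization K = topology (open_in_complex K)"

lemma istopology_open_in_complex: "istopology (open_in_complex K)"
proof -
  have Int: "{t \<in> D. g t \<in> S \<inter> T} = {t \<in> D. g t \<in> S} \<inter> {t \<in> D. g t \<in> T}"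
    for D :: "'z set" and g :: "'z \<Rightarrow> 'p" and S T by auto
  have Un: "{t \<in> D. g t \<in> \<Union>\<K>} = \<Union>((\<lambda>S. {t \<in> D. g t \<in> S}) ` \<K>)"
    for D :: "'z set" and g :: "'z \<Rightarrow> 'p" and \<K> by auto
  show ?thesis
    unfolding istopology_def open_in_complex_def Int Un
    by (intro conjI allI impI ballI openin_Int openin_Union) auto
qed

lemma openin_realization: "openin (realization K) U \<longleftrightarrow> open_in_complex K U"
  by (simp add: realization_def istopology_open_in_complex topology_inverse')

lemma points_eq:
  "points K = Vert_pt ` verts K \<union> (\<Union>e\<in>edges K. Edge_pt e ` {0<..<1}) \<union>
     (\<Union>c\<in>faces K. Face_pt c ` ball 0 1)"
  by (auto simp: points_def open_cells_def)

lemma topspace_realization: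
  assumes "two_complex K"
  shows "topspace (realization K) = points K"
proof -
  have e: "edge_char K e t \<in> points K" if "e \<in> edges K" "t \<in> {0..1}" for e t
    using assms that by (force simp: two_complex_def edge_char_def points_eq)
  have c: "face_char K c z \<in> points K" if "c \<in> faces K" "z \<in> cball 0 1" for c z
  proof (cases "norm z < 1")
    case True
    then show ?thesis using that by (force simp: face_char_def points_eq)
  next
    case False
    define p where "p = bdry K c"
    define x where "x = real (length p) * Arg2pi z / (2 * pi)"
    have p: "p \<noteq> []" "set p \<subseteq> edges K \<times> UNIV"
      using assms that by (auto simp: two_complex_def closed_edge_path_def p_def)
    have "0 \<le> x" "x < real (length p)"
      using p Arg2pi_ge_0[of z] Arg2pi_lt_2pi[of z] by (auto simp: x_def field_simps)
    then have "nat \<lfloor>x\<rfloor> < length p" by linarith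
    then have "p ! nat \<lfloor>x\<rfloor> \<in> edges K \<times> UNIV" using p nth_mem by blast
    moreover have "0 \<le> frac x" "frac x \<le> 1" using frac_lt_1[of x] by auto
    ultimately have "path_point K p x \<in> points K"
      unfolding path_point_def by (auto simp: Let_def intro!: e split: prod.splits)
    then show ?thesis using False by (simp add: face_char_def p_def x_def)
  qed
  have "{t \<in> {0..1}. edge_char K d t \<in> points K} = {0..1}" if "d \<in> edges K" for d
    using e that by blast
  moreover have "{z \<in> cball 0 1. face_char K d z \<in> points K} = cball 0 1" if "d \<in> faces K" for d
    using c that by blast
  ultimately have "open_in_complex K (points K)"
    by (simp add: open_in_complex_def del: mem_cball_0 mem_cball atLeastAtMost_iff)
  then show ?thesis
    by (auto simp: topspace_def openin_realization open_in_complex_def)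
qed

definition euler_char :: "('v, 'e, 'f) complex2 \<Rightarrow> int" where
  "euler_char K = int (card (verts K)) - int (card (edges K)) + int (card (faces K))"


section \<open>Immersions and non-positive immersions\<close>

definition combinatorial_map ::
  "('v, 'e, 'f) complex2 \<Rightarrow> ('w, 'd, 'g) complex2 \<Rightarrow>
     (('v, 'e, 'f) cpoint \<Rightarrow> ('w, 'd, 'g) cpoint) \<Rightarrow> bool" where
  "combinatorial_map Y X f \<longleftrightarrow>
     continuous_map (realization Y) (realization X) f \<and>
     (\<forall>n. \<forall>C\<in>open_cells Y n. \<exists>D\<in>open_cells X n.
        homeomorphic_map (subtopology (realization Y) C) (subtopology (realization X) D) f)"

definition immersion ::
  "('v, 'e, 'f) complex2 \<Rightarrow> ('w, 'd, 'g) complex2 \<Rightarrow>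
     (('v, 'e, 'f) cpoint \<Rightarrow> ('w, 'd, 'g) cpoint) \<Rightarrow> bool" where
  "immersion Y X f \<longleftrightarrow> combinatorial_map Y X f \<and>
     (\<forall>x\<in>topspace (realization Y). \<exists>U. openin (realization Y) U \<and> x \<in> U \<and> inj_on f U)"

text \<open>The \<open>itself\<close> argument carries the types of the cells of \<open>Y\<close>, over which one cannot quantify
  inside a formula; a theorem in which these are type variables covers all of them. The Euler
  characteristic is only used for compact \<open>Y\<close>, which have finitely many cells.\<close>

definition non_positive_immersion_property ::
  "('v \<times> 'e \<times> 'f) itself \<Rightarrow> ('w, 'd, 'g) complex2 \<Rightarrow> bool" where
  "non_positive_immersion_property _ X \<longleftrightarrow>
     (\<forall>(Y :: ('v, 'e, 'f) complex2) f.
        two_complex Y \<and> compact_space (realization Y) \<and> connected_space (realization Y) \<and>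
        immersion Y X f \<longrightarrow>
        euler_char Y \<le> 0 \<or> contractible_space (realization Y))"


section \<open>The standard 2-complex of a presentation\<close>

definition standard_complex :: "'a presentation \<Rightarrow> (unit, 'a, nat) complex2" where
  "standard_complex P =
     \<lparr>verts = {()}, edges = gens P, faces = {..<length (rels P)},
      src = (\<lambda>_. ()), tgt = (\<lambda>_. ()),
      bdry = (\<lambda>i. pos_word (fst (rels P ! i)) @ inv_word (pos_word (snd (rels P ! i))))\<rparr>"

lemma two_complex_standard_complex:
  assumes "adian_presentation P"
  shows "two_complex (standard_complex P)"
  using assms
  by (fastforce simp: adian_presentation_def two_complex_def standard_complex_def closed_edge_path_def
      pos_word_def inv_word_def in_lists_conv_set dest!: nth_mem)

end

theory Submission
  imports Defs "HOL-Computational_Algebra.Polynomial"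
begin

text \<open>All relators have exponent sum zero, so the edges of \<open>X\<close> carry a class in \<open>H\<^sup>1\<close> with value 1 on
  every generator. Let \<open>Y \<rightarrow> X\<close> be an immersion. It preserves boundary words, so each 2-cell of \<open>Y\<close> is a
  bigon: two directed paths of equal length from a bottom to a top vertex. The 2-cells with a given
  bottom vertex span a graph on the outgoing edges which maps injectively on edges to \<open>T(P)\<close>, hence
  is a forest; for \<open>I(P)\<close> one reverses all edges.

  If the class vanishes on \<open>Y\<close>, there is a height function. A leaf of the forest at a lowest bottom
  vertex is a free edge, so \<open>Y\<close> collapses to a connected graph, which is a tree or has nonpositive
  Euler characteristic. Otherwise use the cellular chain complex with coefficients in polynomials
  in \<open>x\<close>, twisted by the class. Its lowest order term in \<open>x\<close> on 2-cells is the incidence matrix of a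
  forest, so the boundary map on 2-cells is injective, and the one on 1-cells has full rank because
  the degree of an element of the kernel of its transpose would be a height function; hence
  \<open>F + V \<le> E\<close>.\<close>

section \<open>The realization of a 2-complex\<close>

text \<open>The twisted chain complex enters as one linear system. If F + V > E, integer polynomials
  \<open>x\<close> on faces and \<open>y\<close> on vertices, not all zero, satisfy D x + \<delta> y
  = 0 on every edge, D being the boundary map and \<delta> y the difference of \<open>y\<close>
  along edges, the end weighted by the variable. The two sides of a bigon have the same length, so D
  x is orthogonal to \<delta> y, and since integer polynomials form an ordered ring, the sum of
  squares of D x vanishes. Hence D x and \<delta> y vanish separately. That boundary words are
  preserved needs an argument, since an immersion is only a continuous map that may distort the open
  cells. Its restriction to an open face is extended to the closed disc, which is possible because
  points of the 1-skeleton have finite fibres; the extension permutes the boundary arcs. Local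
  injectivity is used only at corners: two faces over the same relation with a common corner in the
  same position coincide. This gives the injectivity into T(P) or I(P). The forest condition is
  imposed on every nonempty set of faces: this form survives collapses, and it applies both to the
  faces of lowest base and to those with a coefficient of lowest order.\<close>

lemma edge_char_points:
  assumes "two_complex K" "e \<in> edges K" "t \<in> {0..1}"
  shows "edge_char K e t \<in> points K"
  using assms by (force simp: two_complex_def edge_char_def points_eq)

lemma continuous_map_edge_char:
  assumes "two_complex K" "e \<in> edges K"
  shows "continuous_map (top_of_set {0..1}) (realization K) (edge_char K e)"
  using assms edge_char_points[OF assms]
  by (auto simp: continuous_map_def topspace_realization openin_realization open_in_complex_def)

section \<open>Boundary circles of faces as cyclic sequences of unit arcs\<close>

definition letter_char :: "('v, 'e, 'f) complex2 \<Rightarrow> 'e \<times> bool \<Rightarrow> real \<Rightarrow> ('v, 'e, 'f) cpoint" where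
  "letter_char K l t = edge_char K (fst l) (if snd l then t else 1 - t)"

text \<open>The scaling matches \<open>path_point\<close>: the k-th of n boundary letters occupies
  the arc over \<open>{k..k + 1}\<close>, so positions can be reduced modulo n.\<close>

definition circ :: "nat \<Rightarrow> real \<Rightarrow> complex" where
  "circ n x = cis (2 * pi * x / real n)"

lemma continuous_on_circ [continuous_intros]:
  "continuous_on A g \<Longrightarrow> continuous_on A (\<lambda>x. circ n (g x))"
  unfolding circ_def by (cases "n = 0") (auto intro!: continuous_intros)

lemma norm_circ [simp]: "norm (circ n x) = 1"
  by (simp add: circ_def)

lemma Arg2pi_circ: "0 \<le> x \<Longrightarrow> x < real n \<Longrightarrow> Arg2pi (circ n x) = 2 * pi * x / real n"
  unfolding circ_def by (rule Arg2pi_unique[of 1]) (auto simp: cis_conv_exp field_simps)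

lemma circ_Arg2pi:
  assumes "norm z = 1" "n > 0"
  shows "circ n (real n * Arg2pi z / (2 * pi)) = z"
  using Arg2pi_eq[of z] assms by (simp add: circ_def cis_conv_exp)

lemma circ_period [simp]: "n > 0 \<Longrightarrow> circ n (x + real n) = circ n x"
proof -
  assume "n > 0"
  then have "2 * pi * (x + real n) / real n = 2 * pi * x / real n + 2 * pi"
    by (simp add: field_simps)
  then show ?thesis by (simp add: circ_def cis_mult[symmetric])
qed

lemma circ_mod:
  assumes "n > 0"
  shows "circ n (real (k mod n) + x) = circ n (real k + x)"
proof (induction k rule: less_induct)
  case (less k)
  show ?case
  proof (cases "k < n")
    case False
    then have "circ n (real ((k - n) mod n) + x) = circ n (real (k - n) + x)"
      using less[of "k - n"] assms by simp
    moreover have "circ n (real k + x) = circ n (real (k - n) + x)"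
      using circ_period[OF assms, of "real (k - n) + x"] False
      by (simp add: of_nat_diff algebra_simps del: circ_period)
    ultimately show ?thesis
      using False by (simp add: le_mod_geq)
  qed simp
qed

lemma circ_inj:
  assumes "0 \<le> x" "x < real n" "0 \<le> y" "y < real n" "circ n x = circ n y"
  shows "x = y"
proof -
  have "2 * pi * x / real n = 2 * pi * y / real n"
    unfolding Arg2pi_circ[OF assms(1,2), symmetric] Arg2pi_circ[OF assms(3,4), symmetric] assms(5) ..
  moreover have "real n > 0" using assms(1,2) by linarith
  ultimately show ?thesis by simp
qed

lemma circ_cover:
  assumes "norm z = 1" "n > 0"
  obtains k \<tau> where "k < n" "0 \<le> \<tau>" "\<tau> < 1" "z = circ n (real k + \<tau>)"
proof -
  define x where "x = real n * Arg2pi z / (2 * pi)"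
  have x: "0 \<le> x" "x < real n"
    using assms Arg2pi_ge_0[of z] Arg2pi_lt_2pi[of z] by (auto simp: x_def field_simps)
  have *: "x = real (nat \<lfloor>x\<rfloor>) + frac x" using x by (simp add: frac_def)
  show ?thesis
  proof (rule that[of "nat \<lfloor>x\<rfloor>" "frac x"])
    show "nat \<lfloor>x\<rfloor> < n" using x by linarith
    show "z = circ n (real (nat \<lfloor>x\<rfloor>) + frac x)"
      using circ_Arg2pi[OF assms] * unfolding x_def by metis
  qed (use frac_lt_1 in auto)
qed

lemma letter_char_0: "letter_char K l 0 = Vert_pt (init_vert K l)"
  by (cases l) (auto simp: letter_char_def edge_char_def init_vert_def)

lemma letter_char_1: "letter_char K l 1 = Vert_pt (term_vert K l)"
  by (cases l) (auto simp: letter_char_def edge_char_def term_vert_def)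

lemma letter_char_mid: "0 < t \<Longrightarrow> t < 1 \<Longrightarrow>
   letter_char K l t = Edge_pt (fst l) (if snd l then t else 1 - t)"
  by (auto simp: letter_char_def edge_char_def)

lemma face_char_circ_less:
  assumes "n = length (bdry K c)" "k < n" "0 \<le> \<tau>" "\<tau> < 1"
  shows "face_char K c (circ n (real k + \<tau>)) = letter_char K (bdry K c ! k) \<tau>"
proof -
  have k: "real k + \<tau> < real n" using assms by linarith
  have "real n * Arg2pi (circ n (real k + \<tau>)) / (2 * pi) = real k + \<tau>"
    using Arg2pi_circ[OF _ k] assms(2,3) by simp
  moreover have "\<lfloor>real k + \<tau>\<rfloor> = int k"
    using assms(3,4) by (subst floor_eq_iff) auto
  then have "nat \<lfloor>real k + \<tau>\<rfloor> = k" "frac (real k + \<tau>) = \<tau>"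
    by (auto simp: frac_def)
  ultimately show ?thesis
    unfolding face_char_def path_point_def letter_char_def using assms(1)
    by (simp add: split_beta)
qed

text \<open>\<open>path_point\<close> describes half-open arcs. At \<open>\<tau> = 1\<close> the
  next letter takes over, and the condition on closed edge paths makes both descriptions agree.
  Gluing arguments need the closed arcs.\<close>

lemma face_char_circ:
  assumes "two_complex K" "c \<in> faces K" "n = length (bdry K c)" "k < n" "\<tau> \<in> {0..1}"
  shows "face_char K c (circ n (real k + \<tau>)) = letter_char K (bdry K c ! k) \<tau>"
proof (cases "\<tau> < 1")
  case True
  then show ?thesis using face_char_circ_less[OF assms(3,4)] assms(5) by simp
next
  case False
  then have t: "\<tau> = 1" using assms by auto
  have n: "n > 0" using assms by auto
  have cp: "term_vert K (bdry K c ! k) = init_vert K (bdry K c ! (Suc k mod n))"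
    using assms by (auto simp: two_complex_def closed_edge_path_def)
  have "circ n (real k + \<tau>) = circ n (real (Suc k mod n) + 0)"
    by (subst circ_mod[OF n]) (simp add: t add.commute)
  then have "face_char K c (circ n (real k + \<tau>)) = letter_char K (bdry K c ! (Suc k mod n)) 0"
    using face_char_circ_less[of n K c "Suc k mod n" 0] assms n by simp
  then show ?thesis by (simp add: t letter_char_0 letter_char_1 cp)
qed

lemma bdry_nonempty: "two_complex K \<Longrightarrow> c \<in> faces K \<Longrightarrow> length (bdry K c) > 0"
  by (auto simp: two_complex_def closed_edge_path_def)

lemma bdry_edge: "two_complex K \<Longrightarrow> c \<in> faces K \<Longrightarrow> k < length (bdry K c) \<Longrightarrow> fst (bdry K c ! k) \<in> edges K"
  unfolding two_complex_def closed_edge_path_def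
  by (metis mem_Sigma_iff nth_mem prod.collapse subset_iff)

lemma face_char_points:
  assumes "two_complex K" "c \<in> faces K" "z \<in> cball 0 1"
  shows "face_char K c z \<in> points K"
proof (cases "norm z < 1")
  case True
  then show ?thesis using assms by (force simp: face_char_def points_eq)
next
  case False
  then have "norm z = 1" using assms(3) by simp
  then obtain k \<tau> where k: "k < length (bdry K c)" "0 \<le> \<tau>" "\<tau> < 1"
      "z = circ (length (bdry K c)) (real k + \<tau>)"
    by (rule circ_cover[OF _ bdry_nonempty[OF assms(1,2)]])
  then have "face_char K c z = letter_char K (bdry K c ! k) \<tau>"
    using face_char_circ_less[OF HOL.refl k(1-3)] by simp
  then show ?thesis
    unfolding letter_char_def using edge_char_points[OF assms(1) bdry_edge[OF assms(1,2) k(1)]] k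
    by simp
qed

lemma continuous_map_face_char:
  assumes "two_complex K" "c \<in> faces K"
  shows "continuous_map (top_of_set (cball 0 1)) (realization K) (face_char K c)"
  using assms face_char_points[OF assms]
  by (auto simp: continuous_map_def topspace_realization openin_realization open_in_complex_def
      simp del: mem_cball_0 mem_cball)

text \<open>Universal property of the quotient topology. Vertices get a hypothesis of their own,
  since an isolated vertex is reached by no characteristic map of an edge or face.\<close>

lemma continuous_map_realization:
  assumes "two_complex K" "\<And>v. v \<in> verts K \<Longrightarrow> g (Vert_pt v) \<in> topspace Z"
    and e: "\<And>e. e \<in> edges K \<Longrightarrow> continuous_map (top_of_set {0..1}) Z (g \<circ> edge_char K e)"
    and c: "\<And>c. c \<in> faces K \<Longrightarrow> continuous_map (top_of_set (cball 0 1)) Z (g \<circ> face_char K c)"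
  shows "continuous_map (realization K) Z g"
  unfolding continuous_map_def
proof (intro conjI allI impI)
  show "g \<in> topspace (realization K) \<rightarrow> topspace Z"
  proof
    fix x assume "x \<in> topspace (realization K)"
    then have "x \<in> points K" using topspace_realization assms(1) by blast
    then consider v where "v \<in> verts K" "x = Vert_pt v"
      | d t where "d \<in> edges K" "0 < t" "t < 1" "x = Edge_pt d t"
      | d z where "d \<in> faces K" "norm z < 1" "x = Face_pt d z"
      by (cases x) (auto simp: points_eq)
    then show "g x \<in> topspace Z"
    proof cases
      case 2
      then have "(g \<circ> edge_char K d) t \<in> topspace Z"
        using continuous_map_image_subset_topspace[OF e[of d]] by (simp add: image_subset_iff)
      then show ?thesis using 2 by (simp add: edge_char_def)
    next
      case 3
      then have "(g \<circ> face_char K d) z \<in> topspace Z"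
        using continuous_map_image_subset_topspace[OF c[of d]] by (simp add: image_subset_iff)
      then show ?thesis using 3 by (simp add: face_char_def)
    qed (use assms in auto)
  qed
next
  fix U assume U: "openin Z U"
  have "{t \<in> {0..1}. edge_char K d t \<in> {x \<in> points K. g x \<in> U}} = {t \<in> {0..1}. (g \<circ> edge_char K d) t \<in> U}"
    if "d \<in> edges K" for d
    using edge_char_points[OF assms(1) that] by auto
  moreover have "{z \<in> cball 0 1. face_char K d z \<in> {x \<in> points K. g x \<in> U}}
      = {z \<in> cball 0 1. (g \<circ> face_char K d) z \<in> U}"
    if "d \<in> faces K" for d
    using face_char_points[OF assms(1) that] by auto
  ultimately show "openin (realization K) {x \<in> topspace (realization K). g x \<in> U}"
    using openin_continuous_map_preimage[OF e U] openin_continuous_map_preimage[OF c U]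
    by (simp add: openin_realization open_in_complex_def topspace_realization assms(1)
        del: mem_cball_0 mem_cball atLeastAtMost_iff)
qed

text \<open>The part of \<open>T\<close> outside the preimage is a finite union of continuous images
  of compact sets, hence closed. So \<open>T\<close> carries the quotient topology of its arcs, also
  at points where these meet.\<close>

lemma openin_preimage_arcs:
  fixes \<phi> :: "'i \<Rightarrow> real \<Rightarrow> complex"
  assumes "finite J" and cont: "\<And>j. j \<in> J \<Longrightarrow> continuous_on {0..1} (\<phi> j)"
    and T: "T = (\<Union>j\<in>J. \<phi> j ` {0..1})"
    and op: "\<And>j. j \<in> J \<Longrightarrow> openin (top_of_set {0..1}) {t \<in> {0..1}. g (\<phi> j t) \<in> U}"
  shows "openin (top_of_set T) {z \<in> T. g z \<in> U}"
proof -
  have "compact (\<phi> j ` {t \<in> {0..1}. g (\<phi> j t) \<notin> U})" if "j \<in> J" for j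
  proof (rule compact_continuous_image)
    have "{0..1} - {t \<in> {0..1}. g (\<phi> j t) \<in> U} = {t \<in> {0..1}. g (\<phi> j t) \<notin> U}" by auto
    then have "closedin (top_of_set {0..1}) {t \<in> {0..1}. g (\<phi> j t) \<notin> U}"
      using closedin_diff[OF closedin_topspace op[OF that]] by (metis topspace_euclidean_subtopology)
    then show "compact {t \<in> {0..1}. g (\<phi> j t) \<notin> U}"
      using closedin_compact[OF compact_Icc] by blast
    show "continuous_on {t \<in> {0..1}. g (\<phi> j t) \<notin> U} (\<phi> j)"
      using cont[OF that] by (rule continuous_on_subset) auto
  qed
  then have "compact (\<Union>j\<in>J. \<phi> j ` {t \<in> {0..1}. g (\<phi> j t) \<notin> U})"
    using assms(1) by auto
  moreover have "(\<Union>j\<in>J. \<phi> j ` {t \<in> {0..1}. g (\<phi> j t) \<notin> U}) = T - {z \<in> T. g z \<in> U}"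
    unfolding T by auto
  ultimately have "closedin (top_of_set T) (T - {z \<in> T. g z \<in> U})"
    by (metis Diff_subset closed_subset compact_imp_closed)
  then show ?thesis
    by (metis (no_types, lifting) closedin_def double_diff mem_Collect_eq subsetI subset_refl topspace_euclidean_subtopology)
qed

lemma sphere_arcs: "n > 0 \<Longrightarrow> sphere 0 1 = (\<Union>k\<in>{..<n}. (\<lambda>t. circ n (real k + t)) ` {0..1})"
  by (fastforce elim!: circ_cover)

lemma continuous_map_arcs:
  fixes \<phi> :: "'i \<Rightarrow> real \<Rightarrow> complex"
  assumes "finite J" "\<And>j. j \<in> J \<Longrightarrow> continuous_on {0..1} (\<phi> j)"
    and T: "T = (\<Union>j\<in>J. \<phi> j ` {0..1})"
    and cm: "\<And>j. j \<in> J \<Longrightarrow> continuous_map (top_of_set {0..1}) Z (g \<circ> \<phi> j)"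
  shows "continuous_map (top_of_set T) Z (g :: complex \<Rightarrow> _)"
  unfolding continuous_map_def topspace_euclidean_subtopology
proof (intro conjI allI impI)
  show "g \<in> T \<rightarrow> topspace Z"
    using continuous_map_funspace[OF cm] by (force simp: T Pi_iff)
  fix U assume "openin Z U"
  from openin_continuous_map_preimage[OF cm this]
  show "openin (top_of_set T) {x \<in> T. g x \<in> U}"
    by (intro openin_preimage_arcs[OF assms(1,2) T]) auto
qed

lemma continuous_map_letter_char:
  assumes "continuous_map (top_of_set {0..1}) Z (g \<circ> edge_char K (fst l))"
  shows "continuous_map (top_of_set {0..1}) Z (g \<circ> letter_char K l)"
proof (cases "snd l")
  case True
  then have "letter_char K l = edge_char K (fst l)" by (auto simp: letter_char_def)
  then show ?thesis using assms by simp
next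
  case False
  then have *: "letter_char K l = edge_char K (fst l) \<circ> (\<lambda>t. 1 - t)" by (auto simp: letter_char_def)
  have "continuous_map (top_of_set {0..1}) (top_of_set {0..1}) (\<lambda>t::real. 1 - t)"
    by (auto intro!: continuous_intros)
  from continuous_map_compose[OF this assms] show ?thesis by (simp add: * comp_assoc)
qed

lemma continuous_map_sphere:
  assumes K: "two_complex K" "c \<in> faces K"
    and e: "\<And>e. e \<in> edges K \<Longrightarrow> continuous_map (top_of_set {0..1}) Z (g \<circ> edge_char K e)"
  shows "continuous_map (top_of_set (sphere 0 1)) Z (g \<circ> face_char K c)"
proof (rule continuous_map_arcs[OF _ _ sphere_arcs[OF bdry_nonempty[OF K]]])
  fix k assume k: "k \<in> {..<length (bdry K c)}"
  have "continuous_map (top_of_set {0..1}) Z (g \<circ> letter_char K (bdry K c ! k))"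
    by (rule continuous_map_letter_char[OF e[OF bdry_edge[OF K]]]) (use k in simp)
  then show "continuous_map (top_of_set {0..1}) Z
      (g \<circ> face_char K c \<circ> (\<lambda>t. circ (length (bdry K c)) (real k + t)))"
    using face_char_circ[OF K HOL.refl] k by (auto intro: continuous_map_eq)
qed (auto intro!: continuous_intros)

section \<open>Real functions on a realization and the Hausdorff property\<close>

text \<open>Only the centre is delicate: \<open>sgn\<close> is discontinuous there, but
  \<open>G\<close> is bounded on the compact circle and the factor \<open>norm z\<close> forces the
  limit 0.\<close>

lemma continuous_on_cone:
  fixes G :: "complex \<Rightarrow> real"
  assumes "continuous_on (sphere 0 1) G"
  shows "continuous_on (cball 0 1) (\<lambda>z. norm z * G (sgn z))"
proof -
  have "compact (G ` sphere 0 1)" using assms compact_sphere compact_continuous_image by blast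
  then obtain M where M: "\<And>z. z \<in> sphere 0 1 \<Longrightarrow> \<bar>G z\<bar> \<le> M"
    by (metis bounded_iff compact_imp_bounded image_eqI real_norm_def)
  have "continuous (at z within cball 0 1) (\<lambda>z. norm z * G (sgn z))" if "z \<in> cball 0 1" for z
  proof (cases "z = 0")
    case True
    have "((\<lambda>z. norm z * G (sgn z)) \<longlongrightarrow> 0) (at 0)"
    proof (rule Lim_null_comparison)
      show "\<forall>\<^sub>F x in at 0. norm (norm x * G (sgn x)) \<le> norm x * M"
        by (rule eventually_at_filter[THEN iffD2], rule always_eventually)
          (auto simp: abs_mult norm_sgn intro!: mult_left_mono M)
      show "((\<lambda>x::complex. norm x * M) \<longlongrightarrow> 0) (at 0)"
        by (auto intro!: tendsto_eq_intros)
    qed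
    then show ?thesis using True
      by (auto simp: continuous_within intro: tendsto_within_subset)
  next
    case False
    have o: "open (- {0::complex})" by auto
    have "continuous_on (- {0}) (\<lambda>z. norm z * G (sgn z))"
      by (intro continuous_intros continuous_on_compose2[OF assms]) (auto simp: norm_sgn split: if_splits)
    then show ?thesis using False o
      by (metis Compl_iff continuous_at_imp_continuous_within continuous_on_eq_continuous_at empty_iff insert_iff)
  qed
  then show ?thesis by (simp add: continuous_on_eq_continuous_within)
qed

text \<open>Each face is filled by the radial cone over the boundary values of \<open>g\<close>; on
  the circle, where \<open>norm z = 1\<close>, the cone agrees with \<open>g\<close>, so the pieces
  glue.\<close>

lemma skeleton_function_extends:
  assumes K: "two_complex K" and g: "\<And>e. e \<in> edges K \<Longrightarrow> continuous_on {0..1} (g \<circ> edge_char K e)"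
  obtains G :: "('v, 'e, 'f) cpoint \<Rightarrow> real" where "continuous_map (realization K) euclideanreal G"
    "\<And>v. G (Vert_pt v) = g (Vert_pt v)" "\<And>e t. G (Edge_pt e t) = g (Edge_pt e t)"
proof
  let ?G = "\<lambda>p. case p of Face_pt c z \<Rightarrow> norm z * g (face_char K c (sgn z)) | _ \<Rightarrow> g p"
  show "?G (Vert_pt v) = g (Vert_pt v)" "?G (Edge_pt e t) = g (Edge_pt e t)" for v e t by auto
  have G: "?G (edge_char K e t) = g (edge_char K e t)" for e t by (auto simp: edge_char_def)
  show "continuous_map (realization K) euclideanreal ?G"
  proof (rule continuous_map_realization[OF K])
    fix e assume "e \<in> edges K"
    with g show "continuous_map (top_of_set {0..1}) euclideanreal (?G \<circ> edge_char K e)"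
      by (simp add: o_def G)
  next
    fix c assume c: "c \<in> faces K"
    have "continuous_on (sphere 0 1) (g \<circ> face_char K c)"
      using continuous_map_sphere[OF K c, of euclideanreal g] g by simp
    then have cone: "continuous_on (cball 0 1) (\<lambda>z. norm z * g (face_char K c (sgn z)))"
      using continuous_on_cone[of "g \<circ> face_char K c"] by (simp only: o_apply)
    have eq: "?G (face_char K c z) = norm z * g (face_char K c (sgn z))" if "z \<in> cball 0 1" for z
    proof (cases "norm z < 1")
      case True
      then show ?thesis by (simp add: face_char_def)
    next
      case False
      then have z: "norm z = 1" using that by auto
      obtain k \<tau> where k: "k < length (bdry K c)" "0 \<le> \<tau>" "\<tau> < 1"
        "z = circ (length (bdry K c)) (real k + \<tau>)"
        by (rule circ_cover[OF z bdry_nonempty[OF K c]])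
      then have "face_char K c z = letter_char K (bdry K c ! k) \<tau>"
        using face_char_circ_less[OF HOL.refl k(1-3)] by simp
      then obtain e t where et: "face_char K c z = edge_char K e t" by (simp add: letter_char_def)
      have "?G (face_char K c z) = g (edge_char K e t)" unfolding et by (rule G)
      then show ?thesis using z by (simp add: et[symmetric] sgn_div_norm)
    qed
    show "continuous_map (top_of_set (cball 0 1)) euclideanreal (?G \<circ> face_char K c)"
    proof (rule continuous_map_eq)
      show "continuous_map (top_of_set (cball 0 1)) euclideanreal (\<lambda>z. norm z * g (face_char K c (sgn z)))"
        using cone by simp
      fix z assume "z \<in> topspace (top_of_set (cball 0 1 :: complex set))"
      then have "z \<in> cball 0 1" by (simp only: topspace_euclidean_subtopology)
      from eq[OF this] show "norm z * g (face_char K c (sgn z)) = (?G \<circ> face_char K c) z"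
        by (simp only: o_apply)
    qed
  qed auto
qed

lemma face_function_extends:
  assumes K: "two_complex K" and g: "continuous_on (cball 0 1) g" "\<And>z. norm z = 1 \<Longrightarrow> g z = 0"
  shows "continuous_map (realization K) euclideanreal
    (\<lambda>p. case p of Face_pt d z \<Rightarrow> if d = c then g z else 0 | _ \<Rightarrow> 0)" (is "continuous_map _ _ ?G")
proof (rule continuous_map_realization[OF K])
  fix e assume "e \<in> edges K"
  have "?G \<circ> edge_char K e = (\<lambda>_. 0)" by (auto simp: edge_char_def)
  then show "continuous_map (top_of_set {0..1}) euclideanreal (?G \<circ> edge_char K e)" by simp
next
  fix d assume d: "d \<in> faces K"
  have eq: "?G (face_char K d z) = (if d = c then g z else 0)" if "z \<in> cball 0 1" for z
    using that g(2)[of z] by (auto simp: face_char_def path_point_def edge_char_def split_beta Let_def)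
  show "continuous_map (top_of_set (cball 0 1)) euclideanreal (?G \<circ> face_char K d)"
  proof (rule continuous_map_eq)
    show "continuous_map (top_of_set (cball 0 1)) euclideanreal (\<lambda>z. if d = c then g z else 0)"
      using g(1) by simp
    fix z assume "z \<in> topspace (top_of_set (cball 0 1 :: complex set))"
    then have "z \<in> cball 0 1" by (simp only: topspace_euclidean_subtopology)
    from eq[OF this] show "(if d = c then g z else 0) = (?G \<circ> face_char K d) z"
      by (simp only: o_apply)
  qed
qed auto

text \<open>Continuous real functions separate points. By symmetry \<open>p\<close> may be taken in
  a cell of dimension at least that of \<open>q\<close>; a function concentrated around the cell of
  \<open>p\<close> can then be made to vanish at \<open>q\<close>.\<close>

lemma Hausdorff_realization:
  assumes K: "two_complex K"
  shows "Hausdorff_space (realization K)"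
proof -
  have sep: "\<exists>G. continuous_map (realization K) euclideanreal G \<and> G p \<noteq> G q"
    if p: "p \<in> points K" and q: "q \<in> points K" and pq: "p \<noteq> q"
      and dim: "(\<exists>c z. p = Face_pt c z) \<or> (\<exists>e t. p = Edge_pt e t) \<and> (\<nexists>c z. q = Face_pt c z)
         \<or> (\<exists>v w. p = Vert_pt v \<and> q = Vert_pt w)" for p q
    using dim
  proof (elim disjE conjE exE)
    fix c z assume pc: "p = Face_pt c z"
    \<comment> \<open>The first factor kills the boundary circle, the second one kills
      \<open>q\<close> if it lies in the same face.\<close>
    define g where "g w = (1 - norm w) * (if \<exists>z'. q = Face_pt c z' then norm (w - (THE z'. q = Face_pt c z')) else 1)"
      for w :: complex
    have "continuous_on (cball 0 1) g" "\<And>w. norm w = 1 \<Longrightarrow> g w = 0"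
      by (cases "\<exists>z'. q = Face_pt c z'"; force simp: g_def [abs_def] intro!: continuous_intros)+
    note G = face_function_extends[OF K this, of c]
    have "norm z < 1" using p pc by (auto simp: points_eq)
    then have "g z \<noteq> 0" using pc pq by (auto simp: g_def)
    let ?G = "\<lambda>p. case p of Face_pt d z \<Rightarrow> if d = c then g z else 0 | _ \<Rightarrow> 0"
    have "?G q = 0" by (cases q) (auto simp: g_def)
    moreover have "?G p = g z" using pc by simp
    ultimately have "?G p \<noteq> ?G q" using \<open>g z \<noteq> 0\<close> by simp
    with G show ?thesis by blast
  next
    fix e t assume pe: "p = Edge_pt e t" and nq: "\<nexists>c z. q = Face_pt c z"
    define g where "g x = (case x of Edge_pt e' s \<Rightarrow> if e' = e then
        s * (1 - s) * (if \<exists>t'. q = Edge_pt e t' then abs (s - (THE t'. q = Edge_pt e t')) else 1) else 0 | _ \<Rightarrow> 0)"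
      for x :: "('a, 'b, 'c) cpoint"
    have eq: "g \<circ> edge_char K d = (\<lambda>s. if d = e then
      s * (1 - s) * (if \<exists>t'. q = Edge_pt e t' then abs (s - (THE t'. q = Edge_pt e t')) else 1) else 0)" for d
      by (auto simp: g_def edge_char_def fun_eq_iff)
    have gg: "continuous_on {0..1} (g \<circ> edge_char K d)" for d unfolding eq
      by (cases "\<exists>t'. q = Edge_pt e t'"; cases "d = e") (auto intro!: continuous_intros)
    obtain G where G: "continuous_map (realization K) euclideanreal G"
      "\<And>v. G (Vert_pt v) = g (Vert_pt v)" "\<And>e t. G (Edge_pt e t) = g (Edge_pt e t)"
      using skeleton_function_extends[OF K, of g] gg by blast
    have t: "0 < t" "t < 1" using p pe by (auto simp: points_eq)
    then have "G p \<noteq> 0" using pe pq by (auto simp: G g_def)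
    moreover have "G q = 0" using nq by (cases q) (auto simp: G g_def)
    ultimately show ?thesis using G by auto
  next
    fix v w assume pv: "p = Vert_pt v" "q = Vert_pt w"
    \<comment> \<open>The piecewise linear hat function at \<open>v\<close>; a loop at
      \<open>v\<close> gets the constant 1.\<close>
    define g where "g x = (case x of Vert_pt v' \<Rightarrow> of_bool (v' = v)
       | Edge_pt e s \<Rightarrow> (1 - s) * of_bool (src K e = v) + s * of_bool (tgt K e = v) | _ \<Rightarrow> 0)"
      for x :: "('a, 'b, 'c) cpoint"
    have eq: "g \<circ> edge_char K d = (\<lambda>s. (1 - s) * of_bool (src K d = v) + s * of_bool (tgt K d = v))" for d
      by (auto simp: g_def edge_char_def fun_eq_iff)
    have gg: "continuous_on {0..1} (g \<circ> edge_char K d)" for d unfolding eq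
      by (auto intro!: continuous_intros)
    obtain G where G: "continuous_map (realization K) euclideanreal G"
      "\<And>v. G (Vert_pt v) = g (Vert_pt v)" "\<And>e t. G (Edge_pt e t) = g (Edge_pt e t)"
      using skeleton_function_extends[OF K, of g] gg by blast
    have "G p \<noteq> G q" using pv pq by (auto simp: G g_def)
    then show ?thesis using G by auto
  qed
  have sep': "\<exists>G. continuous_map (realization K) euclideanreal G \<and> G p \<noteq> G q"
    if "p \<in> points K" "q \<in> points K" "p \<noteq> q" for p q
  proof -
    consider "(\<exists>c z. p = Face_pt c z) \<or> (\<exists>e t. p = Edge_pt e t) \<and> (\<nexists>c z. q = Face_pt c z)
         \<or> (\<exists>v w. p = Vert_pt v \<and> q = Vert_pt w)"
      | "(\<exists>c z. q = Face_pt c z) \<or> (\<exists>e t. q = Edge_pt e t) \<and> (\<nexists>c z. p = Face_pt c z)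
         \<or> (\<exists>v w. q = Vert_pt v \<and> p = Vert_pt w)"
      by (cases p; cases q) simp_all
    then show ?thesis
    proof cases
      case 1
      then show ?thesis by (rule sep[OF that])
    next
      case 2
      then show ?thesis using sep[OF that(2,1) that(3)[symmetric]] by metis
    qed
  qed
  show ?thesis
    unfolding Hausdorff_space_def
  proof (intro allI impI)
    fix p q assume "p \<in> topspace (realization K) \<and> q \<in> topspace (realization K) \<and> p \<noteq> q"
    then have pq: "p \<in> points K" "q \<in> points K" "p \<noteq> q" by (auto simp: topspace_realization K)
    then obtain G where G: "continuous_map (realization K) euclideanreal G" "G p \<noteq> G q"
      using sep' by blast
    obtain U V where UV: "open U" "open V" "G p \<in> U" "G q \<in> V" "U \<inter> V = {}"
      using hausdorff[OF G(2)] by blast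
    define U' where "U' = {x \<in> topspace (realization K). G x \<in> U}"
    define V' where "V' = {x \<in> topspace (realization K). G x \<in> V}"
    have "openin (realization K) U'" "openin (realization K) V'"
      unfolding U'_def V'_def using UV by (auto intro!: openin_continuous_map_preimage[OF G(1)])
    moreover have "p \<in> U'" "q \<in> V'" "disjnt U' V'"
      using pq UV by (auto simp: U'_def V'_def topspace_realization[OF K] disjnt_iff)
    ultimately show "\<exists>U V. openin (realization K) U \<and> openin (realization K) V \<and> p \<in> U \<and> q \<in> V \<and> disjnt U V"
      by blast
  qed
qed

section \<open>Forests and homogeneous linear systems\<close>

text \<open>Without a leaf, a walk can go on forever: every edge can be left through its other end
  by a different edge. As there are finitely many vertices, one is revisited, and a shortest return
  is a cycle.\<close>

lemma no_cycles_leaf: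
  assumes nc: "no_cycles E" and S: "S \<subseteq> {..<length E}" "S \<noteq> {}"
  shows "\<exists>i\<in>S. \<exists>w\<in>{fst (E ! i), snd (E ! i)}. fst (E ! i) \<noteq> snd (E ! i) \<and>
    (\<forall>j\<in>S. w \<in> {fst (E ! j), snd (E ! j)} \<longrightarrow> j = i)" (is ?thesis)
proof (rule ccontr)
  assume contr: "\<not> ?thesis"
  define ends where "ends i = {fst (E ! i), snd (E ! i)}" for i
  have noloop: "fst (E ! i) \<noteq> snd (E ! i)" if "i \<in> S" for i
  proof
    assume "fst (E ! i) = snd (E ! i)"
    then have "is_cycle E [fst (E ! i)] [i]"
      using that S by (auto simp: is_cycle_def)
    then show False using nc by (auto simp: no_cycles_def)
  qed
  have other: "\<exists>j\<in>S. j \<noteq> i \<and> w \<in> ends j" if "i \<in> S" "w \<in> ends i" for i w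
    using contr that noloop[of i] unfolding ends_def by blast
  \<comment> \<open>A state is an edge with the end through which it is left. The next edge contains
    this end, differs from the previous edge, and is left through its other end.\<close>
  define Q where "Q = (\<lambda>(i, w) (j, w'). j \<noteq> i \<and> w \<noteq> w' \<and> ends j = {w, w'})"
  obtain i0 where i0: "i0 \<in> S" using S by blast
  obtain f where f: "\<And>n. fst (f n) \<in> S \<and> snd (f n) \<in> ends (fst (f n))" "\<And>n. Q (f n) (f (Suc n))"
  proof (rule dependent_nat_choice[of "\<lambda>_ (i, w). i \<in> S \<and> w \<in> ends i" "\<lambda>_. Q", THEN exE])
    show "\<exists>x. case x of (i, w) \<Rightarrow> i \<in> S \<and> w \<in> ends i"
      using i0 by (auto simp: ends_def)
  next
    fix x :: "nat \<times> 'a" and n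
    assume "case x of (i, w) \<Rightarrow> i \<in> S \<and> w \<in> ends i"
    then obtain i w where x: "x = (i, w)" "i \<in> S" "w \<in> ends i" by (cases x) auto
    then obtain j where j: "j \<in> S" "j \<noteq> i" "w \<in> ends j" using other by blast
    then have "\<exists>w'. w' \<noteq> w \<and> ends j = {w, w'}"
      using noloop[of j] unfolding ends_def by (metis doubleton_eq_iff insert_commute insert_iff singletonD)
    then obtain w' where "w' \<noteq> w" "ends j = {w, w'}" by blast
    then show "\<exists>y. (case y of (i, w) \<Rightarrow> i \<in> S \<and> w \<in> ends i) \<and> Q x y"
      using x j by (intro exI[of _ "(j, w')"]) (auto simp: Q_def)
  qed (auto simp: split_beta)
  define w where "w n = snd (f n)" for n
  define i where "i n = fst (f n)" for n
  have ends: "ends (i (Suc n)) = {w n, w (Suc n)}" and i_ne: "i (Suc n) \<noteq> i n" for n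
    using f(2)[of n] by (auto simp: Q_def w_def i_def split_beta)
  have iS: "i n \<in> S" for n using f(1) by (simp add: i_def)
  have "finite (\<Union>i\<in>S. ends i)" using S finite_subset by (auto simp: ends_def)
  moreover have "range w \<subseteq> (\<Union>i\<in>S. ends i)" using f(1) by (auto simp: w_def)
  ultimately have "\<not> inj w" using finite_subset range_inj_infinite by blast
  then obtain a b where "a < b" "w a = w b"
    by (metis injI linorder_neqE_nat)
  then have ex: "\<exists>d>0. \<exists>p. w p = w (p + d)"
    by (intro exI[of _ "b - a"] conjI exI[of _ a]) auto
  \<comment> \<open>The least distance between two visits to the same vertex over the whole walk, so
    any \<open>d\<close> consecutive vertices are distinct.\<close>
  define d where "d = (LEAST d. d > 0 \<and> (\<exists>p. w p = w (p + d)))"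
  obtain p where p: "d > 0" "w p = w (p + d)"
    using LeastI_ex[OF ex] unfolding d_def[symmetric] by blast
  have inj: "a = b" if "w a = w b" "a \<le> b" "b < a + d" for a b
  proof (rule ccontr)
    assume "a \<noteq> b"
    then have "d \<le> b - a" unfolding d_def
      by (intro Least_le) (use that in \<open>auto intro!: exI[of _ a]\<close>)
    then show False using that by auto
  qed
  define vs where "vs = map (\<lambda>j. w (p + j)) [0..<d]"
  define es where "es = map (\<lambda>j. i (Suc (p + j))) [0..<d]"
  have inj': "j = k" if "w (p + j) = w (p + k)" "j < d" "k < d" for j k
    using inj[of "p + j" "p + k"] inj[of "p + k" "p + j"] that by (cases "j \<le> k") auto
  have "distinct vs"
    unfolding vs_def distinct_map by (auto intro!: inj_onI dest: inj')
  have wrap: "w (p + (Suc j mod d)) = w (Suc (p + j))" if "j < d" for j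
    using that p by (cases "Suc j = d") auto
  \<comment> \<open>As the vertices of the window are distinct, two visits to one edge would have to
    be consecutive; but consecutive edges of the walk differ.\<close>
  have ine: "i (Suc (p + j)) \<noteq> i (Suc (p + k))" if "j < k" "k < d" for j k
  proof
    assume "i (Suc (p + j)) = i (Suc (p + k))"
    then have eq: "{w (p + j), w (Suc (p + j))} = {w (p + k), w (Suc (p + k))}"
      using ends by metis
    have "w (p + j) \<noteq> w (p + k)" using inj'[of j k] that by auto
    then have "w (p + Suc j) = w (p + k)" using eq by (auto simp: doubleton_eq_iff)
    then have "Suc j = k" using inj'[of "Suc j" k] that by simp
    then show False using i_ne[of "p + Suc j"] \<open>i (Suc (p + j)) = i (Suc (p + k))\<close> by auto
  qed
  have "distinct es"
    unfolding es_def distinct_map by (auto intro!: inj_onI) (metis ine linorder_neqE_nat)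
  have "is_cycle E vs es"
    unfolding is_cycle_def
  proof (intro conjI allI impI)
    fix j assume "j < length vs"
    then have j: "j < d" by (simp add: vs_def)
    then have "Suc j mod d < d" by simp
    then show "{fst (E ! (es ! j)), snd (E ! (es ! j))} = {vs ! j, vs ! (Suc j mod length vs)}"
      using ends[of "p + j"] wrap j by (simp add: vs_def es_def ends_def)
  qed (use p iS S \<open>distinct vs\<close> \<open>distinct es\<close> in \<open>auto simp: vs_def es_def\<close>)
  then show False using nc by (auto simp: no_cycles_def)
qed

text \<open>Fraction-free Gaussian elimination, by induction on the equations: a nonzero pivot
  eliminates one unknown from the other equations by cross-multiplication.\<close>

lemma underdetermined_system:
  fixes a :: "'i \<Rightarrow> 'n \<Rightarrow> 'r::idom"
  assumes "finite I" "finite N" "card I < card N"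
  shows "\<exists>x. (\<exists>n\<in>N. x n \<noteq> 0) \<and> (\<forall>i\<in>I. (\<Sum>n\<in>N. a i n * x n) = 0)"
  using assms
proof (induction I arbitrary: N a rule: finite_induct)
  case empty
  then have "N \<noteq> {}" by auto
  then show ?case by (auto intro!: exI[of _ "\<lambda>_. 1"])
next
  case (insert i I)
  show ?case
  proof (cases "\<forall>n\<in>N. a i n = 0")
    case True
    obtain x where "\<exists>n\<in>N. x n \<noteq> 0" "\<forall>i\<in>I. (\<Sum>n\<in>N. a i n * x n) = 0"
      using insert.IH[of N a] insert.hyps insert.prems by auto
    then show ?thesis using True by (intro exI[of _ x]) auto
  next
    case False
    then obtain m where m: "m \<in> N" "a i m \<noteq> 0" by blast
    have "card I < card (N - {m})" using insert m by auto
    then obtain x where x: "\<exists>n\<in>N-{m}. x n \<noteq> 0"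
        "\<forall>j\<in>I. (\<Sum>n\<in>N-{m}. (a i m * a j n - a j m * a i n) * x n) = 0"
      using insert.IH[of "N - {m}" "\<lambda>j n. a i m * a j n - a j m * a i n"] insert.prems(1)
      by blast
    \<comment> \<open>Back substitution: the reduced solution is scaled by the pivot, so that the
      eliminated unknown is found without division.\<close>
    define y where "y n = (if n = m then - (\<Sum>n\<in>N-{m}. a i n * x n) else a i m * x n)" for n
    have split: "(\<Sum>n\<in>N. a j n * y n) =
        a i m * (\<Sum>n\<in>N-{m}. a j n * x n) - a j m * (\<Sum>n\<in>N-{m}. a i n * x n)" for j
    proof -
      have "(\<Sum>n\<in>N. a j n * y n) = a j m * y m + (\<Sum>n\<in>N-{m}. a j n * y n)"
        using m insert.prems by (simp add: sum.remove)
      also have "(\<Sum>n\<in>N-{m}. a j n * y n) = (\<Sum>n\<in>N-{m}. a i m * (a j n * x n))"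
        by (intro sum.cong) (auto simp: y_def)
      finally show ?thesis by (simp add: y_def sum_distrib_left)
    qed
    have "\<forall>j\<in>insert i I. (\<Sum>n\<in>N. a j n * y n) = 0"
      unfolding split using x(2) by (auto simp: sum_distrib_left sum_subtractf algebra_simps)
    moreover have "\<exists>n\<in>N. y n \<noteq> 0" using x(1) m by (auto simp: y_def)
    ultimately show ?thesis by blast
  qed
qed

section \<open>Complexes built from bigons\<close>

definition directed_path :: "('e \<Rightarrow> 'v) \<Rightarrow> ('e \<Rightarrow> 'v) \<Rightarrow> 'e list \<Rightarrow> bool" where
  "directed_path s t p \<longleftrightarrow> p \<noteq> [] \<and> (\<forall>i. Suc i < length p \<longrightarrow> t (p ! i) = s (p ! Suc i))"

text \<open>Every 2-cell is bounded by two directed paths of the same length with common end points,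
  with respect to an orientation \<open>s, t\<close> of the edges which need not be that of \<open>K\<close>. The last
  condition says that the graphs formed by the initial edges of these paths are forests.\<close>

definition bigon_complex :: "('v, 'e, 'f) complex2 \<Rightarrow> ('e \<Rightarrow> 'v) \<Rightarrow> ('e \<Rightarrow> 'v) \<Rightarrow>
    ('f \<Rightarrow> 'e list) \<Rightarrow> ('f \<Rightarrow> 'e list) \<Rightarrow> bool" where
  "bigon_complex K s t \<alpha> \<beta> \<longleftrightarrow>
     two_complex K \<and> finite (verts K) \<and> finite (edges K) \<and> finite (faces K) \<and>
     connected_space (realization K) \<and>
     (\<forall>e\<in>edges K. s e = src K e \<and> t e = tgt K e \<or> s e = tgt K e \<and> t e = src K e) \<and>
     (\<forall>c\<in>faces K. directed_path s t (\<alpha> c) \<and> directed_path s t (\<beta> c) \<and>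
        length (\<alpha> c) = length (\<beta> c) \<and>
        s (hd (\<alpha> c)) = s (hd (\<beta> c)) \<and> t (last (\<alpha> c)) = t (last (\<beta> c)) \<and>
        mset (map fst (bdry K c)) = mset (\<alpha> c) + mset (\<beta> c)) \<and>
     (\<forall>C. C \<subseteq> faces K \<and> C \<noteq> {} \<longrightarrow>
        (\<exists>c\<in>C. \<exists>e\<in>{hd (\<alpha> c), hd (\<beta> c)}. hd (\<alpha> c) \<noteq> hd (\<beta> c) \<and>
           (\<forall>c'\<in>C. e \<in> {hd (\<alpha> c'), hd (\<beta> c')} \<longrightarrow> c' = c)))"

lemma bigon_complexD:
  assumes "bigon_complex K s t \<alpha> \<beta>"
  shows "two_complex K" "finite (verts K)" "finite (edges K)" "finite (faces K)"
    "connected_space (realization K)"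
    "\<And>e. e \<in> edges K \<Longrightarrow> s e = src K e \<and> t e = tgt K e \<or> s e = tgt K e \<and> t e = src K e"
    "\<And>c. c \<in> faces K \<Longrightarrow> directed_path s t (\<alpha> c)"
    "\<And>c. c \<in> faces K \<Longrightarrow> directed_path s t (\<beta> c)"
    "\<And>c. c \<in> faces K \<Longrightarrow> length (\<alpha> c) = length (\<beta> c)"
    "\<And>c. c \<in> faces K \<Longrightarrow> s (hd (\<alpha> c)) = s (hd (\<beta> c))"
    "\<And>c. c \<in> faces K \<Longrightarrow> t (last (\<alpha> c)) = t (last (\<beta> c))"
    "\<And>c. c \<in> faces K \<Longrightarrow> mset (map fst (bdry K c)) = mset (\<alpha> c) + mset (\<beta> c)"
    "\<And>C. C \<subseteq> faces K \<Longrightarrow> C \<noteq> {} \<Longrightarrow> \<exists>c\<in>C. \<exists>e\<in>{hd (\<alpha> c), hd (\<beta> c)}. hd (\<alpha> c) \<noteq> hd (\<beta> c) \<and>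
           (\<forall>c'\<in>C. e \<in> {hd (\<alpha> c'), hd (\<beta> c')} \<longrightarrow> c' = c)"
  using assms unfolding bigon_complex_def by - (elim conjE; (assumption | drule (1) bspec, elim conjE, assumption | drule (1) bspec, assumption | blast))+

lemma bigon_edges:
  assumes "bigon_complex K s t \<alpha> \<beta>" "c \<in> faces K"
  shows "set (\<alpha> c) \<subseteq> edges K" "set (\<beta> c) \<subseteq> edges K"
proof -
  have "set_mset (mset (map fst (bdry K c))) = set (\<alpha> c) \<union> set (\<beta> c)"
    using bigon_complexD(12)[OF assms] by simp
  moreover have "set (map fst (bdry K c)) \<subseteq> edges K"
    using bigon_complexD(1)[OF assms(1)] assms(2) by (fastforce simp: two_complex_def closed_edge_path_def)
  ultimately show "set (\<alpha> c) \<subseteq> edges K" "set (\<beta> c) \<subseteq> edges K" by auto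
qed

text \<open>The end of each edge carries the same power of \<open>x\<close> as the start of the next
  one, so only the two ends of the path survive. Paths of equal length with common ends therefore
  have equal sums.\<close>

lemma directed_path_telescope:
  fixes x :: "'r::comm_ring_1"
  assumes "directed_path s t p"
  shows "(\<Sum>i<length p. x ^ i * (x * y (t (p ! i)) - y (s (p ! i)))) =
    x ^ length p * y (t (last p)) - y (s (hd p))"
proof -
  define f where "f i = x ^ i * (if i < length p then y (s (p ! i)) else y (t (last p)))" for i
  have "t (p ! i) = (if Suc i < length p then s (p ! Suc i) else t (last p))" if "i < length p" for i
  proof (cases "Suc i < length p")
    case True
    then show ?thesis using assms by (simp add: directed_path_def)
  next
    case False
    then have "i = length p - 1" using that by auto
    then show ?thesis using False that last_conv_nth[of p] by (cases "p = []") auto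
  qed
  then have "x ^ i * (x * y (t (p ! i)) - y (s (p ! i))) = f (Suc i) - f i" if "i < length p" for i
    using that by (auto simp: f_def algebra_simps)
  then have "(\<Sum>i<length p. x ^ i * (x * y (t (p ! i)) - y (s (p ! i)))) = f (length p) - f 0"
    by (simp add: sum_lessThan_telescope)
  also have "\<dots> = x ^ length p * y (t (last p)) - y (s (hd p))"
    using assms by (auto simp: f_def directed_path_def hd_conv_nth)
  finally show ?thesis .
qed

text \<open>Otherwise the cells over \<open>S\<close> and those over the remaining vertices would
  form two disjoint nonempty open sets: all corners of a cell lie on the same side, because its
  boundary runs through edges.\<close>

lemma connected_realization_verts:
  assumes K: "two_complex K" and conn: "connected_space (realization K)"
    and S: "S \<subseteq> verts K" "S \<noteq> {}"
    and closed: "\<And>e. e \<in> edges K \<Longrightarrow> src K e \<in> S \<longleftrightarrow> tgt K e \<in> S"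
  shows "S = verts K"
proof (rule ccontr)
  assume ne: "S \<noteq> verts K"
  \<comment> \<open>Any corner of the cell would serve; the source of an edge and the first corner
    of a face are chosen.\<close>
  define side where "side S' p = (case p of Vert_pt v \<Rightarrow> v \<in> S' | Edge_pt e t \<Rightarrow> src K e \<in> S'
     | Face_pt c z \<Rightarrow> init_vert K (bdry K c ! 0) \<in> S')" for S' p
  define V where "V S' = {p \<in> points K. side S' p}" for S'
  have op: "openin (realization K) (V S')"
    if cl: "\<And>e. e \<in> edges K \<Longrightarrow> src K e \<in> S' \<longleftrightarrow> tgt K e \<in> S'" for S'
  proof -
    have e: "edge_char K e t \<in> V S' \<longleftrightarrow> src K e \<in> S'" if "e \<in> edges K" "t \<in> {0..1}" for e t
      using edge_char_points[OF K that] cl[OF that(1)] by (auto simp: V_def edge_char_def side_def)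
    have f: "face_char K c z \<in> V S' \<longleftrightarrow> init_vert K (bdry K c ! 0) \<in> S'"
      if c: "c \<in> faces K" "z \<in> cball 0 1" for c z
    proof (cases "norm z < 1")
      case True
      then show ?thesis using face_char_points[OF K c] by (simp add: V_def face_char_def side_def)
    next
      case False
      have ends: "init_vert K l \<in> S' \<longleftrightarrow> src K (fst l) \<in> S'" "term_vert K l \<in> S' \<longleftrightarrow> src K (fst l) \<in> S'"
        if "fst l \<in> edges K" for l
        using cl[OF that] by (auto simp: init_vert_def term_vert_def split_beta)
      have init: "init_vert K (bdry K c ! k) \<in> S' \<longleftrightarrow> init_vert K (bdry K c ! 0) \<in> S'"
        if "k < length (bdry K c)" for k
        using that
      proof (induction k)
        case (Suc k)
        then have "term_vert K (bdry K c ! k) = init_vert K (bdry K c ! (Suc k mod length (bdry K c)))"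
          using K c(1) by (auto simp: two_complex_def closed_edge_path_def)
        with Suc.prems have "term_vert K (bdry K c ! k) = init_vert K (bdry K c ! Suc k)" by simp
        moreover have "fst (bdry K c ! k) \<in> edges K" using bdry_edge[OF K c(1)] Suc.prems by simp
        note ends[OF this]
        moreover have "init_vert K (bdry K c ! k) \<in> S' \<longleftrightarrow> init_vert K (bdry K c ! 0) \<in> S'"
          using Suc by simp
        ultimately show ?case by simp
      qed simp
      have z: "norm z = 1" using False c(2) by simp
      obtain k \<tau> where k: "k < length (bdry K c)" "0 \<le> \<tau>" "\<tau> < 1"
        "z = circ (length (bdry K c)) (real k + \<tau>)"
        by (rule circ_cover[OF z bdry_nonempty[OF K c(1)]])
      have "face_char K c z = edge_char K (fst (bdry K c ! k)) (if snd (bdry K c ! k) then \<tau> else 1 - \<tau>)"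
        using face_char_circ_less[OF HOL.refl k(1-3)] k(4) by (simp add: letter_char_def)
      then show ?thesis
        using e[OF bdry_edge[OF K c(1) k(1)], of "if snd (bdry K c ! k) then \<tau> else 1 - \<tau>"] k(2,3)
          init[OF k(1)] ends(1)[OF bdry_edge[OF K c(1) k(1)]] by (simp split: if_splits)
    qed
    have "{t \<in> {0..1}. edge_char K e t \<in> V S'} = (if src K e \<in> S' then {0..1} else {})"
      if "e \<in> edges K" for e using e[OF that] by auto
    moreover have "{z \<in> cball 0 1. face_char K c z \<in> V S'} =
        (if init_vert K (bdry K c ! 0) \<in> S' then cball 0 1 else {})"
      if "c \<in> faces K" for c using f[OF that] by auto
    ultimately show ?thesis
      unfolding openin_realization open_in_complex_def
      by (simp add: V_def del: mem_cball mem_cball_0 atLeastAtMost_iff)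
  qed
  have st: "src K e \<in> verts K" "tgt K e \<in> verts K" if "e \<in> edges K" for e
    using K that by (auto simp: two_complex_def)
  have bs: "init_vert K (bdry K c ! 0) \<in> verts K" if "c \<in> faces K" for c
    using st bdry_edge[OF K that, of 0] bdry_nonempty[OF K that]
    by (auto simp: init_vert_def split_beta)
  have "openin (realization K) (V S)" by (rule op[OF closed])
  moreover have "openin (realization K) (V (verts K - S))" by (rule op) (use closed st in blast)
  moreover have "topspace (realization K) \<subseteq> V S \<union> V (verts K - S)"
    using st bs by (auto simp: topspace_realization[OF K] V_def side_def points_eq)
  moreover have "V S \<inter> V (verts K - S) = {}"
  proof -
    have False if "p \<in> V S" "p \<in> V (verts K - S)" for p
      using that by (cases p) (auto simp: V_def side_def)
    then show ?thesis by blast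
  qed
  moreover have "V S \<noteq> {}" "V (verts K - S) \<noteq> {}"
  proof -
    obtain v w where "v \<in> S" "w \<in> verts K - S" using S ne by blast
    then have "Vert_pt v \<in> V S" "Vert_pt w \<in> V (verts K - S)"
      using S by (auto simp: V_def side_def points_eq)
    then show "V S \<noteq> {}" "V (verts K - S) \<noteq> {}" by blast+
  qed
  ultimately show False using conn unfolding connected_space_def by blast
qed

lemma euler_char_nonpos_no_height:
  assumes K: "bigon_complex K s t \<alpha> \<beta>"
    and nh: "\<nexists>h :: 'v \<Rightarrow> int. \<forall>e\<in>edges K. h (t e) = h (s e) + 1"
  shows "euler_char (K :: ('v, 'e, 'f) complex2) \<le> 0"
proof (rule ccontr)
  assume "\<not> euler_char K \<le> 0"
  note bd = bigon_complexD[OF K]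
  have st: "s e \<in> verts K" "t e \<in> verts K" if "e \<in> edges K" for e
    using bd(6)[OF that] bd(1) that by (auto simp: two_complex_def)
  define X where "X = [:0, 1::int:]"
  \<comment> \<open>The coefficient of \<open>e\<close> in the twisted boundary of \<open>c\<close>:
    the i-th edge of a side counts with \<open>X ^ i\<close>, the exponent being its distance from
    the bottom vertex.\<close>
  define B where "B c e = (\<Sum>i<length (\<alpha> c). if \<alpha> c ! i = e then X ^ i else 0)
      - (\<Sum>i<length (\<beta> c). if \<beta> c ! i = e then X ^ i else 0)" for c e
  \<comment> \<open>One unknown for each face and each vertex, against one equation for each
    edge.\<close>
  define N where "N = faces K <+> verts K"
  define a where "a e n = (case n of Inl c \<Rightarrow> B c e | Inr v \<Rightarrow> X * of_bool (t e = v) - of_bool (s e = v))" for e n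
  have "card (edges K) < card N"
    using \<open>\<not> euler_char K \<le> 0\<close> bd(2,4) by (simp add: N_def card_Plus euler_char_def)
  then obtain z where z: "\<exists>n\<in>N. z n \<noteq> 0" "\<And>e. e \<in> edges K \<Longrightarrow> (\<Sum>n\<in>N. a e n * z n) = 0"
    using underdetermined_system[of "edges K" N a] bd(2-4) by (auto simp: N_def)
  define x where "x c = z (Inl c)" for c
  define y where "y v = z (Inr v)" for v
  define \<delta> where "\<delta> e = X * y (t e) - y (s e)" for e
  define D where "D e = (\<Sum>c\<in>faces K. B c e * x c)" for e
  have D\<delta>: "D e = - \<delta> e" if e: "e \<in> edges K" for e
  proof -
    have "(\<Sum>n\<in>N. a e n * z n) = D e + (\<Sum>v\<in>verts K. (X * of_bool (t e = v) - of_bool (s e = v)) * y v)"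
      using bd(2,4) by (simp add: N_def sum.Plus a_def D_def x_def y_def)
    also have "(\<Sum>v\<in>verts K. (X * of_bool (t e = v) - of_bool (s e = v)) * y v) = \<delta> e"
      using st[OF e] bd(2) by (simp add: left_diff_distrib sum_subtractf mult.assoc
          sum_distrib_left[symmetric] \<delta>_def of_bool_def if_distrib[of "\<lambda>x. x * _"] cong: if_cong)
    finally show ?thesis using z(2)[OF e] by (simp add: eq_neg_iff_add_eq_0)
  qed
  have path: "(\<Sum>e\<in>edges K. (\<Sum>i<length p. if p ! i = e then X ^ i else 0) * \<delta> e) =
      X ^ length p * y (t (last p)) - y (s (hd p))" if p: "directed_path s t p" "set p \<subseteq> edges K" for p
  proof -
    have "(\<Sum>e\<in>edges K. (\<Sum>i<length p. if p ! i = e then X ^ i else 0) * \<delta> e) =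
       (\<Sum>i<length p. \<Sum>e\<in>edges K. if p ! i = e then X ^ i * \<delta> e else 0)"
      by (subst sum.swap) (auto simp: sum_distrib_right intro!: sum.cong)
    also have "\<dots> = (\<Sum>i<length p. X ^ i * \<delta> (p ! i))"
      using p(2) bd(3) by (intro sum.cong) (auto simp: subset_iff)
    also have "\<dots> = X ^ length p * y (t (last p)) - y (s (hd p))"
      unfolding \<delta>_def by (rule directed_path_telescope[OF p(1)])
    finally show ?thesis .
  qed
  \<comment> \<open>The coboundary of \<open>y\<close> is orthogonal to twisted boundaries: both
    sides of the bigon telescope to the same value, which is where the equality of their lengths
    enters.\<close>
  have "(\<Sum>e\<in>edges K. B c e * \<delta> e) = 0" if c: "c \<in> faces K" for c
    unfolding B_def left_diff_distrib sum_subtractf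
    using path[OF bd(7)[OF c] bigon_edges(1)[OF K c]] path[OF bd(8)[OF c] bigon_edges(2)[OF K c]]
      bd(9-11)[OF c] by simp
  then have "(\<Sum>e\<in>edges K. D e * \<delta> e) = 0"
    unfolding D_def sum_distrib_right
    by (subst sum.swap) (simp add: mult.assoc mult.left_commute[of _ "x _"] sum_distrib_left[symmetric])
  then have "(\<Sum>e\<in>edges K. (D e)\<^sup>2) = 0"
    using D\<delta> by (simp add: power2_eq_square sum_negf)
  \<comment> \<open>Squares are nonnegative in the ordered ring of integer polynomials, so each term
    of the sum vanishes.\<close>
  then have D0: "D e = 0" if "e \<in> edges K" for e
    using that bd(3) by (simp add: sum_nonneg_eq_0_iff)
  have y0: "y v = 0" if "v \<in> verts K" for v
  proof (rule ccontr)
    assume "y v \<noteq> 0"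
    \<comment> \<open>Since \<delta> y = 0, going along an edge removes a factor \<open>X\<close>
      from \<open>y\<close>. By connectedness \<open>y\<close> vanishes nowhere, and minus its
      degree is a height function.\<close>
    have ys: "y (s e) = pCons 0 (y (t e))" if "e \<in> edges K" for e
      using D\<delta>[OF that] D0[OF that] by (simp add: \<delta>_def X_def)
    have "{v \<in> verts K. y v \<noteq> 0} = verts K"
    proof (rule connected_realization_verts[OF bd(1,5)])
      show "{v \<in> verts K. y v \<noteq> 0} \<noteq> {}" using that \<open>y v \<noteq> 0\<close> by auto
    next
      fix e assume e: "e \<in> edges K"
      show "src K e \<in> {v \<in> verts K. y v \<noteq> 0} \<longleftrightarrow> tgt K e \<in> {v \<in> verts K. y v \<noteq> 0}"
        using bd(6)[OF e] ys[OF e] st[OF e] by auto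
    qed auto
    then have "\<forall>e\<in>edges K. - int (degree (y (t e))) = - int (degree (y (s e))) + 1"
      using st ys by (auto simp: degree_pCons_eq)
    then have "\<exists>h :: 'v \<Rightarrow> int. \<forall>e\<in>edges K. h (t e) = h (s e) + 1"
      by (intro exI[of _ "\<lambda>v. - int (degree (y v))"])
    then show False using nh by contradiction
  qed
  obtain c m where "c \<in> faces K" "coeff (x c) m \<noteq> 0"
    using z(1) y0 by (auto simp: N_def x_def y_def poly_eq_iff)
  then have ex: "\<exists>m. \<exists>c\<in>faces K. coeff (x c) m \<noteq> 0" by blast
  \<comment> \<open>The lowest order occurring in \<open>x\<close>. At order \<open>m\<close> only
    the constant terms of \<open>B\<close> contribute, that is, the initial edges of the two sides;
    a leaf among the faces of \<open>C\<close> then leaves a single nonzero term.\<close>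
  define m where "m = (LEAST m. \<exists>c\<in>faces K. coeff (x c) m \<noteq> 0)"
  have low: "coeff (x c) j = 0" if "c \<in> faces K" "j < m" for c j
    using not_less_Least[of j "\<lambda>m. \<exists>c\<in>faces K. coeff (x c) m \<noteq> 0"] that by (auto simp: m_def)
  define C where "C = {c \<in> faces K. coeff (x c) m \<noteq> 0}"
  have "C \<subseteq> faces K" "C \<noteq> {}" using LeastI_ex[OF ex] by (auto simp: C_def m_def)
  from bd(13)[OF this] obtain c e where "c \<in> C" "e \<in> {hd (\<alpha> c), hd (\<beta> c)}"
      and e: "hd (\<alpha> c) \<noteq> hd (\<beta> c) \<and> (\<forall>c'\<in>C. e \<in> {hd (\<alpha> c'), hd (\<beta> c')} \<longrightarrow> c' = c)"
    by (rule bexE) (erule bexE, rule that)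
  note ce = this(1,2) conjunct1[OF e] conjunct2[OF e]
  have c: "c \<in> faces K" using ce(1) by (simp add: C_def)
  have ne: "\<alpha> c \<noteq> []" "\<beta> c \<noteq> []" if "c \<in> faces K" for c
    using bd(7,8)[OF that] by (auto simp: directed_path_def)
  have B0: "coeff (B c' e) 0 = of_bool (hd (\<alpha> c') = e) - of_bool (hd (\<beta> c') = e)"
    if c': "c' \<in> faces K" for c'
  proof -
    have "poly (\<Sum>i<length p. if p ! i = e then X ^ i else 0) 0 = of_bool (hd p = e)" if "p \<noteq> []" for p
    proof -
      have "poly (\<Sum>i<length p. if p ! i = e then X ^ i else 0) 0 =
          (\<Sum>i<length p. if i = 0 then of_bool (p ! i = e) else 0)"
        unfolding poly_sum by (intro sum.cong) (auto simp: X_def power_0_left)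
      also have "\<dots> = of_bool (hd p = e)" using that by (simp add: hd_conv_nth)
      finally show ?thesis .
    qed
    then show ?thesis using ne[OF c'] by (simp add: poly_0_coeff_0[symmetric] B_def)
  qed
  have lead: "coeff (B c' e * x c') m = coeff (B c' e) 0 * coeff (x c') m" if "c' \<in> faces K" for c'
  proof -
    have "coeff (B c' e * x c') m = (\<Sum>i\<le>m. if i = 0 then coeff (B c' e) 0 * coeff (x c') m else 0)"
      unfolding coeff_mult using low[OF that] by (intro sum.cong) auto
    then show ?thesis by simp
  qed
  have "coeff (D e) m = (\<Sum>c'\<in>faces K. if c' = c then coeff (B c e) 0 * coeff (x c) m else 0)"
    unfolding D_def coeff_sum
  proof (intro sum.cong HOL.refl)
    fix c' assume c': "c' \<in> faces K"
    show "coeff (B c' e * x c') m = (if c' = c then coeff (B c e) 0 * coeff (x c) m else 0)"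
    proof (cases "c' \<in> C \<and> c' \<noteq> c")
      case True
      then have "e \<notin> {hd (\<alpha> c'), hd (\<beta> c')}" using ce(4) by blast
      then have "coeff (B c' e) 0 = 0" using B0[OF c'] by auto
      then show ?thesis using True lead[OF c'] by simp
    next
      case False
      then have "c' = c \<or> coeff (x c') m = 0" using c' by (auto simp: C_def)
      then show ?thesis using lead[OF c'] by auto
    qed
  qed
  also have "\<dots> \<noteq> 0"
  proof -
    have "coeff (B c e) 0 \<noteq> 0" using B0[OF c] ce(2,3) by auto
    moreover have "coeff (x c) m \<noteq> 0" using ce(1) by (simp add: C_def)
    ultimately show ?thesis using c bd(4) by simp
  qed
  finally have "coeff (D e) m \<noteq> 0" .
  moreover have "e \<in> edges K"
    using bigon_edges[OF K c] ne[OF c] ce(2) by (auto simp: subset_iff)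
  ultimately show False using D0 by simp
qed

section \<open>Collapses\<close>

text \<open>The tube lemma: the complement in \<open>D\<close> is the projection of a compact set,
  hence closed.\<close>

lemma tube_open:
  fixes g :: "real \<times> 'a::metric_space \<Rightarrow> 'z"
  assumes g: "continuous_map (top_of_set ({0..1} \<times> D)) Z g" and D: "compact D"
    and U: "openin Z U" and J: "compact J" "J \<subseteq> {0..1}"
  shows "openin (top_of_set D) {x \<in> D. \<forall>t\<in>J. g (t, x) \<in> U}"
proof -
  have "openin (top_of_set ({0..1} \<times> D)) {p \<in> {0..1} \<times> D. g p \<in> U}"
    using openin_continuous_map_preimage[OF g U] by simp
  from openin_closedin_eq[THEN iffD1, OF this]
  have "closedin (top_of_set ({0..1} \<times> D)) ({0..1} \<times> D - {p \<in> {0..1} \<times> D. g p \<in> U})"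
    by (simp only: topspace_euclidean_subtopology)
  then have "compact ({0..1} \<times> D - {p \<in> {0..1} \<times> D. g p \<in> U})"
    by (rule closedin_compact[OF compact_Times[OF compact_Icc D]])
  then have "compact (({0..1} \<times> D - {p \<in> {0..1} \<times> D. g p \<in> U}) \<inter> J \<times> D)"
    by (intro compact_Int compact_Times J D)
  then have "compact (snd ` (({0..1} \<times> D - {p \<in> {0..1} \<times> D. g p \<in> U}) \<inter> J \<times> D))"
    by (intro compact_continuous_image continuous_intros)
  moreover have "snd ` (({0..1} \<times> D - {p \<in> {0..1} \<times> D. g p \<in> U}) \<inter> J \<times> D) =
      D - {x \<in> D. \<forall>t\<in>J. g (t, x) \<in> U}"
    using J(2) by force
  ultimately have "compact (D - {x \<in> D. \<forall>t\<in>J. g (t, x) \<in> U})" by simp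
  then have "closedin (top_of_set D) (D - {x \<in> D. \<forall>t\<in>J. g (t, x) \<in> U})"
    by (intro closed_subset compact_imp_closed) auto
  then show ?thesis
    unfolding openin_closedin_eq topspace_euclidean_subtopology by blast
qed

text \<open>The product of the interval with the quotient topology of \<open>K\<close> is again a quotient topology,
  because the interval is locally compact.\<close>

lemma continuous_map_prod_realization:
  assumes K: "two_complex K"
    and v: "\<And>v. v \<in> verts K \<Longrightarrow> continuous_map (top_of_set {0..1}) Z (\<lambda>t. k (t, Vert_pt v))"
    and e: "\<And>e. e \<in> edges K \<Longrightarrow>
      continuous_map (top_of_set ({0..1} \<times> {0..1})) Z (\<lambda>p. k (fst p, edge_char K e (snd p)))"
    and c: "\<And>c. c \<in> faces K \<Longrightarrow>
      continuous_map (top_of_set ({0..1} \<times> cball 0 1)) Z (\<lambda>p. k (fst p, face_char K c (snd p)))"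
  shows "continuous_map (prod_topology (top_of_set {0..1::real}) (realization K)) Z k"
proof -
  have slice: "continuous_map (top_of_set {0..1}) Z (\<lambda>t. k (t, y))" if "y \<in> points K" for y
  proof -
    have *: "continuous_map (top_of_set {0..1}) Z (\<lambda>t. k (t, ch x))"
      if "continuous_map (top_of_set ({0..1} \<times> D)) Z (\<lambda>p. k (fst p, ch (snd p)))" "x \<in> D"
      for ch :: "'x::real_normed_vector \<Rightarrow> _" and x D
    proof -
      have "continuous_map (top_of_set {0..1}) (top_of_set ({0..1} \<times> D)) (\<lambda>t::real. (t, x))"
        using that(2) by (auto intro!: continuous_intros)
      from continuous_map_compose[OF this that(1)] show ?thesis by (simp add: o_def)
    qed
    show ?thesis
    proof (cases y)
      case (Vert_pt w)
      then show ?thesis using v that by (auto simp: points_eq)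
    next
      case (Edge_pt d x)
      then have "d \<in> edges K" "x \<in> {0..1}" "edge_char K d x = y"
        using that by (auto simp: points_eq edge_char_def)
      then show ?thesis using *[OF e, of d x] by simp
    next
      case (Face_pt d z)
      then have "d \<in> faces K" "z \<in> cball 0 1" "face_char K d z = y"
        using that by (auto simp: points_eq face_char_def)
      then show ?thesis using *[OF c, of d z] by simp
    qed
  qed
  show ?thesis
    unfolding continuous_map_def
  proof (intro conjI allI impI)
    show "k \<in> topspace (prod_topology (top_of_set {0..1}) (realization K)) \<rightarrow> topspace Z"
      using continuous_map_funspace[OF slice] by (auto simp: topspace_realization[OF K] Pi_iff)
  next
    fix U assume U: "openin Z U"
    let ?O = "{x \<in> topspace (prod_topology (top_of_set {0..1}) (realization K)). k x \<in> U}"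
    show "openin (prod_topology (top_of_set {0..1}) (realization K)) ?O"
      unfolding openin_prod_topology_alt
    proof (intro allI impI)
      fix t0 y assume "(t0, y) \<in> ?O"
      then have t0: "t0 \<in> {0..1}" and y: "y \<in> points K" and kU: "k (t0, y) \<in> U"
        by (auto simp: topspace_realization[OF K])
      have op: "openin (top_of_set {0..1}) {t \<in> {0..1}. k (t, y) \<in> U}"
        using openin_continuous_map_preimage[OF slice[OF y] U] by simp
      have "t0 \<in> {t \<in> {0..1}. k (t, y) \<in> U}" using t0 kU by simp
      from bspec[OF conjunct2[OF op[unfolded openin_euclidean_subtopology_iff]] this]
      obtain d where d: "d > 0" "\<forall>t\<in>{0..1}. dist t t0 < d \<longrightarrow> t \<in> {t \<in> {0..1}. k (t, y) \<in> U}"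
        by (elim exE conjE)
      \<comment> \<open>Local compactness of the interval: \<open>J\<close> is a compact
        neighbourhood of \<open>t0\<close> on which the slice through \<open>y\<close> stays in
        \<open>U\<close>. The tube lemma makes the condition defining \<open>V\<close> open in every
        closed cell.\<close>
      define J where "J = cball t0 (d / 2) \<inter> {0..1}"
      have J: "compact J" "J \<subseteq> {0..1}" by (auto simp: J_def intro!: compact_Int)
      define V where "V = {y \<in> points K. \<forall>t\<in>J. k (t, y) \<in> U}"
      have "{x \<in> {0..1}. edge_char K e x \<in> V} = {x \<in> {0..1}. \<forall>t\<in>J. k (t, edge_char K e x) \<in> U}"
        if "e \<in> edges K" for e using edge_char_points[OF K that] by (auto simp: V_def)
      moreover have "{x \<in> cball 0 1. face_char K c x \<in> V} =
          {x \<in> cball 0 1. \<forall>t\<in>J. k (t, face_char K c x) \<in> U}"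
        if "c \<in> faces K" for c using face_char_points[OF K that] by (auto simp: V_def)
      ultimately have "openin (realization K) V"
        using tube_open[OF e compact_Icc U J] tube_open[OF c compact_cball U J]
        by (simp add: openin_realization open_in_complex_def V_def
            del: mem_cball mem_cball_0 atLeastAtMost_iff)
      moreover have "openin (top_of_set {0..1}) (ball t0 (d / 2) \<inter> {0..1})"
        using openin_open_Int[OF open_ball, of "{0..1}"] by (metis Int_commute)
      moreover have "y \<in> V" using y d by (auto simp: V_def J_def dist_commute)
      moreover have "t0 \<in> ball t0 (d / 2) \<inter> {0..1}" using t0 d by auto
      moreover have "(ball t0 (d / 2) \<inter> {0..1}) \<times> V \<subseteq> ?O"
        by (auto simp: V_def J_def topspace_realization[OF K])
      ultimately show "\<exists>W V. openin (top_of_set {0..1}) W \<and> openin (realization K) V \<and>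
          t0 \<in> W \<and> y \<in> V \<and> W \<times> V \<subseteq> ?O"
        by (intro exI[of _ "ball t0 (d / 2) \<inter> {0..1}"] exI[of _ V] conjI)
    qed
  qed
qed

text \<open>The end map of \<open>k\<close> is a homotopy inverse of the inclusion: \<open>k\<close>
  deforms the identity of \<open>K\<close> into it, and it fixes \<open>L\<close> pointwise. It also
  exhibits \<open>L\<close> as a continuous image of \<open>K\<close>.\<close>

lemma deformation_retract_realization:
  assumes K: "two_complex K" and L: "two_complex L"
    and sub: "verts L \<subseteq> verts K" "edges L \<subseteq> edges K" "faces L \<subseteq> faces K"
    and char: "edge_char L = edge_char K" "face_char L = face_char K"
    and k: "continuous_map (prod_topology (top_of_set {0..1::real}) (realization K)) (realization K) k"
    and k0: "\<And>p. p \<in> points K \<Longrightarrow> k (0, p) = p"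
    and kL: "\<And>t p. p \<in> points L \<Longrightarrow> k (t, p) = p"
    and k1: "continuous_map (realization K) (realization L) (\<lambda>p. k (1, p))"
  shows "contractible_space (realization L) \<Longrightarrow> contractible_space (realization K)"
    and "connected_space (realization K) \<Longrightarrow> connected_space (realization L)"
proof -
  have i: "continuous_map (realization L) (realization K) id"
  proof (rule continuous_map_realization[OF L])
    show "continuous_map (top_of_set {0..1}) (realization K) (id \<circ> edge_char L e)" if "e \<in> edges L" for e
      using continuous_map_edge_char[OF K, of e] sub that by (auto simp: char)
    show "continuous_map (top_of_set (cball 0 1)) (realization K) (id \<circ> face_char L c)" if "c \<in> faces L" for c
      using continuous_map_face_char[OF K, of c] sub that by (auto simp: char)
  qed (use sub in \<open>auto simp: topspace_realization[OF K] points_eq\<close>)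
  have LK: "points L \<subseteq> points K" using sub by (auto simp: points_eq)
  have "homotopic_with (\<lambda>x. True) (realization K) (realization K) id (\<lambda>p. k (1, p))"
    unfolding homotopic_with_def
  proof (intro exI conjI allI ballI impI)
    \<comment> \<open>\<open>homotopic_with\<close> prescribes the two end maps on the whole type,
      so \<open>k\<close> is corrected off \<open>points K\<close>.\<close>
    let ?k = "\<lambda>p. if fst p = 0 \<and> snd p \<notin> points K then snd p else if snd p \<in> points K then k p else k (1, snd p)"
    show "continuous_map (prod_topology (top_of_set {0..1}) (realization K)) (realization K) ?k"
      by (rule continuous_map_eq[OF k]) (auto simp: topspace_realization[OF K])
    show "?k (0, x) = id x" for x using k0 by auto
    show "?k (1, x) = k (1, x)" for x by auto
  qed simp
  then have hK: "homotopic_with (\<lambda>x. True) (realization K) (realization K) (id \<circ> (\<lambda>p. k (1, p))) id"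
    by (simp add: homotopic_with_symD o_def)
  have hL: "homotopic_with (\<lambda>x. True) (realization L) (realization L) ((\<lambda>p. k (1, p)) \<circ> id) id"
    by (rule homotopic_with_equal) (auto simp: topspace_realization[OF L] kL continuous_map_compose[OF i k1, simplified])
  have "realization K homotopy_equivalent_space realization L"
    unfolding homotopy_equivalent_space_def using i k1 hK hL by blast
  then show "contractible_space (realization L) \<Longrightarrow> contractible_space (realization K)"
    using homotopy_equivalent_space_contractibility by blast
  assume "connected_space (realization K)"
  then have "connectedin (realization L) ((\<lambda>p. k (1, p)) ` topspace (realization K))"
    using connectedin_continuous_map_image[OF k1] connectedin_topspace by blast
  moreover have "(\<lambda>p. k (1, p)) ` topspace (realization K) = topspace (realization L)"
  proof
    show "(\<lambda>p. k (1, p)) ` topspace (realization K) \<subseteq> topspace (realization L)"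
      using k1 continuous_map_image_subset_topspace by blast
    show "topspace (realization L) \<subseteq> (\<lambda>p. k (1, p)) ` topspace (realization K)"
    proof
      fix p assume "p \<in> topspace (realization L)"
      then have "p \<in> points L" by (simp add: topspace_realization[OF L])
      then show "p \<in> (\<lambda>p. k (1, p)) ` topspace (realization K)"
        using LK kL[of p 1] by (intro image_eqI[of _ _ p]) (auto simp: topspace_realization[OF K])
    qed
  qed
  ultimately show "connected_space (realization L)" by (simp add: connectedin_topspace)
qed

lemma char_cong:
  assumes "src L = src K" "tgt L = tgt K" "bdry L = bdry K"
  shows "edge_char L = edge_char K" "face_char L = face_char K"
proof -
  show e: "edge_char L = edge_char K" using assms by (simp add: fun_eq_iff edge_char_def)
  show "face_char L = face_char K"
    using assms(3) by (simp add: fun_eq_iff face_char_def path_point_def e)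
qed

text \<open>The pendant edge shrinks linearly to its other end and carries \<open>v\<close> along;
  since \<open>v\<close> lies on no other edge, everything else stays fixed.\<close>

lemma leaf_collapse:
  assumes K: "two_complex K" "faces K = {}" and e: "e \<in> edges K"
    and v: "src K e = v \<and> tgt K e \<noteq> v \<or> tgt K e = v \<and> src K e \<noteq> v"
    and others: "\<And>d. d \<in> edges K \<Longrightarrow> d \<noteq> e \<Longrightarrow> src K d \<noteq> v \<and> tgt K d \<noteq> v"
  defines "L \<equiv> K\<lparr>verts := verts K - {v}, edges := edges K - {e}\<rparr>"
  shows "two_complex L"
    "contractible_space (realization L) \<Longrightarrow> contractible_space (realization K)"
    "connected_space (realization K) \<Longrightarrow> connected_space (realization L)"
proof -
  show L: "two_complex L" using K others by (auto simp: two_complex_def L_def)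
  have char: "edge_char L = edge_char K" "face_char L = face_char K"
    by (rule char_cong; simp add: L_def)+
  have points_L: "Vert_pt u \<in> points L \<longleftrightarrow> u \<in> verts L" "verts L = verts K - {v}" for u
    by (auto simp: points_eq L_def)
  \<comment> \<open>The parameter of the free end \<open>v\<close> on \<open>e\<close>; the end that
    stays has parameter \<open>1 - a\<close>.\<close>
  define a where "a = (if src K e = v then 0 else 1::real)"
  define k where "k q = (case snd q of
      Vert_pt u \<Rightarrow> if u = v then edge_char K e ((1 - fst q) * a + fst q * (1 - a)) else snd q
    | Edge_pt d x \<Rightarrow> if d = e then edge_char K e ((1 - fst q) * x + fst q * (1 - a)) else snd q
    | Face_pt c z \<Rightarrow> snd q)" for q
  have a: "edge_char K e a = Vert_pt v" "\<exists>u. u \<noteq> v \<and> edge_char K e (1 - a) = Vert_pt u"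
    using v by (auto simp: a_def edge_char_def)
  have ke: "k (t, edge_char K e x) = edge_char K e ((1 - t) * x + t * (1 - a))" if "t \<in> {0..1}" "x \<in> {0..1}" for t x
  proof -
    have "x = a \<or> x = 1 - a \<or> 0 < x \<and> x < 1" using that by (auto simp: a_def)
    then consider "x = a" | "x = 1 - a" | "0 < x" "x < 1" by blast
    then show ?thesis
    proof cases
      case 1
      then show ?thesis using a by (simp add: k_def)
    next
      case 2
      have "(1 - t) * x + t * (1 - a) = 1 - a" unfolding 2 by (simp add: algebra_simps)
      then show ?thesis using a 2 by (auto simp: k_def)
    next
      case 3
      then show ?thesis by (simp add: k_def edge_char_def)
    qed
  qed
  have ko: "k (t, edge_char K d x) = edge_char K d x" if "d \<in> edges K" "d \<noteq> e" for d t x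
    using that others[OF that] by (auto simp: k_def edge_char_def)
  have conv: "(1 - t) * x + t * (1 - a) \<in> {0..1}" if "t \<in> {0..1}" "x \<in> {0..1}" for t x
    using that by (auto simp: a_def intro: mult_le_one) (smt (verit) mult_left_le mult_left_le_one_le)+
  have aa: "a \<in> {0..1}" by (auto simp: a_def)
  have kc: "continuous_map (prod_topology (top_of_set {0..1::real}) (realization K)) (realization K) k"
  proof (rule continuous_map_prod_realization[OF K(1)])
    fix d assume d: "d \<in> edges K"
    show "continuous_map (top_of_set ({0..1} \<times> {0..1})) (realization K) (\<lambda>p. k (fst p, edge_char K d (snd p)))"
    proof (cases "d = e")
      case True
      have "continuous_map (top_of_set ({0..1} \<times> {0..1})) (top_of_set {0..1})
          (\<lambda>p::real\<times>real. (1 - fst p) * snd p + fst p * (1 - a))"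
        using conv by (auto intro!: continuous_intros simp del: atLeastAtMost_iff)
      from continuous_map_compose[OF this continuous_map_edge_char[OF K(1) e]] show ?thesis
        by (rule continuous_map_eq) (use ke True in auto)
    next
      case False
      have "continuous_map (top_of_set ({0..1} \<times> {0..1})) (top_of_set {0..1}) (snd :: real\<times>real \<Rightarrow> real)"
        by (auto intro!: continuous_intros)
      from continuous_map_compose[OF this continuous_map_edge_char[OF K(1) d]] show ?thesis
        by (rule continuous_map_eq) (use ko[OF d False] in auto)
    qed
  next
    fix u assume u: "u \<in> verts K"
    show "continuous_map (top_of_set {0..1}) (realization K) (\<lambda>t. k (t, Vert_pt u))"
    proof (cases "u = v")
      case True
      have "continuous_map (top_of_set {0..1}) (top_of_set {0..1}) (\<lambda>t. (1 - t) * a + t * (1 - a))"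
        using conv aa by (auto intro!: continuous_intros simp del: atLeastAtMost_iff)
      from continuous_map_compose[OF this continuous_map_edge_char[OF K(1) e]] show ?thesis
        using True by (simp add: k_def o_def)
    next
      case False
      then show ?thesis using u by (simp add: k_def topspace_realization[OF K(1)] points_eq)
    qed
  qed (use K in auto)
  have k0: "k (0, p) = p" if "p \<in> points K" for p
    using that a by (auto simp: k_def points_eq K edge_char_def)
  have kL: "k (t, p) = p" if "p \<in> points L" for t p
    using that by (cases p) (auto simp: k_def points_eq K L_def)
  have k1: "continuous_map (realization K) (realization L) (\<lambda>p. k (1, p))"
  proof (rule continuous_map_realization[OF K(1)])
    fix d assume d: "d \<in> edges K"
    show "continuous_map (top_of_set {0..1}) (realization L) ((\<lambda>p. k (1, p)) \<circ> edge_char K d)"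
    proof (cases "d = e")
      case True
      obtain u where u: "u \<noteq> v" "edge_char K e (1 - a) = Vert_pt u" using a by blast
      then have "u \<in> verts K" using edge_char_points[OF K(1) e, of "1 - a"] aa by (auto simp: points_eq)
      then have "continuous_map (top_of_set {0..1}) (realization L) (\<lambda>_::real. edge_char K e (1 - a))"
        using u by (simp add: topspace_realization[OF L] points_L)
      then show ?thesis by (rule continuous_map_eq) (use ke[of 1] True in auto)
    next
      case False
      then have "continuous_map (top_of_set {0..1}) (realization L) (edge_char K d)"
        using continuous_map_edge_char[OF L, of d] d unfolding char by (simp add: L_def)
      then show ?thesis by (rule continuous_map_eq) (use ko[OF d False] in auto)
    qed
  next
    fix u assume u: "u \<in> verts K"
    obtain u' where u': "u' \<noteq> v" "edge_char K e (1 - a) = Vert_pt u'" using a by blast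
    then have "u' \<in> verts K" using edge_char_points[OF K(1) e, of "1 - a"] aa by (auto simp: points_eq)
    then show "k (1, Vert_pt u) \<in> topspace (realization L)"
      using u u' by (auto simp: topspace_realization[OF L] points_L k_def)
  qed (use K in auto)
  note dr = deformation_retract_realization[OF K(1) L _ _ _ char kc k0 kL k1]
  show "contractible_space (realization L) \<Longrightarrow> contractible_space (realization K)"
    by (rule dr(1)) (auto simp: L_def)
  show "connected_space (realization K) \<Longrightarrow> connected_space (realization L)"
    by (rule dr(2)) (auto simp: L_def)
qed

section \<open>Elementary collapse of a face through a free edge\<close>

lemma circ_add: "circ n (x + y) = circ n x * circ n y"
  by (simp add: circ_def cis_mult distrib_left add_divide_distrib)

text \<open>The interval omits exactly the open arc of the k-th letter. Being shorter than a full
  turn, it is embedded by \<open>circ n\<close>, so its image is an absolute retract and closed in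
  the disc.\<close>

lemma arc_retract:
  assumes n: "n \<ge> 2"
  obtains \<rho> where "continuous_on (cball 0 1) \<rho>" "\<rho> ` cball 0 1 \<subseteq> circ n ` {real k + 1..real k + real n}"
    "\<And>z. z \<in> circ n ` {real k + 1..real k + real n} \<Longrightarrow> \<rho> z = z"
proof -
  let ?I = "{real k + 1..real k + real n}"
  have "inj_on (circ n) ?I"
  proof (rule inj_onI)
    fix x y assume xy: "x \<in> ?I" "y \<in> ?I" "circ n x = circ n y"
    have "circ n x = circ n (real k + 1) * circ n (x - (real k + 1))"
      "circ n y = circ n (real k + 1) * circ n (y - (real k + 1))"
      by (simp_all add: circ_add[symmetric])
    moreover have "circ n (real k + 1) \<noteq> 0" by (metis norm_circ norm_zero zero_neq_one)
    ultimately have "circ n (x - (real k + 1)) = circ n (y - (real k + 1))" using xy(3) by simp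
    from circ_inj[OF _ _ _ _ this] xy show "x = y" by simp
  qed
  then have "?I homeomorphic circ n ` ?I"
    by (intro homeomorphic_compact[of _ "circ n"]) (auto intro!: continuous_intros)
  moreover have "AR ?I" using n by (intro convex_imp_AR) auto
  ultimately have "AR (circ n ` ?I)" using homeomorphic_AR_iff_AR by blast
  moreover have "compact (circ n ` ?I)" by (intro compact_continuous_image continuous_intros compact_Icc)
  then have "closedin (top_of_set (cball 0 1)) (circ n ` ?I)"
    by (intro closed_subset) (auto simp: compact_imp_closed)
  ultimately have "circ n ` ?I retract_of cball 0 1"
    by (meson AR_imp_absolute_retract homeomorphic_refl)
  then show ?thesis
    using that by (auto simp: retract_of_def retraction_def image_subset_iff_funcset)
qed

text \<open>The closed disc of \<open>c\<close> is pushed linearly onto the boundary arc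
  complementary to \<open>e\<close>. This respects the gluing: that arc is fixed pointwise, and
  \<open>e\<close> occurs once in the boundary of \<open>c\<close> and in that of no other
  face.\<close>

lemma free_face_collapse:
  assumes K: "two_complex K" and c: "c \<in> faces K"
    and k0: "k0 < length (bdry K c)" "length (bdry K c) \<ge> 2" "fst (bdry K c ! k0) = e"
    and once: "\<And>k. k < length (bdry K c) \<Longrightarrow> k \<noteq> k0 \<Longrightarrow> fst (bdry K c ! k) \<noteq> e"
    and others: "\<And>d. d \<in> faces K \<Longrightarrow> d \<noteq> c \<Longrightarrow> e \<notin> fst ` set (bdry K d)"
  defines "L \<equiv> K\<lparr>edges := edges K - {e}, faces := faces K - {c}\<rparr>"
  shows "two_complex L"
    "contractible_space (realization L) \<Longrightarrow> contractible_space (realization K)"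
    "connected_space (realization K) \<Longrightarrow> connected_space (realization L)"
proof -
  have Lv: "init_vert L = init_vert K" "term_vert L = term_vert K"
    by (auto simp: fun_eq_iff init_vert_def term_vert_def L_def)
  show L: "two_complex L"
    unfolding two_complex_def
  proof (intro conjI ballI)
    fix d assume "d \<in> faces L"
    then have d: "d \<in> faces K" "d \<noteq> c" by (auto simp: L_def)
    have b: "bdry L d = bdry K d" "edges L = edges K - {e}" by (simp_all add: L_def)
    have cp: "closed_edge_path K (bdry K d)" using K d by (simp add: two_complex_def)
    then have "set (bdry K d) \<subseteq> (edges K - {e}) \<times> UNIV"
      using others[OF d] by (force simp: closed_edge_path_def)
    then show "closed_edge_path L (bdry L d)"
      using cp unfolding closed_edge_path_def Lv b by blast
  qed (use K in \<open>auto simp: two_complex_def L_def\<close>)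
  have char: "edge_char L = edge_char K" "face_char L = face_char K"
    by (rule char_cong; simp add: L_def)+
  have points_L: "Vert_pt u \<in> points L \<longleftrightarrow> u \<in> verts L" "verts L = verts K" for u
    by (auto simp: points_eq L_def)
  have e: "e \<in> edges K" using bdry_edge[OF K c k0(1)] k0(3) by simp
  define n where "n = length (bdry K c)"
  have n: "n \<ge> 2" "n > 0" "k0 < n" using k0 by (auto simp: n_def)
  define T where "T = circ n ` {real k0 + 1..real k0 + real n}"
  obtain \<rho> where \<rho>: "continuous_on (cball 0 1) \<rho>" "\<And>z. z \<in> cball 0 1 \<Longrightarrow> \<rho> z \<in> T" "\<And>z. z \<in> T \<Longrightarrow> \<rho> z = z"
    using arc_retract[OF n(1), of k0] unfolding T_def by (metis image_subset_iff)
  \<comment> \<open>The \<open>n - 1\<close> boundary positions other than \<open>k0\<close>, in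
    cyclic order, starting just after it.\<close>
  define idx where "idx j = (k0 + 1 + j) mod n" for j
  have idx: "idx j < n" "idx j \<noteq> k0" if "j < n - 1" for j
  proof -
    show "idx j < n" using n by (simp add: idx_def)
    have "k0 + 1 + j < k0 + n" using that by simp
    then show "idx j \<noteq> k0"
      using n by (cases "k0 + 1 + j < n") (auto simp: idx_def mod_if)
  qed
  have T: "T = (\<Union>j\<in>{..<n-1}. (\<lambda>t. circ n (real (idx j) + t)) ` {0..1})"
  proof -
    have "(\<Union>j\<in>{..<n-1}. (\<lambda>t. circ n (real (idx j) + t)) ` {0..1}) =
        circ n ` (\<Union>j\<in>{..<n-1}. (\<lambda>t. real (k0 + 1 + j) + t) ` {0..1})"
      unfolding idx_def circ_mod[OF n(2)] image_UN image_image ..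
    also have "(\<Union>j\<in>{..<n-1}. (\<lambda>t. real (k0 + 1 + j) + t) ` {0..1}) = {real k0 + 1..real k0 + real n}"
    proof (intro equalityI subsetI)
      fix x assume "x \<in> {real k0 + 1..real k0 + real n}"
      then have x: "real k0 + 1 \<le> x" "x \<le> real k0 + real n" by auto
      define y where "y = x - real k0 - 1"
      have y: "0 \<le> y" "y \<le> real n - 1" using x by (auto simp: y_def)
      show "x \<in> (\<Union>j\<in>{..<n-1}. (\<lambda>t. real (k0 + 1 + j) + t) ` {0..1})"
      proof (cases "y = real n - 1")
        case True
        then have "x = real (k0 + 1 + (n - 2)) + 1" using n by (simp add: y_def of_nat_diff)
        moreover have "n - 2 \<in> {..<n - 1}" using n by auto
        ultimately show ?thesis by force
      next
        case False
        have "x = real (k0 + 1 + nat \<lfloor>y\<rfloor>) + frac y"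
          using y by (simp add: frac_def y_def)
        moreover have "nat \<lfloor>y\<rfloor> < n - 1" using y False n by linarith
        moreover have "frac y \<in> {0..1}" using frac_lt_1[of y] by auto
        ultimately show ?thesis by blast
      qed
    next
      fix x assume "x \<in> (\<Union>j\<in>{..<n-1}. (\<lambda>t. real (k0 + 1 + j) + t) ` {0..1})"
      then obtain j t where j: "j \<in> {..<n-1}" "t \<in> {0..1}" "x = real (k0 + 1 + j) + t"
        by (elim UN_E imageE)
      have "real j + 2 \<le> real n" using j(1) n by auto
      then show "x \<in> {real k0 + 1..real k0 + real n}" using j by simp
    qed
    finally show ?thesis by (simp add: T_def)
  qed
  have inT: "circ n (real k + \<tau>) \<in> T" if "k < n" "k \<noteq> k0" "\<tau> \<in> {0..1}" for k \<tau>
  proof -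
    define j where "j = (if k > k0 then k - k0 - 1 else k + n - k0 - 1)"
    have "j < n - 1" "idx j = k" using that n by (auto simp: j_def idx_def)
    then show ?thesis unfolding T using that by blast
  qed
  \<comment> \<open>The start of the removed arc is the end \<open>k0 + n\<close> of the
    complementary one, so only the open arc moves.\<close>
  have T0: "circ n (real k0) \<in> T"
    unfolding T_def using n by (intro image_eqI[of _ _ "real k0 + real n"]) auto
  have Tcb: "T \<subseteq> cball 0 1" by (auto simp: T_def)
  define S where "S t z = (1 - t) *\<^sub>R z + t *\<^sub>R \<rho> z" for t :: real and z
  have Scb: "S t z \<in> cball 0 1" if "t \<in> {0..1}" "z \<in> cball 0 1" for t z
    unfolding S_def using that \<rho>(2)[OF that(2)] Tcb
    by (intro convexD_alt[OF convex_cball]) (auto simp: subset_iff)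
  have ST: "S t z = z" if "z \<in> T" for t z
    by (simp add: S_def \<rho>(3)[OF that] algebra_simps flip: scaleR_left.add)
  \<comment> \<open>The boundary of \<open>c\<close> may traverse \<open>e\<close> backwards;
    \<open>\<sigma>\<close> converts between the parameter of \<open>e\<close> and that of the arc,
    in both directions.\<close>
  define \<sigma> where "\<sigma> x = (if snd (bdry K c ! k0) then x else 1 - x)" for x :: real
  have \<sigma>: "\<sigma> x \<in> {0..1}" "\<sigma> (\<sigma> x) = x" if "x \<in> {0..1}" for x using that by (auto simp: \<sigma>_def)
  define k where "k q = (case snd q of
      Vert_pt u \<Rightarrow> snd q
    | Edge_pt d x \<Rightarrow> if d = e then face_char K c (S (fst q) (circ n (real k0 + \<sigma> x))) else snd q
    | Face_pt d z \<Rightarrow> if d = c then face_char K c (S (fst q) z) else snd q)" for q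
  have ec: "edge_char K e x = face_char K c (circ n (real k0 + \<sigma> x))" if "x \<in> {0..1}" for x
    using face_char_circ[OF K c n_def n(3) \<sigma>(1)[OF that]] \<sigma>(2)[OF that] k0(3)
    by (simp add: letter_char_def \<sigma>_def)
  have ko: "k (t, edge_char K d x) = edge_char K d x" if "d \<noteq> e" for d t x
    using that by (auto simp: k_def edge_char_def)
  have fc: "\<exists>j \<tau>. j < length (bdry K d) \<and> \<tau> \<in> {0..<1} \<and> z = circ (length (bdry K d)) (real j + \<tau>) \<and>
     face_char K d z = letter_char K (bdry K d ! j) \<tau>" if d: "d \<in> faces K" "norm z = 1" for d z
    using circ_cover[OF d(2) bdry_nonempty[OF K d(1)]] face_char_circ_less[OF HOL.refl]
    by (metis atLeastLessThan_iff)
  have kf: "k (t, face_char K c z) = face_char K c (S t z)" if z: "z \<in> cball 0 1" for t z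
  proof (cases "norm z < 1")
    case True
    then show ?thesis by (simp add: face_char_def k_def)
  next
    case False
    then obtain j \<tau> where j: "j < n" "\<tau> \<in> {0..<1}" "z = circ n (real j + \<tau>)"
        "face_char K c z = letter_char K (bdry K c ! j) \<tau>"
      using fc[OF c, of z] z by (auto simp: n_def)
    show ?thesis
    proof (cases "j = k0 \<and> \<tau> \<noteq> 0")
      case True
      then have fe: "face_char K c z = Edge_pt e (\<sigma> \<tau>)"
        using j k0(3) by (simp add: letter_char_mid \<sigma>_def)
      show ?thesis unfolding fe using True j(2,3) \<sigma>(2)[of \<tau>] by (simp add: k_def)
    next
      case False
      then have "z \<in> T" using j(1-3) inT[of j \<tau>] T0 by (cases "j = k0") auto
      moreover have "k (t, face_char K c z) = face_char K c z"
      proof (cases "\<tau> = 0")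
        case True
        then show ?thesis using j by (simp add: letter_char_0 k_def)
      next
        case \<tau>: False
        then have "fst (bdry K c ! j) \<noteq> e" using False once[of j] j by (auto simp: n_def)
        then show ?thesis unfolding j(4) letter_char_def by (rule ko)
      qed
      ultimately show ?thesis by (simp add: ST)
    qed
  qed
  have kfo: "k (t, face_char K d z) = face_char K d z" if d: "d \<in> faces K" "d \<noteq> c" and z: "z \<in> cball 0 1" for d t z
  proof (cases "norm z < 1")
    case True
    then show ?thesis using d by (simp add: face_char_def k_def)
  next
    case False
    then obtain j \<tau> where j: "j < length (bdry K d)" "face_char K d z = letter_char K (bdry K d ! j) \<tau>"
      using fc[OF d(1), of z] z by auto
    then have "fst (bdry K d ! j) \<noteq> e" using others[OF d] by force
    then show ?thesis unfolding j(2) letter_char_def by (rule ko)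
  qed
  have ke: "k (t, edge_char K e x) = face_char K c (S t (circ n (real k0 + \<sigma> x)))" if "x \<in> {0..1}" for t x
    unfolding ec[OF that] by (rule kf) simp
  have Sc: "continuous_on ({0..1} \<times> cball 0 1) (\<lambda>p. S (fst p) (snd p))"
    unfolding S_def by (intro continuous_intros continuous_on_compose2[OF \<rho>(1)]) auto
  have \<sigma>0: "continuous_on {0..1} \<sigma>" unfolding \<sigma>_def by (cases "snd (bdry K c ! k0)") (auto intro!: continuous_intros)
  then have \<sigma>c: "continuous_on {0..1} (\<lambda>x. circ n (real k0 + \<sigma> x))" by (intro continuous_intros)
  note \<sigma>0 = continuous_on_compose2[OF \<sigma>0]
  have kc: "continuous_map (prod_topology (top_of_set {0..1::real}) (realization K)) (realization K) k"
  proof (rule continuous_map_prod_realization[OF K])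
    fix d assume d: "d \<in> edges K"
    show "continuous_map (top_of_set ({0..1} \<times> {0..1})) (realization K) (\<lambda>p. k (fst p, edge_char K d (snd p)))"
    proof (cases "d = e")
      case True
      have "continuous_on ({0..1} \<times> {0..1}) (\<lambda>p::real\<times>real. S (fst p) (circ n (real k0 + \<sigma> (snd p))))"
        by (rule continuous_on_compose2[OF Sc, of _ "\<lambda>p. (fst p, circ n (real k0 + \<sigma> (snd p)))", simplified])
          (auto intro!: continuous_intros \<sigma>0)
      then have "continuous_map (top_of_set ({0..1} \<times> {0..1})) (top_of_set (cball 0 1))
          (\<lambda>p::real\<times>real. S (fst p) (circ n (real k0 + \<sigma> (snd p))))"
        using Scb by (auto simp del: mem_cball mem_cball_0) (simp add: image_subset_iff)
      from continuous_map_compose[OF this continuous_map_face_char[OF K c]] show ?thesis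
        by (rule continuous_map_eq) (use ke True in auto)
    next
      case False
      have "continuous_map (top_of_set ({0..1} \<times> {0..1})) (top_of_set {0..1}) (snd :: real\<times>real \<Rightarrow> real)"
        by (auto intro!: continuous_intros)
      from continuous_map_compose[OF this continuous_map_edge_char[OF K d]] show ?thesis
        by (rule continuous_map_eq) (use ko[OF False] in auto)
    qed
  next
    fix d assume d: "d \<in> faces K"
    show "continuous_map (top_of_set ({0..1} \<times> cball 0 1)) (realization K) (\<lambda>p. k (fst p, face_char K d (snd p)))"
    proof (cases "d = c")
      case True
      have "continuous_map (top_of_set ({0..1} \<times> cball 0 1)) (top_of_set (cball 0 1)) (\<lambda>p. S (fst p) (snd p))"
        using Sc Scb by (auto simp del: mem_cball mem_cball_0)
      from continuous_map_compose[OF this continuous_map_face_char[OF K c]] show ?thesis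
        by (rule continuous_map_eq) (use kf True in auto)
    next
      case False
      have "continuous_map (top_of_set ({0..1} \<times> cball 0 1)) (top_of_set (cball 0 1)) (snd :: real\<times>complex \<Rightarrow> complex)"
        by (auto intro!: continuous_intros)
      from continuous_map_compose[OF this continuous_map_face_char[OF K d]] show ?thesis
        by (rule continuous_map_eq) (use kfo[OF d False] in auto)
    qed
  next
    fix u assume u: "u \<in> verts K"
    show "continuous_map (top_of_set {0..1}) (realization K) (\<lambda>t. k (t, Vert_pt u))"
      using u by (simp add: k_def topspace_realization[OF K] points_eq)
  qed
  have k00: "k (0, p) = p" if "p \<in> points K" for p
  proof -
    have S0: "S 0 z = z" for z by (simp add: S_def)
    show ?thesis
      using that ec[symmetric] by (auto simp: k_def points_eq S0 face_char_def) (simp add: edge_char_def)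
  qed
  have kL: "k (t, p) = p" if "p \<in> points L" for t p
    using that by (cases p) (auto simp: k_def points_eq K L_def)
  \<comment> \<open>The complementary arc never runs through \<open>e\<close>, so on it the
    characteristic map of the removed face is continuous into \<open>L\<close>.\<close>
  have fT: "continuous_map (top_of_set T) (realization L) (face_char K c)"
  proof (rule continuous_map_arcs[OF _ _ T])
    fix j assume "j \<in> {..<n-1}"
    then have j: "idx j < n" "idx j \<noteq> k0" using idx by auto
    have "fst (bdry K c ! idx j) \<in> edges L"
      using once[of "idx j"] j bdry_edge[OF K c, of "idx j"] by (simp add: L_def n_def)
    then have "continuous_map (top_of_set {0..1}) (realization L) (id \<circ> letter_char L (bdry K c ! idx j))"
      by (intro continuous_map_letter_char) (simp add: continuous_map_edge_char[OF L])
    moreover have "letter_char L = letter_char K" by (simp add: fun_eq_iff letter_char_def char)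
    ultimately have "continuous_map (top_of_set {0..1}) (realization L) (letter_char K (bdry K c ! idx j))"
      by simp
    then show "continuous_map (top_of_set {0..1}) (realization L) (face_char K c \<circ> (\<lambda>t. circ n (real (idx j) + t)))"
      by (rule continuous_map_eq) (use face_char_circ[OF K c n_def j(1)] in auto)
  qed (auto intro!: continuous_intros)
  have f\<rho>: "continuous_map (top_of_set (cball 0 1)) (realization L) (face_char K c \<circ> \<rho>)"
    by (rule continuous_map_compose[OF _ fT]) (use \<rho> in \<open>auto simp del: mem_cball mem_cball_0\<close>)
  have S1: "S 1 z = \<rho> z" for z by (simp add: S_def)
  have k1: "continuous_map (realization K) (realization L) (\<lambda>p. k (1, p))"
  proof (rule continuous_map_realization[OF K])
    fix d assume d: "d \<in> edges K"
    show "continuous_map (top_of_set {0..1}) (realization L) ((\<lambda>p. k (1, p)) \<circ> edge_char K d)"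
    proof (cases "d = e")
      case True
      have "continuous_map (top_of_set {0..1}) (top_of_set (cball 0 1)) (\<lambda>x. circ n (real k0 + \<sigma> x))"
        using \<sigma>c by auto
      from continuous_map_compose[OF this f\<rho>] show ?thesis
        by (rule continuous_map_eq) (use ke[of _ 1] S1 True in auto)
    next
      case False
      then have "continuous_map (top_of_set {0..1}) (realization L) (edge_char K d)"
        using continuous_map_edge_char[OF L, of d] d unfolding char by (simp add: L_def)
      then show ?thesis by (rule continuous_map_eq) (use ko[OF False] in auto)
    qed
  next
    fix d assume d: "d \<in> faces K"
    show "continuous_map (top_of_set (cball 0 1)) (realization L) ((\<lambda>p. k (1, p)) \<circ> face_char K d)"
    proof (cases "d = c")
      case True
      show ?thesis by (rule continuous_map_eq[OF f\<rho>]) (use kf[of _ 1] S1 True in auto)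
    next
      case False
      then have "continuous_map (top_of_set (cball 0 1)) (realization L) (face_char K d)"
        using continuous_map_face_char[OF L, of d] d unfolding char by (simp add: L_def)
      then show ?thesis by (rule continuous_map_eq) (use kfo[OF d False] in auto)
    qed
  next
    fix u assume u: "u \<in> verts K"
    then show "k (1, Vert_pt u) \<in> topspace (realization L)"
      by (auto simp: topspace_realization[OF L] points_L k_def)
  qed
  note dr = deformation_retract_realization[OF K L _ _ _ char kc k00 kL k1]
  show "contractible_space (realization L) \<Longrightarrow> contractible_space (realization K)"
    by (rule dr(1)) (auto simp: L_def)
  show "connected_space (realization K) \<Longrightarrow> connected_space (realization L)"
    by (rule dr(2)) (auto simp: L_def)
qed

section \<open>Collapsing a complex with a height function\<close>

lemma directed_path_height:
  fixes h :: "'v \<Rightarrow> int"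
  assumes "directed_path s t p" "set p \<subseteq> E" "\<And>e. e \<in> E \<Longrightarrow> h (t e) = h (s e) + 1" "i < length p"
  shows "h (s (p ! i)) = h (s (hd p)) + int i"
  using assms(4)
proof (induction i)
  case 0
  then show ?case by (simp add: hd_conv_nth)
next
  case (Suc i)
  have "p ! i \<in> E" using assms(2) Suc.prems by (simp add: subset_iff)
  moreover have "t (p ! i) = s (p ! Suc i)" using assms(1) Suc.prems by (simp add: directed_path_def)
  ultimately show ?case using Suc.IH Suc.prems assms(3)[of "p ! i"] by simp
qed

lemma count_mset_nth: "count (mset xs) x = card {k. k < length xs \<and> xs ! k = x}"
  by (simp add: count_mset count_list_eq_length_filter length_filter_conv_card eq_commute)

text \<open>Along a side of a face the heights of the starting points increase by one at each step.
  At minimal base height an edge can thus occur only as an initial edge, and a leaf edge among the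
  faces of that base height occurs exactly once in all boundaries.\<close>

lemma bigon_complex_collapse:
  assumes K: "bigon_complex K s t \<alpha> \<beta>" and ne: "faces K \<noteq> {}"
    and h: "\<And>e. e \<in> edges K \<Longrightarrow> h (t e) = h (s e) + (1 :: int)"
  obtains L where "bigon_complex L s t \<alpha> \<beta>" "edges L \<subset> edges K" "euler_char L = euler_char K"
    "contractible_space (realization L) \<Longrightarrow> contractible_space (realization K)"
proof -
  note bd = bigon_complexD[OF K]
  define base where "base c = h (s (hd (\<alpha> c)))" for c
  define C where "C = {c \<in> faces K. base c = Min (base ` faces K)}"
  have "Min (base ` faces K) \<in> base ` faces K" using bd(4) ne by (intro Min_in) auto
  then have "C \<subseteq> faces K" "C \<noteq> {}" by (auto simp: C_def)
  from bd(13)[OF this] obtain c e where cC: "c \<in> C" and e: "e \<in> {hd (\<alpha> c), hd (\<beta> c)}"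
      and "hd (\<alpha> c) \<noteq> hd (\<beta> c) \<and> (\<forall>c'\<in>C. e \<in> {hd (\<alpha> c'), hd (\<beta> c')} \<longrightarrow> c' = c)"
    by (rule bexE) (erule bexE, rule that)
  then have ne_hd: "hd (\<alpha> c) \<noteq> hd (\<beta> c)"
    and uniq: "\<forall>c'\<in>C. e \<in> {hd (\<alpha> c'), hd (\<beta> c')} \<longrightarrow> c' = c" by blast+
  have c: "c \<in> faces K" and base_c: "base c = Min (base ` faces K)" using cC by (auto simp: C_def)
  have base_le: "base c \<le> base d" if "d \<in> faces K" for d
    using that bd(4) by (simp add: base_c)
  have dp: "p \<noteq> [] \<and> set p \<subseteq> edges K \<and> s (hd p) = s (hd (\<alpha> d)) \<and>
      (\<forall>i<length p. h (s (p ! i)) = base d + int i)"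
    if "d \<in> faces K" "p \<in> {\<alpha> d, \<beta> d}" for d p
  proof -
    have "directed_path s t p" "set p \<subseteq> edges K" "s (hd p) = s (hd (\<alpha> d))"
      using that bd(7,8,10)[of d] bigon_edges[OF K, of d] by auto
    then show ?thesis
      using directed_path_height[of s t p "edges K" h] h by (auto simp: directed_path_def base_def)
  qed
  have se: "h (s e) = base c" using e dp[OF c, of "\<alpha> c"] dp[OF c, of "\<beta> c"] by (auto simp: base_def)
  have at_hd: "i = 0 \<and> d \<in> C" if "d \<in> faces K" "p \<in> {\<alpha> d, \<beta> d}" "i < length p" "p ! i = e" for d p i
    using dp[OF that(1,2)] base_le[OF that(1)] that base_c se by (force simp: C_def)
  have cnt: "count (mset p) e = of_bool (hd p = e)" if "p \<in> {\<alpha> c, \<beta> c}" for p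
  proof -
    have "{k. k < length p \<and> p ! k = e} = (if hd p = e then {0} else {})"
      using at_hd[OF c that] dp[OF c that] by (auto simp: hd_conv_nth)
    then show ?thesis by (simp add: count_mset_nth)
  qed
  have "count (mset (map fst (bdry K c))) e = 1"
    using bd(12)[OF c] cnt e ne_hd by auto
  then have "card {k. k < length (bdry K c) \<and> fst (bdry K c ! k) = e} = 1"
    unfolding count_mset_nth by (simp cong: conj_cong)
  then obtain k0 where k0: "{k. k < length (bdry K c) \<and> fst (bdry K c ! k) = e} = {k0}"
    by (auto simp: card_1_singleton_iff)
  have "size (mset (map fst (bdry K c))) = length (\<alpha> c) + length (\<beta> c)"
    unfolding bd(12)[OF c] by simp
  moreover have "length (\<alpha> c) > 0" "length (\<beta> c) > 0"
    using dp[OF c, of "\<alpha> c"] dp[OF c, of "\<beta> c"] by auto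
  ultimately have len: "length (bdry K c) \<ge> 2" by (simp only: size_mset length_map)
  have others: "e \<notin> fst ` set (bdry K d)" if d: "d \<in> faces K" "d \<noteq> c" for d
  proof
    assume "e \<in> fst ` set (bdry K d)"
    then have "e \<in> set_mset (mset (map fst (bdry K d)))" by simp
    then obtain p i where p: "p \<in> {\<alpha> d, \<beta> d}" "i < length p" "p ! i = e"
      unfolding bd(12)[OF d(1)] by (auto simp: in_set_conv_nth)
    then have "d \<in> C" "hd p = e" using at_hd[OF d(1) p] p by (auto simp: hd_conv_nth)
    then show False using uniq p(1) d(2) by blast
  qed
  define L where "L = K\<lparr>edges := edges K - {e}, faces := faces K - {c}\<rparr>"
  have k0': "k0 < length (bdry K c)" "fst (bdry K c ! k0) = e" using k0 by blast+
  have once: "fst (bdry K c ! k) \<noteq> e" if "k < length (bdry K c)" "k \<noteq> k0" for k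
    using k0 that by blast
  have coll: "two_complex L"
    "contractible_space (realization L) \<Longrightarrow> contractible_space (realization K)"
    "connected_space (realization K) \<Longrightarrow> connected_space (realization L)"
    unfolding L_def by (rule free_face_collapse[OF bd(1) c k0'(1) len k0'(2) once others], assumption+)+
  have eK: "e \<in> edges K" using bdry_edge[OF bd(1) c k0'(1)] k0'(2) by simp
  show ?thesis
  proof
    show "bigon_complex L s t \<alpha> \<beta>"
      unfolding bigon_complex_def
    proof (intro conjI ballI allI impI)
      fix D assume "D \<subseteq> faces L \<and> D \<noteq> {}"
      then have "D \<subseteq> faces K" "D \<noteq> {}" by (auto simp: L_def)
      from bd(13)[OF this] show "\<exists>c\<in>D. \<exists>e\<in>{hd (\<alpha> c), hd (\<beta> c)}. hd (\<alpha> c) \<noteq> hd (\<beta> c) \<and>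
          (\<forall>c'\<in>D. e \<in> {hd (\<alpha> c'), hd (\<beta> c')} \<longrightarrow> c' = c)" .
    qed (use bd(2-12) coll in \<open>auto simp: L_def\<close>)
    show "edges L \<subset> edges K" using eK by (auto simp: L_def)
    show "euler_char L = euler_char K"
      using card_Suc_Diff1[OF bd(3) eK] card_Suc_Diff1[OF bd(4) c] by (simp add: euler_char_def L_def)
  qed (use coll in auto)
qed

text \<open>Degrees sum to twice the number of edges. If all are at least 2, there are at least as
  many edges as vertices; degree 0 leaves a single point by connectedness; degree 1 permits a leaf
  collapse, which preserves the Euler characteristic.\<close>

lemma finite_connected_graph:
  assumes K: "two_complex K" "faces K = {}" "finite (verts K)" "finite (edges K)"
    and conn: "connected_space (realization K)"
  shows "euler_char K \<le> 0 \<or> contractible_space (realization K)"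
  using assms
proof (induction "card (edges K)" arbitrary: K rule: less_induct)
  case (less K)
  note K = less.prems
  have st: "src K e \<in> verts K" "tgt K e \<in> verts K" if "e \<in> edges K" for e
    using K(1) that by (auto simp: two_complex_def)
  \<comment> \<open>A loop counts twice, so a vertex of degree 1 carries no loop and is a genuine
    leaf.\<close>
  define deg where "deg v = card {e \<in> edges K. src K e = v} + card {e \<in> edges K. tgt K e = v}" for v
  have fib: "(\<Sum>v\<in>verts K. card {e \<in> edges K. f e = v}) = card (edges K)"
    if "\<And>e. e \<in> edges K \<Longrightarrow> f e \<in> verts K" for f
  proof -
    have "card (\<Union>v\<in>verts K. {e \<in> edges K. f e = v}) = (\<Sum>v\<in>verts K. card {e \<in> edges K. f e = v})"
      using K(3,4) by (intro card_UN_disjoint) auto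
    moreover have "(\<Union>v\<in>verts K. {e \<in> edges K. f e = v}) = edges K" using that by auto
    ultimately show ?thesis by simp
  qed
  have sum_deg: "(\<Sum>v\<in>verts K. deg v) = 2 * card (edges K)"
    unfolding deg_def sum.distrib using fib[of "src K"] fib[of "tgt K"] st by simp
  consider "verts K = {}" | "\<forall>v\<in>verts K. deg v \<ge> 2" | v where "v \<in> verts K" "deg v = 0"
    | v where "v \<in> verts K" "deg v = 1"
    by (metis One_nat_def Suc_1 less_2_cases not_less)
  then show ?case
  proof cases
    case 1
    then have "edges K = {}" using st by blast
    then show ?thesis using 1 K by (simp add: euler_char_def)
  next
    case 2
    then have "(\<Sum>v\<in>verts K. 2) \<le> (\<Sum>v\<in>verts K. deg v)" by (intro sum_mono) auto
    then show ?thesis using sum_deg K by (simp add: euler_char_def)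
  next
    case (3 v)
    then have nov: "src K e \<noteq> v" "tgt K e \<noteq> v" if "e \<in> edges K" for e
      using that K by (auto simp: deg_def)
    have "{v} = verts K"
      by (rule connected_realization_verts[OF K(1,5)]) (use 3 nov in auto)
    moreover from this have "edges K = {}" using st nov by fast
    ultimately have "points K = {Vert_pt v}" using K by (auto simp: points_eq)
    then have "topspace (realization K) \<subseteq> {Vert_pt v}" by (simp add: topspace_realization[OF K(1)])
    then show ?thesis by (intro disjI2 contractible_space_subset_singleton)
  next
    case (4 v)
    have fin: "finite {e \<in> edges K. src K e = v}" "finite {e \<in> edges K. tgt K e = v}" using K by auto
    from 4 consider e where "{e \<in> edges K. src K e = v} = {e}" "{e \<in> edges K. tgt K e = v} = {}"
      | e where "{e \<in> edges K. tgt K e = v} = {e}" "{e \<in> edges K. src K e = v} = {}"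
      using fin by (auto simp: deg_def add_is_1 card_1_singleton_iff)
    then obtain e where e: "e \<in> edges K" "src K e = v \<and> tgt K e \<noteq> v \<or> tgt K e = v \<and> src K e \<noteq> v"
      "\<And>d. d \<in> edges K \<Longrightarrow> d \<noteq> e \<Longrightarrow> src K d \<noteq> v \<and> tgt K d \<noteq> v"
      by cases blast+
    define L where "L = K\<lparr>verts := verts K - {v}, edges := edges K - {e}\<rparr>"
    have coll: "two_complex L"
      "contractible_space (realization L) \<Longrightarrow> contractible_space (realization K)"
      "connected_space (realization K) \<Longrightarrow> connected_space (realization L)"
      unfolding L_def by (rule leaf_collapse[OF K(1,2) e], assumption+)+
    have "card (edges L) < card (edges K)"
      using card_Diff1_less[OF K(4) e(1)] by (simp add: L_def)
    moreover have "faces L = {}" "finite (verts L)" "finite (edges L)" using K by (simp_all add: L_def)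
    ultimately have "euler_char L \<le> 0 \<or> contractible_space (realization L)"
      using less.hyps coll(1) coll(3)[OF K(5)] by blast
    moreover have "euler_char L = euler_char K"
      using card_Suc_Diff1[OF K(4) e(1)] card_Suc_Diff1[OF K(3) 4(1)] by (simp add: euler_char_def L_def)
    ultimately show ?thesis using coll(2) by auto
  qed
qed

lemma bigon_complex_euler_char_or_contractible:
  assumes K: "bigon_complex K s t \<alpha> \<beta>"
  shows "euler_char (K :: ('v, 'e, 'f) complex2) \<le> 0 \<or> contractible_space (realization K)"
proof (cases "\<exists>h :: 'v \<Rightarrow> int. \<forall>e\<in>edges K. h (t e) = h (s e) + 1")
  case True
  then obtain h :: "'v \<Rightarrow> int" where "\<forall>e\<in>edges K. h (t e) = h (s e) + 1" by blast
  with K show ?thesis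
  proof (induction "card (edges K)" arbitrary: K rule: less_induct)
    case (less K)
    show ?case
    proof (cases "faces K = {}")
      case True
      then show ?thesis using finite_connected_graph bigon_complexD[OF less.prems(1)] by blast
    next
      case False
      obtain L where L: "bigon_complex L s t \<alpha> \<beta>" "edges L \<subset> edges K" "euler_char L = euler_char K"
          "contractible_space (realization L) \<Longrightarrow> contractible_space (realization K)"
        using bigon_complex_collapse[OF less.prems(1) False, of h] less.prems(2) by blast
      have "card (edges L) < card (edges K)"
        using L(2) bigon_complexD(3)[OF less.prems(1)] by (rule psubset_card_mono[rotated])
      moreover have "\<forall>e\<in>edges L. h (t e) = h (s e) + 1" using less.prems(2) L(2) by blast
      ultimately have "euler_char L \<le> 0 \<or> contractible_space (realization L)"
        using less.hyps[of L] L(1) by blast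
      then show ?thesis using L(3,4) by auto
    qed
  qed
qed (use euler_char_nonpos_no_height[OF K] in blast)

section \<open>Cellular structure of an immersion\<close>

text \<open>The coordinate need not extend to a continuous function on \<open>X\<close>, but
  \<open>t * (1 - t)\<close> and \<open>t ^ 2 * (1 - t)\<close> do, since they vanish at both ends;
  the coordinate is their quotient.\<close>

lemma edge_coordinate_continuous:
  fixes S :: "'s::topological_space set"
  assumes X: "two_complex X" and \<gamma>: "continuous_map (top_of_set S) (realization X) \<gamma>"
    and g: "\<And>x. x \<in> S \<Longrightarrow> \<gamma> x = Edge_pt a (g x) \<and> 0 < g x \<and> g x < 1"
  shows "continuous_on S g"
proof -
  define \<phi> where "\<phi> i p = (case p of Edge_pt d t \<Rightarrow> if d = a then t ^ i * (1 - t) else 0 | _ \<Rightarrow> 0)"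
    for i :: nat and p :: "('a, 'b, 'c) cpoint"
  have ext: "\<exists>G. continuous_map (realization X) euclideanreal G \<and> (\<forall>t. G (Edge_pt a t) = t ^ i * (1 - t))"
    if "i > 0" for i
  proof -
    have "\<phi> i \<circ> edge_char X d = (\<lambda>t. if d = a then t ^ i * (1 - t) else 0)" for d
      using that by (auto simp: \<phi>_def edge_char_def fun_eq_iff)
    then have "continuous_on {0..1} (\<phi> i \<circ> edge_char X d)" for d
      by (cases "d = a") (auto intro!: continuous_intros)
    then obtain G where G: "continuous_map (realization X) euclideanreal G"
      "\<And>e t. G (Edge_pt e t) = \<phi> i (Edge_pt e t)"
      using skeleton_function_extends[OF X, of "\<phi> i"] by blast
    then show ?thesis by (intro exI[of _ G]) (auto simp: \<phi>_def)
  qed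
  obtain G1 where G1: "continuous_map (realization X) euclideanreal G1" "\<And>t. G1 (Edge_pt a t) = t ^ 1 * (1 - t)"
    using ext[of 1] by auto
  obtain G2 where G2: "continuous_map (realization X) euclideanreal G2" "\<And>t. G2 (Edge_pt a t) = t ^ 2 * (1 - t)"
    using ext[of 2] by auto
  have c: "continuous_on S (G1 \<circ> \<gamma>)" "continuous_on S (G2 \<circ> \<gamma>)"
    using continuous_map_compose[OF \<gamma> G1(1)] continuous_map_compose[OF \<gamma> G2(1)] by auto
  have G1\<gamma>: "(G1 \<circ> \<gamma>) x = g x * (1 - g x)" and G2\<gamma>: "(G2 \<circ> \<gamma>) x = (g x)\<^sup>2 * (1 - g x)"
    and nz: "(G1 \<circ> \<gamma>) x \<noteq> 0" if "x \<in> S" for x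
    using g[OF that] by (auto simp: G1 G2)
  have "continuous_on S (\<lambda>x. (G2 \<circ> \<gamma>) x / (G1 \<circ> \<gamma>) x)"
    using c nz by (intro continuous_on_divide) auto
  moreover have "(G2 \<circ> \<gamma>) x / (G1 \<circ> \<gamma>) x = g x" if "x \<in> S" for x
    using g[OF that] unfolding G1\<gamma>[OF that] G2\<gamma>[OF that] by (simp add: power2_eq_square)
  ultimately show ?thesis by (rule continuous_on_eq)
qed

text \<open>Multiplied by the weight \<open>1 - norm z\<close>, which vanishes on the boundary
  circle, any continuous function of the coordinate extends by zero; real and imaginary part are
  recovered as quotients.\<close>

lemma face_coordinate_continuous:
  fixes S :: "'s::topological_space set"
  assumes X: "two_complex X" and \<gamma>: "continuous_map (top_of_set S) (realization X) \<gamma>"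
    and g: "\<And>x. x \<in> S \<Longrightarrow> \<gamma> x = Face_pt d (g x) \<and> norm (g x) < 1"
  shows "continuous_on S g"
proof -
  have ext: "continuous_on S (\<lambda>x. (1 - norm (g x)) * u (g x))" if u: "continuous_on UNIV u" for u :: "complex \<Rightarrow> real"
  proof -
    define \<phi> where "\<phi> p = (case p of Face_pt d' z \<Rightarrow> if d' = d then (1 - norm z) * u z else 0 | _ \<Rightarrow> 0)"
      for p :: "('a, 'b, 'c) cpoint"
    have "continuous_on (cball 0 1) (\<lambda>z. (1 - norm z) * u z)"
      by (intro continuous_intros continuous_on_subset[OF u]) auto
    then have "continuous_map (realization X) euclideanreal \<phi>"
      unfolding \<phi>_def by (intro face_function_extends[OF X]) auto
    from continuous_map_compose[OF \<gamma> this] have "continuous_on S (\<phi> \<circ> \<gamma>)" by simp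
    then show ?thesis by (rule continuous_on_eq) (use g in \<open>auto simp: \<phi>_def\<close>)
  qed
  have nz: "1 - norm (g x) \<noteq> 0" if "x \<in> S" for x using g[OF that] by auto
  have "continuous_on S (\<lambda>x. Complex (((1 - norm (g x)) * Re (g x)) / ((1 - norm (g x)) * 1))
      (((1 - norm (g x)) * Im (g x)) / ((1 - norm (g x)) * 1)))"
    unfolding Complex_eq using nz by (intro continuous_intros ext) auto
  then show ?thesis by (rule continuous_on_eq) (use nz in \<open>auto simp: complex_eq_iff\<close>)
qed

section \<open>Homeomorphisms of the interval\<close>

definition interval_homeo :: "(real \<Rightarrow> real) \<Rightarrow> bool" where
  "interval_homeo G \<longleftrightarrow> continuous_on {0..1} G \<and> inj_on G {0..1} \<and> G 0 = 0 \<and> G 1 = 1 \<and>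
     (\<forall>t. 0 < t \<and> t < 1 \<longrightarrow> 0 < G t \<and> G t < 1)"

text \<open>Continued by the identity, the map is monotone from the line onto itself, and a monotone
  map with open image is continuous.\<close>

lemma interval_homeo_extend:
  assumes g: "bij_betw g {0<..<1} {0<..<1}" and mono: "strict_mono_on {0<..<1::real} g"
  shows "interval_homeo (\<lambda>t. if 0 < t \<and> t < 1 then g t else t)" (is "interval_homeo ?G")
proof -
  have g01: "0 < g t \<and> g t < 1" if "0 < t" "t < 1" for t
    using bij_betwE[OF g] that by auto
  have "continuous_on UNIV ?G"
  proof (rule continuous_onI_mono)
    have "?G ` UNIV = UNIV"
    proof (intro equalityI subsetI)
      fix y :: real assume "y \<in> UNIV"
      show "y \<in> ?G ` UNIV"
      proof (cases "0 < y \<and> y < 1")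
        case True
        then have "y \<in> g ` {0<..<1}" using bij_betw_imp_surj_on[OF g] by simp
        then show ?thesis by force
      next
        case False
        then show ?thesis by (intro image_eqI[of _ _ y]) auto
      qed
    qed simp
    then show "open (?G ` UNIV)" by simp
    show "?G x \<le> ?G y" if "x \<le> y" for x y
      using that g01[of x] g01[of y] strict_mono_onD[OF mono, of x y] by (cases "x = y") auto
  qed
  then have "continuous_on {0..1} ?G" by (rule continuous_on_subset) simp
  moreover have "inj_on ?G {0..1}"
  proof (rule linorder_inj_onI)
    show "?G x \<noteq> ?G y" if "x < y" "x \<in> {0..1}" "y \<in> {0..1}" for x y
      using that g01[of x] g01[of y] strict_mono_onD[OF mono, of x y] by auto
  qed auto
  ultimately show ?thesis using g01 by (auto simp: interval_homeo_def)
qed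

lemma interval_homeo_reflect:
  assumes "interval_homeo G"
  shows "interval_homeo (\<lambda>t. 1 - G (1 - t))"
proof -
  have "continuous_on {0..1} (\<lambda>t. 1 - G (1 - t))"
  proof (intro continuous_intros)
    have "continuous_on {0..1} G" using assms by (simp add: interval_homeo_def)
    then show "continuous_on {0..1} (\<lambda>t. G (1 - t))"
      by (rule continuous_on_compose2) (auto intro!: continuous_intros)
  qed
  moreover have "inj_on (\<lambda>t. 1 - G (1 - t)) {0..1}"
  proof (rule inj_onI)
    fix x y :: real assume xy: "x \<in> {0..1}" "y \<in> {0..1}" "1 - G (1 - x) = 1 - G (1 - y)"
    have "inj_on G {0..1}" using assms by (simp add: interval_homeo_def)
    from inj_onD[OF this, of "1 - x" "1 - y"] show "x = y" using xy by simp
  qed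
  ultimately show ?thesis using assms unfolding interval_homeo_def by auto
qed

text \<open>If \<open>g\<close> went up on one pair and down on another, the first pair could be
  moved linearly to the second, keeping its points in order. By the intermediate value theorem their
  values would agree at some time, against injectivity.\<close>

lemma strict_mono_or_antimono:
  fixes g :: "real \<Rightarrow> real"
  assumes cont: "continuous_on {0<..<1} g" and inj: "inj_on g {0<..<1}"
  shows "strict_mono_on {0<..<1} g \<or> strict_mono_on {0<..<1} (\<lambda>t. - g t)"
proof (rule ccontr)
  assume "\<not> ?thesis"
  then obtain x y x' y' where xy: "0 < x" "x < y" "y < 1" "g x \<ge> g y"
      and xy': "0 < x'" "x' < y'" "y' < 1" "g x' \<le> g y'"
    unfolding strict_mono_on_def by force
  define p where "p s = (1 - s) * x + s * x'" for s
  define q where "q s = (1 - s) * y + s * y'" for s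
  have pq: "0 < p s \<and> p s < q s \<and> q s < 1" if "s \<in> {0..1}" for s
  proof -
    have s: "0 \<le> s" "0 \<le> 1 - s" using that by auto
    have "p s < q s"
    proof (cases "s = 0")
      case False
      then have "s * x' < s * y'" "(1 - s) * x \<le> (1 - s) * y"
        using s xy xy' by (auto intro!: mult_left_mono)
      then show ?thesis by (simp add: p_def q_def)
    qed (use xy in \<open>simp add: p_def q_def\<close>)
    moreover have "0 < p s"
      using convexD_alt[of "{0<..<1}" x x' s] s xy xy' by (auto simp: p_def)
    moreover have "q s < 1"
      using convexD_alt[of "{0<..<1}" y y' s] s xy xy' by (auto simp: q_def)
    ultimately show ?thesis by simp
  qed
  have "continuous_on {0..1} (\<lambda>s. g (q s) - g (p s))"
    using pq unfolding p_def q_def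
    by (intro continuous_intros continuous_on_compose2[OF cont]) force+
  moreover have "g (q 0) - g (p 0) \<le> 0" "0 \<le> g (q 1) - g (p 1)"
    using xy xy' by (auto simp: p_def q_def)
  ultimately obtain s where "s \<in> {0..1}" "g (q s) - g (p s) = 0"
    using IVT'[of "\<lambda>s. g (q s) - g (p s)" 0 0 1] by auto
  then show False using pq[of s] inj_onD[OF inj, of "q s" "p s"] by auto
qed

section \<open>Extension of maps of open discs to the boundary circle\<close>

lemma finite_letter_fibre:
  assumes G: "interval_homeo G"
  shows "finite {t \<in> {0..1}. letter_char K l (G t) = p}"
proof -
  have "s = t" if "s \<in> {0<..<1}" "t \<in> {0<..<1}" "letter_char K l (G s) = p" "letter_char K l (G t) = p" for s t
  proof -
    have "0 < G s" "G s < 1" "0 < G t" "G t < 1" using G that by (auto simp: interval_homeo_def)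
    then have "G s = G t" using that(3,4) by (auto simp: letter_char_mid split: if_splits)
    then show ?thesis using G that by (auto simp: interval_homeo_def dest: inj_onD)
  qed
  then have "\<exists>s. {t \<in> {0<..<1}. letter_char K l (G t) = p} \<subseteq> {s}" by blast
  then have "finite {t \<in> {0<..<1}. letter_char K l (G t) = p}" by (auto intro: finite_subset)
  moreover have "{t \<in> {0..1}. letter_char K l (G t) = p} \<subseteq> {0, 1} \<union> {t \<in> {0<..<1}. letter_char K l (G t) = p}"
    by auto
  ultimately show ?thesis by (auto intro: finite_subset)
qed

lemma finite_circle_fibre:
  assumes "n > 0" and g: "\<And>k t. k < n \<Longrightarrow> t \<in> {0..1} \<Longrightarrow> g (circ n (real k + t)) = letter_char K (l k) (G k t)"
    and G: "\<And>k. k < n \<Longrightarrow> interval_homeo (G k)"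
  shows "finite {z \<in> sphere 0 1. g z = p}"
proof -
  have "{z \<in> sphere 0 1. g z = p} \<subseteq>
      (\<Union>k<n. (\<lambda>t. circ n (real k + t)) ` {t \<in> {0..1}. letter_char K (l k) (G k t) = p})"
  proof
    fix z assume "z \<in> {z \<in> sphere 0 1. g z = p}"
    then have z: "norm z = 1" "g z = p" by auto
    obtain k t where k: "k < n" "0 \<le> t" "t < 1" "z = circ n (real k + t)"
      by (rule circ_cover[OF z(1) assms(1)])
    then have "t \<in> {t \<in> {0..1}. letter_char K (l k) (G k t) = p}" using g[of k t] z by auto
    with k show "z \<in> (\<Union>k<n. (\<lambda>t. circ n (real k + t)) ` {t \<in> {0..1}. letter_char K (l k) (G k t) = p})"
      by blast
  qed
  moreover have "finite (\<Union>k<n. (\<lambda>t. circ n (real k + t)) ` {t \<in> {0..1}. letter_char K (l k) (G k t) = p})"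
    by (intro finite_UN_I finite_imageI finite_letter_fibre[OF G]) auto
  ultimately show ?thesis by (rule finite_subset)
qed

text \<open>As \<open>x\<close> tends to a boundary point \<open>z\<close>, compactness forces
  \<open>h x\<close> towards the fibre of \<open>g2\<close> over \<open>g1 z\<close>. The fibre is
  finite and the points near \<open>z\<close> form a connected set, so \<open>h x\<close> tends to a
  single point of it, the boundary value.\<close>

lemma ball_map_extends:
  fixes g1 g2 :: "complex \<Rightarrow> 'z"
  assumes Z: "Hausdorff_space Z"
    and g1: "continuous_map (top_of_set (cball 0 1)) Z g1"
    and g2: "continuous_map (top_of_set (cball 0 1)) Z g2"
    and h: "continuous_on (ball 0 1) h" "\<And>z. norm z < 1 \<Longrightarrow> norm (h z) < 1 \<and> g2 (h z) = g1 z"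
    and fin: "\<And>z. norm z = 1 \<Longrightarrow> finite {w \<in> cball 0 1. g2 w = g1 z}"
  obtains H where "continuous_on (cball 0 1) H" "\<And>z. norm z < 1 \<Longrightarrow> H z = h z"
    "\<And>z. norm z \<le> 1 \<Longrightarrow> norm (H z) \<le> 1 \<and> g2 (H z) = g1 z"
proof -
  have lim: "\<exists>l. norm l \<le> 1 \<and> g2 l = g1 z \<and>
      (\<forall>\<epsilon>>0. \<exists>\<delta>>0. \<forall>x. norm x < 1 \<and> dist x z < \<delta> \<longrightarrow> dist (h x) l < \<epsilon>)" if z: "norm z = 1" for z
  proof -
    define F where "F = {w \<in> cball 0 1. g2 w = g1 z}"
    have near: "\<exists>\<delta>>0. \<forall>x. norm x < 1 \<and> dist x z < \<delta> \<longrightarrow> h x \<in> W" if W: "open W" "F \<subseteq> W" for W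
    proof -
      define U where "U = topspace Z - g2 ` (cball 0 1 - W)"
      have "compactin (top_of_set (cball 0 1)) (cball 0 1 - W)"
        using W by (simp add: compactin_subtopology compact_diff)
      then have "closedin Z (g2 ` (cball 0 1 - W))"
        by (intro compactin_imp_closedin[OF Z] image_compactin[OF _ g2])
      then have "openin Z U" by (auto simp: U_def)
      from openin_continuous_map_preimage[OF g1 this]
      have op: "openin (top_of_set (cball 0 1)) {x \<in> cball 0 1. g1 x \<in> U}" by simp
      have "g1 z \<in> topspace Z" using continuous_map_funspace[OF g1] z by (auto simp: Pi_iff)
      moreover have "g1 z \<notin> g2 ` (cball 0 1 - W)" using W(2) by (auto simp: F_def)
      ultimately have "z \<in> {x \<in> cball 0 1. g1 x \<in> U}" using z by (auto simp: U_def)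
      from bspec[OF conjunct2[OF op[unfolded openin_euclidean_subtopology_iff]] this]
      obtain \<delta> where \<delta>: "\<delta> > 0" "\<forall>x\<in>cball 0 1. dist x z < \<delta> \<longrightarrow> x \<in> {x \<in> cball 0 1. g1 x \<in> U}"
        by (elim exE conjE)
      have "h x \<in> W" if x: "norm x < 1" "dist x z < \<delta>" for x
      proof (rule ccontr)
        assume "h x \<notin> W"
        then have "h x \<in> cball 0 1 - W" using h(2)[OF x(1)] by auto
        then have "g2 (h x) \<in> g2 ` (cball 0 1 - W)" by (rule imageI)
        moreover have "g1 x \<in> U" using \<delta>(2) x by auto
        ultimately show False using h(2)[OF x(1)] by (auto simp: U_def)
      qed
      with \<delta>(1) show ?thesis by blast
    qed
    have "finite F" using fin[OF z] by (simp add: F_def)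
    then have "uniform_discrete F" using uniform_discrete_finite_iff by blast
    then obtain r where r: "r > 0" "\<And>x y. x \<in> F \<Longrightarrow> y \<in> F \<Longrightarrow> dist x y < r \<Longrightarrow> x = y"
      unfolding uniform_discrete_def by blast
    have sep: "ball w (r / 2) \<inter> ball w' (r / 2) = {}" if "w \<in> F" "w' \<in> F" "w \<noteq> w'" for w w'
    proof -
      have "dist w w' \<ge> r" using r(2) that by force
      then show ?thesis by (intro disjoint_ballI) auto
    qed
    have "F \<subseteq> (\<Union>w\<in>F. ball w (r / 2))" using r(1) by auto
    then obtain \<delta>0 where \<delta>0: "\<delta>0 > 0" "\<And>x. norm x < 1 \<Longrightarrow> dist x z < \<delta>0 \<Longrightarrow> h x \<in> (\<Union>w\<in>F. ball w (r / 2))"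
      using near[of "\<Union>w\<in>F. ball w (r / 2)"] by blast
    define N where "N = ball 0 1 \<inter> ball z \<delta>0"
    have hN: "h x \<in> (\<Union>w\<in>F. ball w (r / 2))" if "x \<in> N" for x
      using \<delta>0(2)[of x] that by (auto simp: N_def dist_commute)
    have "z \<in> closure (ball 0 1)" using z by simp
    then obtain x0 where "x0 \<in> ball 0 1" "dist x0 z < \<delta>0"
      using \<delta>0(1) unfolding closure_approachable by blast
    then have x0: "x0 \<in> N" by (simp add: N_def dist_commute)
    then obtain l where l: "l \<in> F" "h x0 \<in> ball l (r / 2)" using hN by blast
    \<comment> \<open>The image of the convex set \<open>N\<close> lies in a union of disjoint balls
      around the points of the fibre, hence in one of them.\<close>
    have conn: "connected (h ` N)"
      by (intro connected_continuous_image continuous_on_subset[OF h(1)] convex_connected)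
        (auto simp: N_def intro!: convex_Int)
    define V where "V = (\<Union>w\<in>F - {l}. ball w (r / 2))"
    have disj: "ball l (r / 2) \<inter> V = {}" using sep[OF l(1)] by (fastforce simp: V_def)
    have cov: "h ` N \<subseteq> ball l (r / 2) \<union> V"
    proof
      fix y assume "y \<in> h ` N"
      then obtain w where "w \<in> F" "y \<in> ball w (r / 2)" using hN by blast
      then show "y \<in> ball l (r / 2) \<union> V" by (cases "w = l") (auto simp: V_def)
    qed
    have VN: "V \<inter> h ` N = {}"
    proof -
      have "open (ball l (r / 2))" "open V" by (auto simp: V_def)
      then have "ball l (r / 2) \<inter> h ` N = {} \<or> V \<inter> h ` N = {}"
        using connectedD[OF conn] disj cov by blast
      then show ?thesis using l(2) x0 by blast
    qed
    have "\<exists>\<delta>>0. \<forall>x. norm x < 1 \<and> dist x z < \<delta> \<longrightarrow> dist (h x) l < \<epsilon>" if "\<epsilon> > 0" for \<epsilon>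
    proof -
      have "F \<subseteq> ball l \<epsilon> \<union> V" using that r(1) by (auto simp: V_def)
      moreover have "open (ball l \<epsilon> \<union> V)" by (auto simp: V_def)
      ultimately have "\<exists>\<delta>>0. \<forall>x. norm x < 1 \<and> dist x z < \<delta> \<longrightarrow> h x \<in> ball l \<epsilon> \<union> V"
        by (intro near)
      then obtain \<delta> where \<delta>: "\<delta> > 0" "\<And>x. norm x < 1 \<Longrightarrow> dist x z < \<delta> \<Longrightarrow> h x \<in> ball l \<epsilon> \<union> V"
        by blast
      show ?thesis
      proof (intro exI[of _ "min \<delta> \<delta>0"] conjI allI impI)
        fix x assume x: "norm x < 1 \<and> dist x z < min \<delta> \<delta>0"
        then have "x \<in> N" by (auto simp: N_def dist_commute)
        then have "h x \<notin> V" using VN by blast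
        then show "dist (h x) l < \<epsilon>" using \<delta>(2)[of x] x by (auto simp: dist_commute)
      qed (use \<delta> \<delta>0 in auto)
    qed
    then show ?thesis using l(1) by (intro exI[of _ l]) (auto simp: F_def)
  qed
  define H where "H z = (if norm z < 1 then h z else SOME l. norm l \<le> 1 \<and> g2 l = g1 z \<and>
      (\<forall>\<epsilon>>0. \<exists>\<delta>>0. \<forall>x. norm x < 1 \<and> dist x z < \<delta> \<longrightarrow> dist (h x) l < \<epsilon>))" for z
  have Hs: "norm (H z) \<le> 1 \<and> g2 (H z) = g1 z \<and>
      (\<forall>\<epsilon>>0. \<exists>\<delta>>0. \<forall>x. norm x < 1 \<and> dist x z < \<delta> \<longrightarrow> dist (h x) (H z) < \<epsilon>)" if "norm z = 1" for z
    using someI_ex[OF lim[OF that]] that by (simp add: H_def)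
  have lim_all: "\<exists>\<delta>>0. \<forall>x. norm x < 1 \<and> dist x z < \<delta> \<longrightarrow> dist (h x) (H z) < \<epsilon>"
    if "norm z \<le> 1" and \<epsilon>: "\<epsilon> > 0" for z \<epsilon>
  proof (cases "norm z < 1")
    case True
    then have "isCont h z" using h(1) by (simp add: continuous_on_eq_continuous_at)
    then obtain \<delta> where "\<delta> > 0" "\<forall>x. dist x z < \<delta> \<longrightarrow> dist (h x) (h z) < \<epsilon>"
      using \<epsilon> unfolding continuous_at_eps_delta by blast
    then show ?thesis using True by (auto simp: H_def)
  qed (use Hs[of z] that \<epsilon> in auto)
  show ?thesis
  proof
    show "continuous_on (cball 0 1) H"
      unfolding continuous_on_iff
    proof (intro ballI allI impI)
      fix z :: complex and \<epsilon> :: real assume z: "z \<in> cball 0 1" and \<epsilon>: "\<epsilon> > 0"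
      then obtain \<delta> where \<delta>: "\<delta> > 0" "\<And>x. norm x < 1 \<Longrightarrow> dist x z < \<delta> \<Longrightarrow> dist (h x) (H z) < \<epsilon> / 2"
        using lim_all[of z "\<epsilon> / 2"] by auto
      show "\<exists>d>0. \<forall>x'\<in>cball 0 1. dist x' z < d \<longrightarrow> dist (H x') (H z) < \<epsilon>"
      proof (intro exI[of _ \<delta>] conjI ballI impI)
        fix w :: complex assume w: "w \<in> cball 0 1" "dist w z < \<delta>"
        then obtain \<eta> where \<eta>: "\<eta> > 0" "\<And>x. norm x < 1 \<Longrightarrow> dist x w < \<eta> \<Longrightarrow> dist (h x) (H w) < \<epsilon> / 2"
          using lim_all[of w "\<epsilon> / 2"] \<epsilon> by auto
        have "w \<in> closure (ball 0 1)" using w by simp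
        moreover have "min \<eta> (\<delta> - dist w z) > 0" using \<eta> w by auto
        ultimately obtain x where x: "x \<in> ball 0 1" "dist x w < min \<eta> (\<delta> - dist w z)"
          unfolding closure_approachable by blast
        then have "dist x z < \<delta>" using dist_triangle[of x z w] by auto
        then have "dist (h x) (H z) < \<epsilon> / 2" "dist (h x) (H w) < \<epsilon> / 2" using \<delta>(2) \<eta>(2) x by auto
        then show "dist (H w) (H z) < \<epsilon>"
          using dist_triangle2[of "H w" "H z" "h x"] by (simp add: dist_commute)
      qed (rule \<delta>(1))
    qed
    show "H z = h z" if "norm z < 1" for z using that by (simp add: H_def)
    show "norm (H z) \<le> 1 \<and> g2 (H z) = g1 z" if "norm z \<le> 1" for z
      using Hs[of z] h(2)[of z] that by (cases "norm z < 1") (auto simp: H_def)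
  qed
qed

text \<open>Invariance of domain makes the inverse of \<open>h\<close> continuous, so both
  directions extend; the composites are the identity on the open disc, and by density on the closed
  one.\<close>

lemma ball_homeo_extends:
  fixes g1 g2 :: "complex \<Rightarrow> 'z"
  assumes Z: "Hausdorff_space Z"
    and g1: "continuous_map (top_of_set (cball 0 1)) Z g1"
    and g2: "continuous_map (top_of_set (cball 0 1)) Z g2"
    and h: "continuous_on (ball 0 1) h" "bij_betw h (ball 0 1) (ball 0 1)"
    and gh: "\<And>z. norm z < 1 \<Longrightarrow> g2 (h z) = g1 z"
    and fin: "\<And>z. norm z = 1 \<Longrightarrow> finite {w \<in> cball 0 1. g2 w = g1 z}"
      "\<And>z. norm z = 1 \<Longrightarrow> finite {w \<in> cball 0 1. g1 w = g2 z}"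
  obtains H H' where "continuous_on (cball 0 1) H" "continuous_on (cball 0 1) H'"
    "\<And>z. norm z < 1 \<Longrightarrow> H z = h z"
    "\<And>z. norm z \<le> 1 \<Longrightarrow> norm (H z) \<le> 1 \<and> g2 (H z) = g1 z \<and> H' (H z) = z"
    "\<And>z. norm z \<le> 1 \<Longrightarrow> norm (H' z) \<le> 1 \<and> g1 (H' z) = g2 z \<and> H (H' z) = z"
    "\<And>z. norm z < 1 \<Longrightarrow> norm (H' z) < 1"
proof -
  obtain h' where h': "homeomorphism (ball 0 1) (h ` ball 0 1) h h'"
    using invariance_of_domain_homeomorphism[OF open_ball h(1)] h(2) by (auto simp: bij_betw_def)
  then have hh: "h ` ball 0 1 = ball 0 1" "continuous_on (ball 0 1) h'"
    "\<And>z. norm z < 1 \<Longrightarrow> h' (h z) = z" "\<And>z. norm z < 1 \<Longrightarrow> h (h' z) = z"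
    using h(2) homeomorphism_apply2[OF h'] by (auto simp: homeomorphism_def bij_betw_def)
  have hn: "norm (h z) < 1" "norm (h' z) < 1" if "norm z < 1" for z
    using hh(1) h' that by (auto simp: homeomorphism_def)
  obtain H where H: "continuous_on (cball 0 1) H" "\<And>z. norm z < 1 \<Longrightarrow> H z = h z"
      "\<And>z. norm z \<le> 1 \<Longrightarrow> norm (H z) \<le> 1 \<and> g2 (H z) = g1 z"
    by (rule ball_map_extends[OF Z g1 g2 h(1) _ fin(1)]) (use hn gh in auto)
  obtain H' where H': "continuous_on (cball 0 1) H'" "\<And>z. norm z < 1 \<Longrightarrow> H' z = h' z"
      "\<And>z. norm z \<le> 1 \<Longrightarrow> norm (H' z) \<le> 1 \<and> g1 (H' z) = g2 z"
    by (rule ball_map_extends[OF Z g2 g1 hh(2) _ fin(2)]) (use hn gh hh in \<open>auto, metis\<close>)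
  have id: "A (B z) = z" if A: "continuous_on (cball 0 1) A" and B: "continuous_on (cball 0 1) B"
      "\<And>z. norm z \<le> 1 \<Longrightarrow> norm (B z) \<le> 1" and AB: "\<And>z. norm z < 1 \<Longrightarrow> A (B z) = z" and z: "norm z \<le> 1"
    for A B :: "complex \<Rightarrow> complex" and z
  proof -
    have "A (B z) - z = 0"
    proof (rule continuous_constant_on_closure[of "ball 0 1" "\<lambda>z. A (B z) - z"])
      show "continuous_on (closure (ball 0 1)) (\<lambda>z. A (B z) - z)"
        using B by (auto intro!: continuous_intros continuous_on_compose2[OF A])
      show "z \<in> closure (ball 0 1)" using z by simp
    qed (use AB in auto)
    then show ?thesis by simp
  qed
  show ?thesis
  proof (rule that[OF H(1) H'(1) H(2)])
    show "norm (H z) \<le> 1 \<and> g2 (H z) = g1 z \<and> H' (H z) = z" if "norm z \<le> 1" for z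
      using H(3)[OF that] id[OF H'(1) H(1) _ _ that] H(2,3) H'(2) hh hn by auto
    show "norm (H' z) \<le> 1 \<and> g1 (H' z) = g2 z \<and> H (H' z) = z" if "norm z \<le> 1" for z
      using H'(3)[OF that] id[OF H(1) H'(1) _ _ that] H(2) H'(2,3) hh hn by auto
    show "norm (H' z) < 1" if "norm z < 1" for z using hn(2)[OF that] H'(2)[OF that] by simp
  qed auto
qed

lemma open_cells_points: "C \<in> open_cells K n \<Longrightarrow> C \<subseteq> points K"
  by (auto simp: points_def open_cells_def split: if_splits)

lemma combinatorial_map_cell:
  assumes "two_complex Y" "two_complex X" "combinatorial_map Y X f" "C \<in> open_cells Y n"
  shows "\<exists>D\<in>open_cells X n. bij_betw f C D"
proof -
  obtain D where D: "D \<in> open_cells X n"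
    "homeomorphic_map (subtopology (realization Y) C) (subtopology (realization X) D) f"
    using assms(3,4) by (auto simp: combinatorial_map_def)
  have "topspace (subtopology (realization Y) C) = C" "topspace (subtopology (realization X) D) = D"
    using open_cells_points[OF assms(4)] open_cells_points[OF D(1)] assms(1,2)
    by (auto simp: topspace_realization)
  then have "bij_betw f C D"
    using homeomorphic_imp_injective_map[OF D(2)] homeomorphic_imp_surjective_map[OF D(2)]
    by (simp add: bij_betw_def)
  with D(1) show ?thesis by blast
qed

section \<open>Edges and faces under a combinatorial map\<close>

text \<open>\<open>lab e\<close> is the edge below \<open>e\<close>, and \<open>\<sigma> e\<close>
  tells whether \<open>f\<close> keeps the direction. \<open>G\<close> absorbs the
  reparametrization, which \<open>combinatorial_map\<close> leaves arbitrary.\<close>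

definition edge_lift where
  "edge_lift Y X f lab \<sigma> \<longleftrightarrow> (\<forall>e\<in>edges Y. \<exists>G. interval_homeo G \<and>
     (\<forall>t\<in>{0..1}. f (edge_char Y e t) = letter_char X (lab e, \<sigma> e) (G t)))"

text \<open>On the open edge \<open>f\<close> is a continuous bijection of open intervals, hence
  monotone; a decreasing one is an increasing one onto the reversed letter. With a single vertex
  below, the end points match in either case.\<close>

lemma edge_lift_exists:
  assumes Y: "two_complex Y" and X: "two_complex X" "verts X = {x}" and f: "combinatorial_map Y X f"
  obtains lab \<sigma> where "edge_lift Y X f lab \<sigma>"
proof -
  have vert: "f (Vert_pt v) = Vert_pt x" if "v \<in> verts Y" for v
  proof -
    have "{Vert_pt v} \<in> open_cells Y 0" using that by (simp add: open_cells_def)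
    from combinatorial_map_cell[OF Y X(1) f this] show ?thesis
      by (auto simp: open_cells_def X bij_betw_def)
  qed
  have "\<exists>a s G. interval_homeo G \<and> (\<forall>t\<in>{0..1}. f (edge_char Y e t) = letter_char X (a, s) (G t))"
    if e: "e \<in> edges Y" for e
  proof -
    have "Edge_pt e ` {0<..<1} \<in> open_cells Y 1" using e by (simp add: open_cells_def)
    from combinatorial_map_cell[OF Y X(1) f this] obtain a where a: "a \<in> edges X"
        "bij_betw f (Edge_pt e ` {0<..<1}) (Edge_pt a ` {0<..<1})"
      by (auto simp: open_cells_def)
    define g where "g t = (case f (Edge_pt e t) of Edge_pt _ y \<Rightarrow> y)" for t
    have g: "f (Edge_pt e t) = Edge_pt a (g t)" "0 < g t" "g t < 1" if "t \<in> {0<..<1}" for t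
      using bij_betw_apply[OF a(2), of "Edge_pt e t"] that by (auto simp: g_def)
    have inj: "inj_on g {0<..<1}"
    proof (rule inj_onI)
      fix s t assume st: "s \<in> {0<..<1}" "t \<in> {0<..<1}" "g s = g t"
      then have "f (Edge_pt e s) = f (Edge_pt e t)" using g(1) by simp
      then show "s = t" using inj_onD[OF bij_betw_imp_inj_on[OF a(2)], of "Edge_pt e s" "Edge_pt e t"] st by auto
    qed
    have surj: "g ` {0<..<1} = {0<..<1}"
    proof (intro equalityI subsetI)
      fix y :: real assume "y \<in> {0<..<1}"
      then have "Edge_pt a y \<in> f ` Edge_pt e ` {0<..<1}" using bij_betw_imp_surj_on[OF a(2)] by blast
      then show "y \<in> g ` {0<..<1}" using g(1) by auto
    qed (use g in auto)
    have "continuous_map (top_of_set {0<..<1}) (realization X) (f \<circ> edge_char Y e)"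
    proof (rule continuous_map_compose)
      show "continuous_map (top_of_set {0<..<1}) (realization Y) (edge_char Y e)"
        by (rule continuous_map_from_subtopology_mono[OF continuous_map_edge_char[OF Y e]]) auto
      show "continuous_map (realization Y) (realization X) f" using f by (simp add: combinatorial_map_def)
    qed
    from edge_coordinate_continuous[OF X(1) this, of a g]
    have cont: "continuous_on {0<..<1} g" using g by (simp add: edge_char_def)
    have st: "src Y e \<in> verts Y" "tgt Y e \<in> verts Y" "src X a = x" "tgt X a = x"
      using Y X e a(1) by (auto simp: two_complex_def)
    show ?thesis
    proof (cases "strict_mono_on {0<..<1} g")
      case True
      let ?G = "\<lambda>t. if 0 < t \<and> t < 1 then g t else t"
      have "f (edge_char Y e t) = letter_char X (a, True) (?G t)" if "t \<in> {0..1}" for t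
        using that g[of t] vert st by (auto simp: letter_char_def edge_char_def)
      moreover have "interval_homeo ?G"
        by (rule interval_homeo_extend[OF _ True]) (simp add: bij_betw_def inj surj)
      ultimately show ?thesis by blast
    next
      case False
      then have sm: "strict_mono_on {0<..<1} (\<lambda>t. - g t)" using strict_mono_or_antimono[OF cont inj] by blast
      let ?G = "\<lambda>t. if 0 < t \<and> t < 1 then 1 - g t else t"
      have "f (edge_char Y e t) = letter_char X (a, False) (?G t)" if "t \<in> {0..1}" for t
        using that g[of t] vert st by (auto simp: letter_char_def edge_char_def)
      moreover have "interval_homeo ?G"
      proof (rule interval_homeo_extend)
        show "strict_mono_on {0<..<1} (\<lambda>t. 1 - g t)"
          using sm unfolding strict_mono_on_def by auto
        have "(\<lambda>t. 1 - g t) ` {0<..<1} = (\<lambda>y. 1 - y) ` g ` {0<..<1}" by (simp add: image_image)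
        also have "\<dots> = {0<..<1}" unfolding surj
        proof (intro equalityI subsetI)
          fix y :: real assume "y \<in> {0<..<1}"
          then show "y \<in> (\<lambda>y. 1 - y) ` {0<..<1}" by (intro image_eqI[of _ _ "1 - y"]) auto
        qed auto
        finally show "bij_betw (\<lambda>t. 1 - g t) {0<..<1} {0<..<1}"
          using inj by (simp add: bij_betw_def inj_on_def)
      qed
      ultimately show ?thesis by blast
    qed
  qed
  then have "\<exists>a s. \<forall>e\<in>edges Y. \<exists>G. interval_homeo G \<and> (\<forall>t\<in>{0..1}. f (edge_char Y e t) = letter_char X (a e, s e) (G t))"
    by metis
  then show ?thesis using that unfolding edge_lift_def by blast
qed

text \<open>Equality of the booleans is the product of the signs: reading the edge backwards
  reverses the letter below it and reflects \<open>G\<close>.\<close>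

lemma letter_lift:
  assumes "edge_lift Y X f lab \<sigma>" "fst l \<in> edges Y"
  shows "\<exists>G. interval_homeo G \<and>
    (\<forall>t\<in>{0..1}. f (letter_char Y l t) = letter_char X (lab (fst l), \<sigma> (fst l) = snd l) (G t))"
proof -
  obtain G where G: "interval_homeo G"
    "\<And>t. t \<in> {0..1} \<Longrightarrow> f (edge_char Y (fst l) t) = letter_char X (lab (fst l), \<sigma> (fst l)) (G t)"
    using assms unfolding edge_lift_def by blast
  show ?thesis
  proof (cases "snd l")
    case True
    then show ?thesis using G by (intro exI[of _ G]) (auto simp: letter_char_def)
  next
    case False
    then have "f (letter_char Y l t) = letter_char X (lab (fst l), \<sigma> (fst l) = snd l) (1 - G (1 - t))"
      if "t \<in> {0..1}" for t
      using that G(2)[of "1 - t"] by (auto simp: letter_char_def)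
    with interval_homeo_reflect[OF G(1)] show ?thesis by blast
  qed
qed

lemma letter_char_not_face: "letter_char K l t \<noteq> Face_pt d y"
  by (simp add: letter_char_def edge_char_def)

lemma interval_homeo_id: "interval_homeo (\<lambda>t. t)"
  by (auto simp: interval_homeo_def)

text \<open>The homeomorphism of open faces extends to the closed discs, because both boundary
  circles run through the 1-skeleton edge by edge and so each of its points has finitely many
  preimages.\<close>

lemma face_homeo:
  assumes Y: "two_complex Y" and X: "two_complex X" and f: "combinatorial_map Y X f"
    and lift: "edge_lift Y X f lab \<sigma>" and c: "c \<in> faces Y"
  obtains d H H' where "d \<in> faces X" "continuous_on (cball 0 1) H" "continuous_on (cball 0 1) H'"
    "\<forall>z. norm z \<le> 1 \<longrightarrow> norm (H z) \<le> 1 \<and> face_char X d (H z) = f (face_char Y c z) \<and> H' (H z) = z"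
    "\<forall>z. norm z \<le> 1 \<longrightarrow> norm (H' z) \<le> 1 \<and> f (face_char Y c (H' z)) = face_char X d z \<and> H (H' z) = z"
    "\<forall>z. norm z < 1 \<longrightarrow> norm (H' z) < 1" "\<forall>z. norm z = 1 \<longrightarrow> norm (H z) = 1"
proof -
  have "Face_pt c ` ball 0 1 \<in> open_cells Y 2" using c by (simp add: open_cells_def)
  from combinatorial_map_cell[OF Y X f this] obtain d where d: "d \<in> faces X"
      and bij: "bij_betw f (Face_pt c ` ball 0 1) (Face_pt d ` ball 0 1)"
    by (auto simp: open_cells_def)
  define h where "h z = (case f (Face_pt c z) of Face_pt _ y \<Rightarrow> y)" for z
  have h: "f (Face_pt c z) = Face_pt d (h z)" "norm (h z) < 1" if "norm z < 1" for z
    using bij_betw_apply[OF bij, of "Face_pt c z"] that by (auto simp: h_def)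
  have inj: "inj_on h (ball 0 1)"
  proof (rule inj_onI)
    fix s t :: complex assume st: "s \<in> ball 0 1" "t \<in> ball 0 1" "h s = h t"
    then have "f (Face_pt c s) = f (Face_pt c t)" using h(1) by simp
    then show "s = t" using inj_onD[OF bij_betw_imp_inj_on[OF bij], of "Face_pt c s" "Face_pt c t"] st by auto
  qed
  have surj: "h ` ball 0 1 = ball 0 1"
  proof (intro equalityI subsetI)
    fix y :: complex assume "y \<in> ball 0 1"
    then have "Face_pt d y \<in> f ` Face_pt c ` ball 0 1" using bij_betw_imp_surj_on[OF bij] by blast
    then show "y \<in> h ` ball 0 1" using h(1) by auto
  qed (use h in auto)
  let ?g1 = "f \<circ> face_char Y c" and ?g2 = "face_char X d"
  have cf: "continuous_map (realization Y) (realization X) f" using f by (simp add: combinatorial_map_def)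
  have g1: "continuous_map (top_of_set (cball 0 1)) (realization X) ?g1"
    by (rule continuous_map_compose[OF continuous_map_face_char[OF Y c] cf])
  have g2: "continuous_map (top_of_set (cball 0 1)) (realization X) ?g2"
    by (rule continuous_map_face_char[OF X d])
  have "continuous_map (top_of_set (ball 0 1)) (realization X) ?g1"
    by (rule continuous_map_from_subtopology_mono[OF g1]) auto
  from face_coordinate_continuous[OF X this, of d h]
  have ch: "continuous_on (ball 0 1) h" using h by (simp add: face_char_def)
  define n where "n = length (bdry Y c)"
  define m where "m = length (bdry X d)"
  have nm: "n > 0" "m > 0" using bdry_nonempty[OF Y c] bdry_nonempty[OF X d] by (simp_all add: n_def m_def)
  define l1 where "l1 k = (lab (fst (bdry Y c ! k)), \<sigma> (fst (bdry Y c ! k)) = snd (bdry Y c ! k))" for k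
  have "\<exists>G. interval_homeo G \<and> (\<forall>t\<in>{0..1}. f (letter_char Y (bdry Y c ! k) t) = letter_char X (l1 k) (G t))"
    if "k < n" for k
    using letter_lift[OF lift bdry_edge[OF Y c]] that by (simp add: n_def l1_def)
  then obtain G where G: "\<And>k. k < n \<Longrightarrow> interval_homeo (G k)"
    "\<And>k t. k < n \<Longrightarrow> t \<in> {0..1} \<Longrightarrow> f (letter_char Y (bdry Y c ! k) t) = letter_char X (l1 k) (G k t)"
    by metis
  have g1l: "?g1 (circ n (real k + t)) = letter_char X (l1 k) (G k t)" if "k < n" "t \<in> {0..1}" for k t
    using G(2)[OF that] face_char_circ[OF Y c n_def that] by simp
  have g2l: "?g2 (circ m (real k + t)) = letter_char X (bdry X d ! k) t" if "k < m" "t \<in> {0..1}" for k t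
    using face_char_circ[OF X d m_def that] .

  have skel1: "?g1 z \<noteq> Face_pt d' y" if z: "norm z = 1" for z d' y
  proof -
    obtain k t where k: "k < n" "0 \<le> t" "t < 1" "z = circ n (real k + t)"
      by (rule circ_cover[OF z nm(1)])
    then show ?thesis using g1l[of k t] letter_char_not_face[of X] by auto
  qed
  have skel2: "?g2 z \<noteq> Face_pt d' y" if z: "norm z = 1" for z d' y
  proof -
    obtain k t where k: "k < m" "0 \<le> t" "t < 1" "z = circ m (real k + t)"
      by (rule circ_cover[OF z nm(2)])
    then show ?thesis using g2l[of k t] letter_char_not_face[of X] by auto
  qed
  have fin2: "finite {w \<in> cball 0 1. ?g2 w = ?g1 z}" if z: "norm z = 1" for z
  proof -
    have "{w \<in> cball 0 1. ?g2 w = ?g1 z} \<subseteq> {w \<in> sphere 0 1. ?g2 w = ?g1 z}"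
    proof
      fix w assume w: "w \<in> {w \<in> cball 0 1. ?g2 w = ?g1 z}"
      then have "\<not> norm w < 1" using skel1[OF z, of d w] by (auto simp: face_char_def)
      then show "w \<in> {w \<in> sphere 0 1. ?g2 w = ?g1 z}" using w by auto
    qed
    moreover have "finite {w \<in> sphere 0 1. ?g2 w = ?g1 z}"
      by (rule finite_circle_fibre[OF nm(2) g2l interval_homeo_id])
    ultimately show ?thesis by (rule finite_subset)
  qed
  have fin1: "finite {w \<in> cball 0 1. ?g1 w = ?g2 z}" if z: "norm z = 1" for z
  proof -
    have "{w \<in> cball 0 1. ?g1 w = ?g2 z} \<subseteq> {w \<in> sphere 0 1. ?g1 w = ?g2 z}"
    proof
      fix w assume w: "w \<in> {w \<in> cball 0 1. ?g1 w = ?g2 z}"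
      have "?g1 w = Face_pt d (h w)" if "norm w < 1" using h(1)[OF that] that by (simp add: face_char_def)
      then have "\<not> norm w < 1" using skel2[OF z, of d "h w"] w by auto
      then show "w \<in> {w \<in> sphere 0 1. ?g1 w = ?g2 z}" using w by auto
    qed
    moreover have "finite {w \<in> sphere 0 1. ?g1 w = ?g2 z}"
      by (rule finite_circle_fibre[OF nm(1) g1l G(1)])
    ultimately show ?thesis by (rule finite_subset)
  qed
  have gh: "?g2 (h z) = ?g1 z" if "norm z < 1" for z using h[OF that] that by (simp add: face_char_def)
  obtain H H' where H: "continuous_on (cball 0 1) H" "continuous_on (cball 0 1) H'"
    "\<And>z. norm z \<le> 1 \<Longrightarrow> norm (H z) \<le> 1 \<and> ?g2 (H z) = ?g1 z \<and> H' (H z) = z"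
    "\<And>z. norm z \<le> 1 \<Longrightarrow> norm (H' z) \<le> 1 \<and> ?g1 (H' z) = ?g2 z \<and> H (H' z) = z"
    "\<And>z. norm z < 1 \<Longrightarrow> norm (H' z) < 1"
    by (rule ball_homeo_extends[OF Hausdorff_realization[OF X] g1 g2 ch _ gh fin2 fin1])
      (auto simp: bij_betw_def inj surj)
  \<comment> \<open>\<open>H'\<close> sends interior points to interior points, and
    \<open>H' (H z) = z\<close>.\<close>
  have "norm (H z) = 1" if "norm z = 1" for z
    using H(3)[of z] H(5)[of "H z"] that by force
  then show ?thesis using that[OF d H(1,2)] H(3-5) by auto
qed

section \<open>Boundary words under a combinatorial map\<close>

text \<open>The open arc maps into an open edge, so its image under \<open>H\<close> avoids the
  corners of the circle of \<open>d\<close>. By connectedness it stays within one arc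
  \<open>j\<close>, where the edge coordinate determines the point, given the directions of the
  letters.\<close>

lemma arc_image:
  assumes X: "two_complex X" "d \<in> faces X" and m: "m = length (bdry X d)"
    and H: "continuous_on (cball 0 1) H" "\<And>z. norm z = 1 \<Longrightarrow> norm (H z) = 1"
    and G: "interval_homeo G"
    and arc: "\<And>t. t \<in> {0..1} \<Longrightarrow> face_char X d (H (circ n (real k + t))) = letter_char X l (G t)"
  shows "\<exists>j<m. fst (bdry X d ! j) = fst l \<and> (\<forall>t\<in>{0..1}.
    H (circ n (real k + t)) = circ m (real j + (if snd l = snd (bdry X d ! j) then G t else 1 - G t)))"
proof -
  have m0: "m > 0" using bdry_nonempty[OF X] m by simp
  define w where "w t = H (circ n (real k + t))" for t
  have nw: "norm (w t) = 1" for t by (simp add: w_def H(2))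
  \<comment> \<open>The circle parameter of \<open>w t\<close> in \<open>{0..<m}\<close>. It can
    jump only at the point 1, which is a corner and hence avoided for
    \<open>0 < t < 1\<close>.\<close>
  define \<xi> where "\<xi> t = real m * Arg2pi (w t) / (2 * pi)" for t
  have pt: "\<exists>j<m. \<exists>\<tau>. 0 < \<tau> \<and> \<tau> < 1 \<and> w t = circ m (real j + \<tau>) \<and> \<xi> t = real j + \<tau> \<and>
      letter_char X (bdry X d ! j) \<tau> = letter_char X l (G t)" if t: "0 < t" "t < 1" for t
  proof -
    obtain j \<tau> where j: "j < m" "0 \<le> \<tau>" "\<tau> < 1" "w t = circ m (real j + \<tau>)"
      by (rule circ_cover[OF nw m0])
    have eq: "letter_char X (bdry X d ! j) \<tau> = letter_char X l (G t)"
      using face_char_circ_less[OF m j(1-3)] arc[of t] t j(4) by (simp add: w_def)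
    have "0 < G t" "G t < 1" using G t by (auto simp: interval_homeo_def)
    then have "\<tau> \<noteq> 0" using eq by (auto simp: letter_char_0 letter_char_mid)
    moreover have "\<xi> t = real j + \<tau>"
      unfolding \<xi>_def j(4) using j by (subst Arg2pi_circ) auto
    ultimately show ?thesis using j eq by (intro exI[of _ j] conjI exI[of _ \<tau>]) auto
  qed
  have fl: "\<xi> t \<noteq> of_int i" if t: "0 < t" "t < 1" for t i
  proof
    assume i: "\<xi> t = of_int i"
    obtain j \<tau> where j: "0 < \<tau>" "\<tau> < 1" "\<xi> t = real j + \<tau>" using pt[OF t] by blast
    have "real_of_int (i - int j) = \<tau>" using i j(3) by simp
    then have "0 < real_of_int (i - int j)" "real_of_int (i - int j) < 1" using j by auto
    then have "0 < i - int j" "i - int j < 1" by (simp_all only: of_int_0_less_iff of_int_less_1_iff)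
    then show False by linarith
  qed
  have "continuous_on {0<..<1} \<xi>"
  proof -
    have w: "continuous_on {0<..<1} w"
      unfolding w_def by (rule continuous_on_compose2[OF H(1)]) (auto intro!: continuous_intros)
    have "w t \<notin> \<real>\<^sub>\<ge>\<^sub>0" if "0 < t" "t < 1" for t
    proof
      assume "w t \<in> \<real>\<^sub>\<ge>\<^sub>0"
      then obtain r where "w t = of_real r" "r \<ge> 0" by (auto elim: nonneg_Reals_cases)
      then have "w t = 1" using nw[of t] by auto
      then have "\<xi> t = of_int 0" by (simp add: \<xi>_def Arg2pi_eq_0)
      then show False using fl[OF that] by metis
    qed
    then have "continuous_on {0<..<1} (\<lambda>t. Arg2pi (w t))"
      using w unfolding continuous_on_eq_continuous_within
      by (intro ballI continuous_within_compose3[OF continuous_at_Arg2pi]) auto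
    then show ?thesis unfolding \<xi>_def by (intro continuous_intros) auto
  qed
  then have conn: "connected (\<xi> ` {0<..<1})" by (rule connected_continuous_image) simp
  have const: "\<not> \<lfloor>\<xi> s\<rfloor> < \<lfloor>\<xi> t\<rfloor>" if "s \<in> {0<..<1}" "t \<in> {0<..<1}" for s t
  proof
    assume "\<lfloor>\<xi> s\<rfloor> < \<lfloor>\<xi> t\<rfloor>"
    then have "\<xi> s \<le> of_int \<lfloor>\<xi> t\<rfloor>" "of_int \<lfloor>\<xi> t\<rfloor> \<le> \<xi> t" by linarith+
    then have "of_int \<lfloor>\<xi> t\<rfloor> \<in> \<xi> ` {0<..<1}"
      using connected_contains_Icc[OF conn, of "\<xi> s" "\<xi> t"] that by auto
    then show False using fl by (metis greaterThanLessThan_iff imageE)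
  qed
  obtain j where j: "j < m" "\<lfloor>\<xi> (1/2)\<rfloor> = int j"
  proof -
    obtain j \<tau> where j: "j < m" "0 < \<tau>" "\<tau> < 1" "\<xi> (1/2) = real j + \<tau>" using pt[of "1/2"] by auto
    have "\<lfloor>\<xi> (1/2)\<rfloor> = int j" unfolding j(4) using j(2,3) by (subst floor_eq_iff) auto
    then show ?thesis using j(1) that by blast
  qed
  define D where "D \<longleftrightarrow> snd l = snd (bdry X d ! j)"
  have main: "fst (bdry X d ! j) = fst l \<and> w t = circ m (real j + (if D then G t else 1 - G t))"
    if t: "t \<in> {0<..<1}" for t
  proof -
    obtain i \<tau> where i: "i < m" "0 < \<tau>" "\<tau> < 1" "w t = circ m (real i + \<tau>)" "\<xi> t = real i + \<tau>"
      "letter_char X (bdry X d ! i) \<tau> = letter_char X l (G t)" using pt[of t] t by fastforce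
    have "\<lfloor>\<xi> t\<rfloor> = int i" unfolding i(5) using i(2,3) by (subst floor_eq_iff) auto
    moreover have "\<lfloor>\<xi> t\<rfloor> = \<lfloor>\<xi> (1/2)\<rfloor>" using const[OF t, of "1/2"] const[OF _ t, of "1/2"] by simp
    ultimately have ij: "i = j" using j by simp
    have "0 < G t" "G t < 1" using G t by (auto simp: interval_homeo_def)
    then have "fst (bdry X d ! j) = fst l" "\<tau> = (if D then G t else 1 - G t)"
      using i(2,3,6) unfolding ij D_def by (auto simp: letter_char_mid split: if_splits)
    then show ?thesis using i(4) ij by simp
  qed
  have "w t = circ m (real j + (if D then G t else 1 - G t))" if "t \<in> {0..1}" for t
  proof -
    have "w t - circ m (real j + (if D then G t else 1 - G t)) = 0"
    proof (rule continuous_constant_on_closure[of "{0<..<1}"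
        "\<lambda>t. w t - circ m (real j + (if D then G t else 1 - G t))"])
      have cl: "closure {0<..<1::real} = {0..1}" by simp
      have "continuous_on {0..1} w"
        unfolding w_def by (rule continuous_on_compose2[OF H(1)]) (auto intro!: continuous_intros)
      moreover have "continuous_on {0..1} G" using G by (simp add: interval_homeo_def)
      ultimately show "continuous_on (closure {0<..<1}) (\<lambda>t. w t - circ m (real j + (if D then G t else 1 - G t)))"
        unfolding cl by (cases D) (auto intro!: continuous_intros)
    qed (use main that in auto)
    then show ?thesis by simp
  qed
  moreover have "fst (bdry X d ! j) = fst l" using main[of "1/2"] by simp
  ultimately show ?thesis using j(1) unfolding w_def D_def by blast
qed

lemma circ_nat_eq:
  assumes "m > 0" "circ m (real a) = circ m (real b)"
  shows "a mod m = b mod m"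
proof -
  have "circ m (real (a mod m) + 0) = circ m (real (b mod m) + 0)"
    unfolding circ_mod[OF assms(1)] using assms(2) by simp
  from circ_inj[OF _ _ _ _ this] show ?thesis using assms(1) by simp
qed

text \<open>Midpoints identify arcs: at \<open>\<tau> = 1\<close> the point is a corner, whose
  parameter is an integer.\<close>

lemma circ_half:
  assumes "j < m" "i < m" "0 \<le> \<tau>" "\<tau> \<le> 1" "circ m (real j + \<tau>) = circ m (real i + 1/2)"
  shows "j = i"
proof (cases "\<tau> < 1")
  case True
  have "real j + \<tau> < real m" "real i + 1/2 < real m" using assms True by linarith+
  then have "real j + \<tau> = real i + 1/2" using circ_inj[OF _ _ _ _ assms(5)] assms(3) by simp
  then have "real j < real i + 1" "real i < real j + 1" using assms(3) True by linarith+
  then show ?thesis by linarith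
next
  case False
  then have "circ m (real (Suc j mod m) + 0) = circ m (real i + 1/2)"
    using circ_mod[of m "Suc j" 0] assms by (simp add: add.commute)
  moreover have "real i + 1/2 < real m" using assms(2) by linarith
  ultimately have "real (Suc j mod m) = real i + 1/2"
    using circ_inj[of "real (Suc j mod m) + 0" m "real i + 1/2"] assms(1) by simp
  then have "2 * (Suc j mod m) = 2 * i + 1" by linarith
  moreover have "2 * a \<noteq> 2 * i + 1" for a :: nat by presburger
  ultimately show ?thesis by blast
qed

text \<open>A bijection between the arcs of two subdivided circles which respects the incidence of
  consecutive arcs, where \<open>D k\<close> tells whether the \<open>k\<close>-th arc keeps its direction, is a rotation
  or a reflection.\<close>

lemma cyclic_matching:
  assumes bij: "bij_betw J {..<n} {..<m}"
    and vertex: "\<And>k. k < n \<Longrightarrow>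
      (J k + of_bool (D k)) mod m = (J (Suc k mod n) + of_bool (\<not> D (Suc k mod n))) mod m"
  shows "n = m" "\<exists>\<delta>. \<forall>k<n. D k = \<delta> \<and> (if \<delta> then J (Suc k mod n) = Suc (J k) mod m
    else J k = Suc (J (Suc k mod n)) mod m)"
proof -
  show nm: "n = m" using bij_betw_same_card[OF bij] by simp
  have J: "J k < m" if "k < n" for k using bij_betw_apply[OF bij] that by simp
  have succ: "Suc k mod n < n" if "k < n" for k using that by simp
  \<comment> \<open>If the direction changed, the shifts in \<open>vertex\<close> would cancel and
    both arcs would have the same image. Injectivity of \<open>J\<close> then gives
    \<open>Suc k mod n = k\<close>, where no change is possible.\<close>
  have D_Suc: "D (Suc k mod n) = D k" if k: "k < n" for k
  proof (rule ccontr)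
    assume neq: "D (Suc k mod n) \<noteq> D k"
    have "J k = J (Suc k mod n)"
      using vertex[OF k] neq J[OF k] J[OF succ[OF k]]
      by (cases "D k") (auto simp: mod_Suc split: if_splits)
    then have "k = Suc k mod n" using bij_betw_imp_inj_on[OF bij] k succ[OF k] by (auto dest: inj_onD)
    then show False using neq by simp
  qed
  have D0: "D k = D 0" if "k < n" for k
    using that
  proof (induction k)
    case (Suc k)
    then show ?case using D_Suc[of k] by simp
  qed simp
  show "\<exists>\<delta>. \<forall>k<n. D k = \<delta> \<and> (if \<delta> then J (Suc k mod n) = Suc (J k) mod m
    else J k = Suc (J (Suc k mod n)) mod m)"
  proof (intro exI[of _ "D 0"] allI impI conjI)
    fix k assume k: "k < n"
    then show "D k = D 0" by (rule D0)
    show "if D 0 then J (Suc k mod n) = Suc (J k) mod m else J k = Suc (J (Suc k mod n)) mod m"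
      using vertex[OF k] D0[OF k] D0[OF succ[OF k]] J[OF k] J[OF succ[OF k]] by auto
  qed
qed

text \<open>The boundary path of a 2-cell of \<open>Y\<close>, read so that its image is the boundary path of the
  2-cell below it: the \<open>j\<close>-th letter is the edge \<open>\<epsilon> j\<close>, traversed as the \<open>j\<close>-th letter below it
  with respect to the orientation of the edges of \<open>Y\<close> pulled back from \<open>X\<close>. The map \<open>H\<close> lifts the
  closed disc of \<open>d\<close> to that of \<open>c\<close>.\<close>

definition boundary_lift where
  "boundary_lift Y X f lab \<sigma> c d \<epsilon> H \<longleftrightarrow> d \<in> faces X \<and> continuous_on (cball 0 1) H \<and>
    (\<forall>j<length (bdry X d). \<epsilon> j \<in> edges Y \<and> lab (\<epsilon> j) = fst (bdry X d ! j)) \<and>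
    mset (map fst (bdry Y c)) = mset (map \<epsilon> [0..<length (bdry X d)]) \<and>
    (\<forall>j<length (bdry X d). term_vert Y (\<epsilon> j, \<sigma> (\<epsilon> j) = snd (bdry X d ! j)) =
       init_vert Y (\<epsilon> (Suc j mod length (bdry X d)),
         \<sigma> (\<epsilon> (Suc j mod length (bdry X d))) = snd (bdry X d ! (Suc j mod length (bdry X d))))) \<and>
    (\<forall>j<length (bdry X d). face_char Y c (H (circ (length (bdry X d)) (real j))) =
         Vert_pt (init_vert Y (\<epsilon> j, \<sigma> (\<epsilon> j) = snd (bdry X d ! j)))) \<and>
    (\<forall>z. norm z \<le> 1 \<longrightarrow> norm (H z) \<le> 1) \<and>
    (\<forall>z. norm z < 1 \<longrightarrow> norm (H z) < 1 \<and> f (Face_pt c (H z)) = Face_pt d z)"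

text \<open>\<open>arc_image\<close> sends the k-th boundary letter of \<open>c\<close> to position
  \<open>J k\<close> of \<open>d\<close>. By \<open>cyclic_matching\<close> this is a rotation or a
  reflection, so the boundary of \<open>c\<close> can be read in the order of \<open>d\<close>,
  backwards for a reflection.\<close>

lemma boundary_lift_exists:
  assumes Y: "two_complex Y" and X: "two_complex X" and f: "combinatorial_map Y X f"
    and lift: "edge_lift Y X f lab \<sigma>" and c: "c \<in> faces Y"
  shows "\<exists>d \<epsilon> H. boundary_lift Y X f lab \<sigma> c d \<epsilon> H"
proof -
  obtain d H H' where d: "d \<in> faces X" and H0: "continuous_on (cball 0 1) H" "continuous_on (cball 0 1) H'"
    "\<forall>z. norm z \<le> 1 \<longrightarrow> norm (H z) \<le> 1 \<and> face_char X d (H z) = f (face_char Y c z) \<and> H' (H z) = z"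
    "\<forall>z. norm z \<le> 1 \<longrightarrow> norm (H' z) \<le> 1 \<and> f (face_char Y c (H' z)) = face_char X d z \<and> H (H' z) = z"
    "\<forall>z. norm z < 1 \<longrightarrow> norm (H' z) < 1" "\<forall>z. norm z = 1 \<longrightarrow> norm (H z) = 1"
    by (rule face_homeo[OF Y X f lift c])
  note H = H0(1,2) H0(3-6)[rule_format]
  define p where "p = bdry Y c"
  define w where "w = bdry X d"
  define n where "n = length p"
  define m where "m = length w"
  have nm: "n > 0" "m > 0" using bdry_nonempty[OF Y c] bdry_nonempty[OF X d]
    by (simp_all add: n_def m_def p_def w_def)
  have nY: "n = length (bdry Y c)" and mX: "m = length (bdry X d)" by (simp_all add: n_def p_def m_def w_def)
  have pe: "fst (p ! k) \<in> edges Y" if "k < n" for k using bdry_edge[OF Y c] that by (simp add: nY p_def)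
  define l where "l k = (lab (fst (p ! k)), \<sigma> (fst (p ! k)) = snd (p ! k))" for k
  have "\<exists>j G. interval_homeo G \<and> j < m \<and> fst (w ! j) = fst (l k) \<and>
      (\<forall>t\<in>{0..1}. H (circ n (real k + t)) = circ m (real j + (if snd (l k) = snd (w ! j) then G t else 1 - G t)))"
    if k: "k < n" for k
  proof -
    obtain G where G: "interval_homeo G"
        "\<And>t. t \<in> {0..1} \<Longrightarrow> f (letter_char Y (p ! k) t) = letter_char X (l k) (G t)"
      using letter_lift[OF lift pe[OF k]] unfolding l_def by blast
    have "face_char X d (H (circ n (real k + t))) = letter_char X (l k) (G t)" if "t \<in> {0..1}" for t
      using H(3)[of "circ n (real k + t)"] face_char_circ[OF Y c nY k that] G(2)[OF that]
      by (simp add: p_def)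
    from arc_image[OF X d mX H(1) H(6) G(1) this] G(1) show ?thesis unfolding w_def by blast
  qed
  then obtain J G where JG: "\<And>k. k < n \<Longrightarrow> interval_homeo (G k)" "\<And>k. k < n \<Longrightarrow> J k < m"
      "\<And>k. k < n \<Longrightarrow> fst (w ! J k) = fst (l k)"
      "\<And>k t. k < n \<Longrightarrow> t \<in> {0..1} \<Longrightarrow> H (circ n (real k + t)) =
         circ m (real (J k) + (if snd (l k) = snd (w ! J k) then G k t else 1 - G k t))"
    by metis
  define D where "D k \<longleftrightarrow> snd (l k) = snd (w ! J k)" for k
  have G01: "0 \<le> G k t \<and> G k t \<le> 1" if "k < n" "t \<in> {0..1}" for k t
  proof -
    have "0 < G k t \<and> G k t < 1" if "t \<noteq> 0" "t \<noteq> 1"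
      using JG(1)[OF \<open>k < n\<close>] \<open>t \<in> {0..1}\<close> that by (auto simp: interval_homeo_def)
    then show ?thesis using JG(1)[OF that(1)] by (cases "t = 0 \<or> t = 1") (auto simp: interval_homeo_def)
  qed
  have start: "H (circ n (real k)) = circ m (real (J k + of_bool (\<not> D k)))"
    and stop: "H (circ n (real (Suc k))) = circ m (real (J k + of_bool (D k)))" if k: "k < n" for k
    using JG(4)[OF k, of 0] JG(4)[OF k, of 1] JG(1)[OF k]
    by (auto simp: D_def interval_homeo_def add.commute)
  have vertex: "(J k + of_bool (D k)) mod m = (J (Suc k mod n) + of_bool (\<not> D (Suc k mod n))) mod m"
    if k: "k < n" for k
  proof (rule circ_nat_eq[OF nm(2)])
    have "circ n (real (Suc k mod n)) = circ n (real (Suc k))"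
      using circ_mod[OF nm(1), of "Suc k" 0] by simp
    then show "circ m (real (J k + of_bool (D k))) = circ m (real (J (Suc k mod n) + of_bool (\<not> D (Suc k mod n))))"
      using stop[OF k] start[of "Suc k mod n"] nm(1) by simp
  qed
  \<comment> \<open>A point over the midpoint of the arc \<open>J k\<close>. A midpoint lies on one
    arc only, so bijectivity of \<open>H\<close> on the circles passes to \<open>J\<close>.\<close>
  have half: "\<exists>t. 0 < t \<and> t < 1 \<and> H (circ n (real k + t)) = circ m (real (J k) + 1/2)" if k: "k < n" for k
  proof -
    have "continuous_on {0..1} (G k)" "G k 0 = 0" "G k 1 = 1" using JG(1)[OF k] by (auto simp: interval_homeo_def)
    then obtain t where t: "0 \<le> t" "t \<le> 1" "G k t = 1/2"
      using IVT'[of "G k" 0 "1/2" 1] by auto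
    then have "t \<noteq> 0" "t \<noteq> 1" using \<open>G k 0 = 0\<close> \<open>G k 1 = 1\<close> by auto
    moreover have "H (circ n (real k + t)) = circ m (real (J k) + 1/2)"
      using JG(4)[OF k, of t] t(1,2) unfolding t(3) by simp
    ultimately show ?thesis using t by (intro exI[of _ t]) auto
  qed
  have bij: "bij_betw J {..<n} {..<m}"
    unfolding bij_betw_def
  proof
    show "inj_on J {..<n}"
    proof (rule inj_onI)
      fix k k' assume k: "k \<in> {..<n}" "k' \<in> {..<n}" "J k = J k'"
      then obtain t t' where t: "0 < t" "t < 1" "0 < t'" "t' < 1"
          "H (circ n (real k + t)) = H (circ n (real k' + t'))"
        using half[of k] half[of k'] by (metis lessThan_iff)
      then have "H' (H (circ n (real k + t))) = H' (H (circ n (real k' + t')))" by simp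
      then have "circ n (real k + t) = circ n (real k' + t')" using H(3) by simp
      moreover have "k < n" "k' < n" using k by auto
      then have "real k + t < real n" "real k' + t' < real n" using t by linarith+
      ultimately have "real k + t = real k' + t'" using circ_inj[of "real k + t" n "real k' + t'"] t by simp
      then have "real k < real k' + 1" "real k' < real k + 1" using t by linarith+
      then show "k = k'" by linarith
    qed
    show "J ` {..<n} = {..<m}"
    proof (intro equalityI subsetI)
      fix i assume i: "i \<in> {..<m}"
      define z where "z = H' (circ m (real i + 1/2))"
      \<comment> \<open>An interior point would map into an open face, whereas the midpoint of an
        arc lies on an edge.\<close>
      have "norm z = 1"
      proof (rule ccontr)
        assume "norm z \<noteq> 1"
        moreover have "norm z \<le> 1" using H(4) by (simp add: z_def)
        ultimately have "face_char Y c z = Face_pt c z" by (simp add: face_char_def)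
        then have z: "Face_pt c z \<in> Face_pt c ` ball 0 1" "Face_pt c ` ball 0 1 \<in> open_cells Y 2"
          using \<open>norm z \<noteq> 1\<close> \<open>norm z \<le> 1\<close> c by (auto simp: open_cells_def)
        from combinatorial_map_cell[OF Y X f z(2)] z(1)
        obtain d' y where "f (Face_pt c z) = Face_pt d' y"
          by (auto simp: open_cells_def dest!: bij_betw_apply)
        moreover have "f (face_char Y c z) = face_char X d (circ m (real i + 1/2))"
          using H(4) by (simp add: z_def)
        moreover have "face_char X d (circ m (real i + 1/2)) = letter_char X (w ! i) (1/2)"
          unfolding w_def by (rule face_char_circ_less[OF mX]) (use i in auto)
        ultimately show False using \<open>face_char Y c z = Face_pt c z\<close> letter_char_not_face[of X] by metis
      qed
      then obtain k t where k: "k < n" "0 \<le> t" "t < 1" "z = circ n (real k + t)"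
        using nm(1) by (rule circ_cover)
      have "H z = circ m (real i + 1/2)" using H(4) by (simp add: z_def)
      then have "circ m (real (J k) + (if D k then G k t else 1 - G k t)) = circ m (real i + 1/2)"
        using JG(4)[OF k(1), of t] k by (simp add: D_def)
      from circ_half[OF JG(2)[OF k(1)] _ _ _ this] have "J k = i"
        using i G01[OF k(1), of t] k by auto
      then show "i \<in> J ` {..<n}" using k(1) by auto
    qed (use JG(2) in auto)
  qed
  have n_m: "n = m" by (rule cyclic_matching(1)[OF bij vertex])
  obtain \<delta> where \<delta>: "\<And>k. k < n \<Longrightarrow> D k = \<delta>"
    "\<And>k. k < n \<Longrightarrow> if \<delta> then J (Suc k mod n) = Suc (J k) mod m else J k = Suc (J (Suc k mod n)) mod m"
    using cyclic_matching(2)[OF bij vertex] by metis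
  define \<kappa> where "\<kappa> = inv_into {..<n} J"
  have \<kappa>: "\<kappa> j < n" "J (\<kappa> j) = j" if "j < m" for j
    using bij_betw_apply[OF bij_betw_inv_into[OF bij], of j] bij_betw_inv_into_right[OF bij, of j] that
    by (auto simp: \<kappa>_def)
  have \<kappa>J: "\<kappa> (J k) = k" if "k < n" for k
    using bij_betw_inv_into_left[OF bij, of k] that by (simp add: \<kappa>_def)
  define \<epsilon> where "\<epsilon> j = fst (p ! \<kappa> j)" for j
  define q where "q j = (\<epsilon> j, \<sigma> (\<epsilon> j) = snd (w ! j))" for j
  have q: "q j = (fst (p ! \<kappa> j), snd (p ! \<kappa> j) = \<delta>)" if "j < m" for j
    using \<delta>(1)[OF \<kappa>(1)[OF that]] \<kappa>(2)[OF that] by (auto simp: q_def D_def l_def \<epsilon>_def)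
  have rev: "init_vert Y (fst x, snd x = False) = term_vert Y x" "term_vert Y (fst x, snd x = False) = init_vert Y x"
    "(fst x, snd x = True) = x" for x
    by (auto simp: init_vert_def term_vert_def split_beta)
  have cp: "term_vert Y (p ! k) = init_vert Y (p ! (Suc k mod n))" if "k < n" for k
    using Y c that by (auto simp: two_complex_def closed_edge_path_def p_def n_def)
  \<comment> \<open>\<open>boundary_lift\<close> asks for a map from the disc of \<open>d\<close> to
    that of \<open>c\<close>, hence for the inverse \<open>H'\<close>.\<close>
  have "boundary_lift Y X f lab \<sigma> c d \<epsilon> H'"
    unfolding boundary_lift_def w_def[symmetric] p_def[symmetric] m_def[symmetric]
  proof (intro conjI allI impI d H(2))
    fix j assume j: "j < m"
    then show "\<epsilon> j \<in> edges Y" "lab (\<epsilon> j) = fst (w ! j)"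
      using pe[OF \<kappa>(1)[OF j]] JG(3)[OF \<kappa>(1)[OF j]] \<kappa>(2)[OF j] by (simp_all add: \<epsilon>_def l_def)
    define j' where "j' = Suc j mod m"
    have j': "j' < m" using nm by (simp add: j'_def)
    have "term_vert Y (q j) = init_vert Y (q j')"
    proof (cases \<delta>)
      case True
      have "J (Suc (\<kappa> j) mod n) = j'" using \<delta>(2)[OF \<kappa>(1)[OF j]] True \<kappa>(2)[OF j] by (simp add: j'_def)
      then have "\<kappa> j' = Suc (\<kappa> j) mod n" using \<kappa>J[of "Suc (\<kappa> j) mod n"] nm by auto
      then show ?thesis using cp[OF \<kappa>(1)[OF j]] True rev(3) by (simp add: q[OF j] q[OF j'])
    next
      case False
      \<comment> \<open>For a reflection, the successor of a position in \<open>d\<close>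
        corresponds to its predecessor in the boundary of \<open>c\<close>.\<close>
      define k where "k = Suc (\<kappa> j') mod n"
      have k: "k < n" using nm by (simp add: k_def)
      have "j' = Suc (J k) mod m" using \<delta>(2)[OF \<kappa>(1)[OF j']] False \<kappa>(2)[OF j'] by (simp add: k_def)
      then have "J k = j" using JG(2)[OF k] j unfolding j'_def by (auto simp: mod_Suc split: if_splits)
      then have "\<kappa> j = k" using \<kappa>J[OF k] by simp
      then show ?thesis using cp[OF \<kappa>(1)[OF j']] False rev(1,2) by (simp add: q[OF j] q[OF j'] k_def)
    qed
    then show "term_vert Y (\<epsilon> j, \<sigma> (\<epsilon> j) = snd (w ! j)) =
        init_vert Y (\<epsilon> (Suc j mod m), \<sigma> (\<epsilon> (Suc j mod m)) = snd (w ! (Suc j mod m)))"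
      by (simp add: q_def j'_def)
    have "face_char Y c (H' (circ m (real j))) = Vert_pt (init_vert Y (q j))"
    proof (cases \<delta>)
      case True
      then have "H (circ n (real (\<kappa> j))) = circ m (real j)"
        using start[OF \<kappa>(1)[OF j]] \<delta>(1)[OF \<kappa>(1)[OF j]] \<kappa>(2)[OF j] by simp
      then have "H' (circ m (real j)) = circ n (real (\<kappa> j) + 0)" using H(3)[of "circ n (real (\<kappa> j))"] by simp
      then show ?thesis
        using face_char_circ[OF Y c nY \<kappa>(1)[OF j], of 0] True rev(3)
        by (simp add: letter_char_0 q[OF j] p_def)
    next
      case False
      then have "H (circ n (real (Suc (\<kappa> j)))) = circ m (real j)"
        using stop[OF \<kappa>(1)[OF j]] \<delta>(1)[OF \<kappa>(1)[OF j]] \<kappa>(2)[OF j] by simp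
      then have "H' (circ m (real j)) = circ n (real (\<kappa> j) + 1)"
        using H(3)[of "circ n (real (Suc (\<kappa> j)))"] by (simp add: add.commute)
      then show ?thesis
        using face_char_circ[OF Y c nY \<kappa>(1)[OF j], of 1] False rev(1)
        by (simp add: letter_char_1 q[OF j] p_def)
    qed
    then show "face_char Y c (H' (circ m (real j))) = Vert_pt (init_vert Y (\<epsilon> j, \<sigma> (\<epsilon> j) = snd (w ! j)))"
      by (simp add: q_def)
  next
    have "map fst p = map (\<lambda>k. fst (p ! k)) [0..<n]"
      by (rule nth_equalityI) (simp_all add: n_def)
    then have "mset (map fst p) = image_mset (\<lambda>k. fst (p ! k)) (mset_set {..<n})"
      by (simp add: atLeast0LessThan)
    also have "mset_set {..<n} = image_mset \<kappa> (mset_set {..<m})"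
      using bij_betw_inv_into[OF bij] by (simp add: \<kappa>_def bij_betw_def image_mset_mset_set)
    moreover have "\<epsilon> = (\<lambda>j. fst (p ! \<kappa> j))" by (simp add: fun_eq_iff \<epsilon>_def)
    ultimately show "mset (map fst p) = mset (map \<epsilon> [0..<m])"
      by (simp add: image_mset.compositionality o_def atLeast0LessThan)
  next
    fix z :: complex
    show "norm (H' z) \<le> 1" if "norm z \<le> 1" using H(4)[OF that] by blast
    assume z: "norm z < 1"
    then show "norm (H' z) < 1" "f (Face_pt c (H' z)) = Face_pt d z"
      using H(4)[of z] H(5)[OF z] by (simp_all add: face_char_def)
  qed
  then show ?thesis by blast
qed

section \<open>Finiteness of compact complexes\<close>

lemma openin_Diff_finite:
  fixes D :: "'a::t1_space set"
  assumes "finite N"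
  shows "openin (top_of_set D) (D - N)"
  using openin_open_Int[of "- N" D] assms by (simp add: Diff_eq finite_imp_closed open_Compl)

text \<open>A set with one point in every open cell is closed and discrete.\<close>

lemma compact_realization_finite:
  assumes K: "two_complex K" and comp: "compact_space (realization K)"
  shows "finite (verts K)" "finite (edges K)" "finite (faces K)"
proof -
  define M where "M = Vert_pt ` verts K \<union> (\<lambda>e. Edge_pt e (1/2)) ` edges K \<union> (\<lambda>c. Face_pt c 0) ` faces K"
  have op: "openin (realization K) (points K - N)" if N: "N \<subseteq> M" for N
  proof -
    have Nh: "(Edge_pt e t \<in> N \<longrightarrow> t = 1/2) \<and> (Face_pt c z \<in> N \<longrightarrow> z = 0)" for e t c z
      using N by (auto simp: M_def)
    have fe: "finite {t \<in> {0..1}. letter_char K l t \<in> N}" for l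
    proof (rule finite_subset)
      show "{t \<in> {0..1}. letter_char K l t \<in> N} \<subseteq> {0, 1/2, 1}"
      proof
        fix t assume "t \<in> {t \<in> {0..1}. letter_char K l t \<in> N}"
        then show "t \<in> {0, 1/2, 1}"
          using Nh[of "fst l" "if snd l then t else 1 - t"] letter_char_mid[of t K l]
          by (cases "t = 0 \<or> t = 1") (auto split: if_splits)
      qed
    qed simp
    have "openin (top_of_set {0..1}) {t \<in> {0..1}. edge_char K e t \<in> points K - N}" if "e \<in> edges K" for e
    proof -
      have "{t \<in> {0..1}. edge_char K e t \<in> points K - N} = {0..1} - {t \<in> {0..1}. letter_char K (e, True) t \<in> N}"
        using edge_char_points[OF K that] by (auto simp: letter_char_def)
      then show ?thesis using openin_Diff_finite[OF fe[of "(e, True)"], of "{0..1}"] by simp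
    qed
    moreover have "openin (top_of_set (cball 0 1)) {z \<in> cball 0 1. face_char K c z \<in> points K - N}"
      if c: "c \<in> faces K" for c
    proof -
      have "{z \<in> cball 0 1. face_char K c z \<in> N} \<subseteq> {0} \<union>
          (\<Union>k<length (bdry K c). (\<lambda>t. circ (length (bdry K c)) (real k + t)) ` {t \<in> {0..1}. letter_char K (bdry K c ! k) t \<in> N})"
      proof
        fix z assume z: "z \<in> {z \<in> cball 0 1. face_char K c z \<in> N}"
        show "z \<in> {0} \<union> (\<Union>k<length (bdry K c). (\<lambda>t. circ (length (bdry K c)) (real k + t)) ` {t \<in> {0..1}. letter_char K (bdry K c ! k) t \<in> N})"
        proof (cases "norm z < 1")
          case True
          then show ?thesis using z Nh by (auto simp: face_char_def)
        next
          case False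
          then have "norm z = 1" using z by simp
          then obtain k t where k: "k < length (bdry K c)" "0 \<le> t" "t < 1" "z = circ (length (bdry K c)) (real k + t)"
            using bdry_nonempty[OF K c] by (rule circ_cover)
          have "t \<in> {t \<in> {0..1}. letter_char K (bdry K c ! k) t \<in> N}"
            using face_char_circ_less[OF HOL.refl k(1-3)] z k by auto
          then show ?thesis using k(1,4) by blast
        qed
      qed
      then have "finite {z \<in> cball 0 1. face_char K c z \<in> N}"
        by (rule finite_subset) (intro finite_UnI finite_UN_I finite_imageI fe; simp)
      moreover have "{z \<in> cball 0 1. face_char K c z \<in> points K - N} = cball 0 1 - {z \<in> cball 0 1. face_char K c z \<in> N}"
        using face_char_points[OF K c] by auto
      ultimately show ?thesis
        using openin_Diff_finite[of "{z \<in> cball 0 1. face_char K c z \<in> N}" "cball 0 1"] by simp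
    qed
    ultimately show ?thesis by (simp add: openin_realization open_in_complex_def)
  qed
  have MK: "M \<subseteq> points K" by (force simp: M_def points_eq)
  have "finite M"
  proof -
    \<comment> \<open>Each member of this open cover contains at most one point of \<open>M\<close>,
      so a finite subcover makes \<open>M\<close> finite.\<close>
    define \<U> where "\<U> = insert (points K - M) ((\<lambda>x. points K - (M - {x})) ` M)"
    have "\<forall>U\<in>\<U>. openin (realization K) U" using op by (auto simp: \<U>_def)
    moreover have "topspace (realization K) \<subseteq> \<Union>\<U>"
      by (auto simp: topspace_realization[OF K] \<U>_def)
    ultimately obtain \<F> where F: "finite \<F>" "\<F> \<subseteq> \<U>" "topspace (realization K) \<subseteq> \<Union>\<F>"
      using comp unfolding compact_space_alt by meson
    have "\<exists>x. U \<inter> M \<subseteq> {x}" if "U \<in> \<F>" for U using that F(2) by (auto simp: \<U>_def)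
    then have "finite (U \<inter> M)" if "U \<in> \<F>" for U using that by (meson finite.simps finite_subset)
    then have "finite (\<Union>U\<in>\<F>. U \<inter> M)" using F(1) by blast
    moreover have "M \<subseteq> (\<Union>U\<in>\<F>. U \<inter> M)" using F(3) MK by (auto simp: topspace_realization[OF K])
    ultimately show ?thesis by (rule finite_subset[rotated])
  qed
  then have "finite (Vert_pt ` verts K :: ('a, 'b, 'c) cpoint set)"
    "finite ((\<lambda>e. Edge_pt e (1/2)) ` edges K :: ('a, 'b, 'c) cpoint set)"
    "finite ((\<lambda>c. Face_pt c 0) ` faces K :: ('a, 'b, 'c) cpoint set)"
    by (simp_all add: M_def)
  then show "finite (verts K)" "finite (edges K)" "finite (faces K)"
    by (auto dest!: finite_imageD simp: inj_on_def)
qed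

section \<open>The bigon structure of an immersed complex\<close>

text \<open>The faces of \<open>C\<close> over one bottom vertex embed via \<open>\<tau>\<close>
  into the edges of \<open>E\<close>, where a leaf \<open>w\<close> exists. An edge of
  \<open>Y\<close> determines its start under \<open>s\<close>, so the edge labelled
  \<open>w\<close> can only be shared with faces over the same vertex, and there the leaf property
  excludes them.\<close>

lemma leaf_condition:
  assumes nc: "no_cycles E" and \<tau>: "\<And>c. c \<in> C \<Longrightarrow> \<tau> c < length E" and C: "C \<noteq> {}"
    and e1: "\<And>c. c \<in> C \<Longrightarrow> lab (e1 c) = fst (E ! \<tau> c) \<and> s (e1 c) = b c"
    and e2: "\<And>c. c \<in> C \<Longrightarrow> lab (e2 c) = snd (E ! \<tau> c) \<and> s (e2 c) = b c"
    and inj: "\<And>c c'. c \<in> C \<Longrightarrow> c' \<in> C \<Longrightarrow> \<tau> c = \<tau> c' \<Longrightarrow> b c = b c' \<Longrightarrow> c = c'"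
  shows "\<exists>c\<in>C. \<exists>e\<in>{e1 c, e2 c}. e1 c \<noteq> e2 c \<and> (\<forall>c'\<in>C. e \<in> {e1 c', e2 c'} \<longrightarrow> c' = c)"
proof -
  obtain c0 where c0: "c0 \<in> C" using C by blast
  define C0 where "C0 = {c \<in> C. b c = b c0}"
  have "\<tau> ` C0 \<subseteq> {..<length E}" "\<tau> ` C0 \<noteq> {}" using \<tau> c0 by (auto simp: C0_def)
  from no_cycles_leaf[OF nc this] obtain i where "i \<in> \<tau> ` C0"
      and i: "\<exists>w\<in>{fst (E ! i), snd (E ! i)}. fst (E ! i) \<noteq> snd (E ! i) \<and>
        (\<forall>j\<in>\<tau> ` C0. w \<in> {fst (E ! j), snd (E ! j)} \<longrightarrow> j = i)"
    by (rule bexE)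
  then obtain c where c': "i = \<tau> c" "c \<in> C0" by (elim imageE)
  from i[unfolded c'(1)] obtain w where w: "w \<in> {fst (E ! \<tau> c), snd (E ! \<tau> c)}"
      and cw: "fst (E ! \<tau> c) \<noteq> snd (E ! \<tau> c) \<and>
        (\<forall>i\<in>\<tau> ` C0. w \<in> {fst (E ! i), snd (E ! i)} \<longrightarrow> i = \<tau> c)"
    by (rule bexE)
  note c = c'(2) w
  have leaf: "\<tau> c' = \<tau> c" if "c' \<in> C0" "w \<in> {fst (E ! \<tau> c'), snd (E ! \<tau> c')}" for c'
    using cw that by blast
  have cC: "c \<in> C" "b c = b c0" using c(1) by (auto simp: C0_def)
  obtain e where e: "e \<in> {e1 c, e2 c}" "lab e = w" using c(2) e1[OF cC(1)] e2[OF cC(1)] by auto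
  show ?thesis
  proof (intro bexI conjI ballI impI)
    show "e1 c \<noteq> e2 c" using conjunct1[OF cw] e1[OF cC(1)] e2[OF cC(1)] by auto
    fix c' assume c': "c' \<in> C" "e \<in> {e1 c', e2 c'}"
    have "b c' = b c" using e1[OF cC(1)] e2[OF cC(1)] e1[OF c'(1)] e2[OF c'(1)] e(1) c'(2) by auto
    then have "c' \<in> C0" using c'(1) cC(2) by (simp add: C0_def)
    moreover have "w \<in> {fst (E ! \<tau> c'), snd (E ! \<tau> c')}"
      using e(2) c'(2) e1[OF c'(1)] e2[OF c'(1)] by auto
    ultimately have "\<tau> c' = \<tau> c" by (rule leaf)
    then show "c' = c" using inj[OF c'(1) cC(1)] \<open>b c' = b c\<close> by blast
  qed (use e cC in auto)
qed

lemma bdry_standard_complex: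
  assumes "i < length (rels P)" "rels P ! i = (u, v)" "length u = length v"
  shows "length (bdry (standard_complex P) i) = 2 * length u"
    "\<And>j. j < length u \<Longrightarrow> bdry (standard_complex P) i ! j = (u ! j, True)"
    "\<And>j. length u \<le> j \<Longrightarrow> j < 2 * length u \<Longrightarrow>
       bdry (standard_complex P) i ! j = (v ! (2 * length u - 1 - j), False)"
proof -
  show "length (bdry (standard_complex P) i) = 2 * length u"
    using assms by (simp add: standard_complex_def pos_word_def inv_word_def)
  show "bdry (standard_complex P) i ! j = (u ! j, True)" if "j < length u" for j
    using assms that by (simp add: standard_complex_def pos_word_def inv_word_def nth_append)
  show "bdry (standard_complex P) i ! j = (v ! (2 * length u - 1 - j), False)"
    if "length u \<le> j" "j < 2 * length u" for j
  proof -
    have "2 * length u - 1 - j = length v - Suc (j - length u)" using that assms(3) by linarith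
    then show ?thesis
      using assms that by (simp add: standard_complex_def pos_word_def inv_word_def nth_append rev_nth)
  qed
qed

text \<open>Two 2-cells which lie over the same corner of \<open>d\<close> would have common image points
  arbitrarily close to that corner, against local injectivity.\<close>

lemma corner_injective:
  assumes Y: "two_complex Y" and f: "immersion Y X f"
    and c: "c1 \<in> faces Y" "c2 \<in> faces Y"
    and H1: "continuous_on (cball 0 1) H1" "\<And>z. norm z \<le> 1 \<Longrightarrow> norm (H1 z) \<le> 1"
      "\<And>z. norm z < 1 \<Longrightarrow> norm (H1 z) < 1 \<and> f (Face_pt c1 (H1 z)) = Face_pt d z"
    and H2: "continuous_on (cball 0 1) H2" "\<And>z. norm z \<le> 1 \<Longrightarrow> norm (H2 z) \<le> 1"
      "\<And>z. norm z < 1 \<Longrightarrow> norm (H2 z) < 1 \<and> f (Face_pt c2 (H2 z)) = Face_pt d z"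
    and z: "norm z = 1" "face_char Y c1 (H1 z) = face_char Y c2 (H2 z)"
  shows "c1 = c2"
proof -
  have "H1 z \<in> cball 0 1" using H1(2) z by simp
  then have "face_char Y c1 (H1 z) \<in> topspace (realization Y)"
    using face_char_points[OF Y c(1)] by (simp add: topspace_realization[OF Y] del: mem_cball mem_cball_0)
  then obtain U where U: "openin (realization Y) U" "face_char Y c1 (H1 z) \<in> U" "inj_on f U"
    using f unfolding immersion_def by blast
  have nbhd: "\<exists>\<delta>>0. \<forall>x. norm x < 1 \<and> dist x z < \<delta> \<longrightarrow> Face_pt c (H x) \<in> U"
    if c: "c \<in> faces Y" and H: "continuous_on (cball 0 1) H" "\<And>z. norm z \<le> 1 \<Longrightarrow> norm (H z) \<le> 1"
      "\<And>z. norm z < 1 \<Longrightarrow> norm (H z) < 1" and HU: "face_char Y c (H z) \<in> U" for c H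
  proof -
    have "continuous_map (top_of_set (cball 0 1)) (top_of_set (cball 0 1)) H"
      using H by (auto simp: Pi_iff)
    from openin_continuous_map_preimage[OF continuous_map_compose[OF this continuous_map_face_char[OF Y c]] U(1)]
    have op: "openin (top_of_set (cball 0 1)) {x \<in> cball 0 1. face_char Y c (H x) \<in> U}" by simp
    have "z \<in> {x \<in> cball 0 1. face_char Y c (H x) \<in> U}" using z HU by simp
    from bspec[OF conjunct2[OF op[unfolded openin_euclidean_subtopology_iff]] this]
    obtain \<delta> where \<delta>: "\<delta> > 0"
        "\<forall>x\<in>cball 0 1. dist x z < \<delta> \<longrightarrow> x \<in> {x \<in> cball 0 1. face_char Y c (H x) \<in> U}"
      by (elim exE conjE)
    have "Face_pt c (H x) \<in> U" if "norm x < 1" "dist x z < \<delta>" for x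
    proof -
      have "face_char Y c (H x) \<in> U" using \<delta>(2) that by auto
      then show ?thesis using H(3)[OF that(1)] by (simp add: face_char_def)
    qed
    with \<delta>(1) show ?thesis by blast
  qed
  obtain \<delta>1 where \<delta>1: "\<delta>1 > 0" "\<And>x. norm x < 1 \<Longrightarrow> dist x z < \<delta>1 \<Longrightarrow> Face_pt c1 (H1 x) \<in> U"
    using nbhd[OF c(1) H1(1,2)] H1(3) U(2) by blast
  obtain \<delta>2 where \<delta>2: "\<delta>2 > 0" "\<And>x. norm x < 1 \<Longrightarrow> dist x z < \<delta>2 \<Longrightarrow> Face_pt c2 (H2 x) \<in> U"
    using nbhd[OF c(2) H2(1,2)] H2(3) U(2) z(2) by metis
  have "z \<in> closure (ball 0 1)" using z by simp
  moreover have "min \<delta>1 \<delta>2 > 0" using \<delta>1 \<delta>2 by simp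
  ultimately obtain x where x: "x \<in> ball 0 1" "dist x z < min \<delta>1 \<delta>2"
    unfolding closure_approachable by blast
  then have "Face_pt c1 (H1 x) \<in> U" "Face_pt c2 (H2 x) \<in> U" using \<delta>1(2)[of x] \<delta>2(2)[of x] by auto
  moreover have "f (Face_pt c1 (H1 x)) = f (Face_pt c2 (H2 x))" using H1(3) H2(3) x by simp
  ultimately show ?thesis using inj_onD[OF U(3)] by blast
qed

lemma directed_path_rev:
  "directed_path s t p \<Longrightarrow> directed_path t s (rev p)"
  unfolding directed_path_def
proof (intro conjI allI impI)
  fix i assume p: "p \<noteq> [] \<and> (\<forall>i. Suc i < length p \<longrightarrow> t (p ! i) = s (p ! Suc i))"
    and i: "Suc i < length (rev p)"
  define k where "k = length p - Suc (Suc i)"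
  have "rev p ! i = p ! Suc k" "rev p ! Suc i = p ! k" "Suc k < length p"
    using i by (auto simp: k_def rev_nth Suc_diff_Suc)
  then show "s (rev p ! i) = t (rev p ! Suc i)" using p by simp
qed auto

theorem theorem4p1:
  fixes P :: "'a presentation" and r :: nat
  assumes "adian_presentation P"
    and "int r = int (card (gens P)) - int (length (rels P))"
    and "free_abelian_of_rank (abelianization (presented_group P)) r"
    and "\<not> trivial_group (abelianization (presented_group P))"
    and "\<forall>(u, v) \<in> set (rels P). length u = length v"
    and "no_cycles (I_graph P) \<or> no_cycles (T_graph P)"
  shows "non_positive_immersion_property TYPE('v \<times> 'e \<times> 'f) (standard_complex P)"
  unfolding non_positive_immersion_property_def
proof (intro allI impI)
  fix Y :: "('v, 'e, 'f) complex2" and f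
  assume "two_complex Y \<and> compact_space (realization Y) \<and> connected_space (realization Y) \<and>
    immersion Y (standard_complex P) f"
  then have Y: "two_complex Y" and comp: "compact_space (realization Y)"
    and conn: "connected_space (realization Y)" and imm: "immersion Y (standard_complex P) f" by auto
  define X where "X = standard_complex P"
  have X: "two_complex X" unfolding X_def by (rule two_complex_standard_complex[OF assms(1)])
  have f: "combinatorial_map Y X f" using imm by (simp add: immersion_def X_def)
  obtain lab \<sigma> where lift: "edge_lift Y X f lab \<sigma>"
    using edge_lift_exists[OF Y X _ f] by (auto simp: X_def standard_complex_def)
  note fin = compact_realization_finite[OF Y comp]
  \<comment> \<open>The orientation pulled back from the generators, which may differ from that of
    \<open>Y\<close>.\<close>
  define s where "s e = init_vert Y (e, \<sigma> e)" for e
  define t where "t e = term_vert Y (e, \<sigma> e)" for e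
  have st: "s e = src Y e \<and> t e = tgt Y e \<or> s e = tgt Y e \<and> t e = src Y e" for e
    by (auto simp: s_def t_def init_vert_def term_vert_def)
  obtain \<tau> \<epsilon> H where data: "\<And>c. c \<in> faces Y \<Longrightarrow> boundary_lift Y X f lab \<sigma> c (\<tau> c) (\<epsilon> c) (H c)"
    using boundary_lift_exists[OF Y X f lift] by metis
  define L where "L c = length (fst (rels P ! \<tau> c))" for c
  have rel: "\<tau> c < length (rels P)" "length (snd (rels P ! \<tau> c)) = L c" "L c > 0"
    if "c \<in> faces Y" for c
  proof -
    show i: "\<tau> c < length (rels P)" using data[OF that] by (simp add: boundary_lift_def X_def standard_complex_def)
    obtain u v where uv: "rels P ! \<tau> c = (u, v)" by fastforce
    have "(u, v) \<in> set (rels P)" using i uv by (metis nth_mem)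
    then have "length u = length v" "u \<noteq> []" using assms(1,5) by (auto simp: adian_presentation_def)
    then show "length (snd (rels P ! \<tau> c)) = L c" "L c > 0" by (auto simp: L_def uv)
  qed
  have bd: "length (bdry X (\<tau> c)) = 2 * L c"
    "\<And>j. j < L c \<Longrightarrow> bdry X (\<tau> c) ! j = (fst (rels P ! \<tau> c) ! j, True)"
    "\<And>j. L c \<le> j \<Longrightarrow> j < 2 * L c \<Longrightarrow>
      bdry X (\<tau> c) ! j = (snd (rels P ! \<tau> c) ! (2 * L c - 1 - j), False)"
    if "c \<in> faces Y" for c
    using bdry_standard_complex[OF rel(1)[OF that], of "fst (rels P ! \<tau> c)" "snd (rels P ! \<tau> c)"]
      rel(2)[OF that] by (simp_all add: X_def L_def)
  have sgn: "init_vert Y (e, \<sigma> e = True) = s e" "term_vert Y (e, \<sigma> e = True) = t e"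
    "init_vert Y (e, \<sigma> e = False) = t e" "term_vert Y (e, \<sigma> e = False) = s e" for e
    by (auto simp: s_def t_def init_vert_def term_vert_def)
  \<comment> \<open>Positions below \<open>L c\<close> spell the left word and are traversed
    forwards; the others spell the inverse of the right word and are traversed backwards. So a
    letter starts at \<open>s\<close> or at \<open>t\<close> of its edge accordingly.\<close>
  have step: "(if j < L c then t (\<epsilon> c j) else s (\<epsilon> c j)) =
      (if Suc j mod (2 * L c) < L c then s (\<epsilon> c (Suc j mod (2 * L c))) else t (\<epsilon> c (Suc j mod (2 * L c))))"
    if c: "c \<in> faces Y" and j: "j < 2 * L c" for c j
  proof -
    have snd_bd: "snd (bdry X (\<tau> c) ! i) \<longleftrightarrow> i < L c" if "i < 2 * L c" for i
      using bd(2,3)[OF c, of i] that by (cases "i < L c") auto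
    have "Suc j mod (2 * L c) < 2 * L c" using rel(3)[OF c] by simp
    note snd_bd = snd_bd[OF j] snd_bd[OF this]
    have "term_vert Y (\<epsilon> c j, \<sigma> (\<epsilon> c j) = (j < L c)) = init_vert Y (\<epsilon> c (Suc j mod (2 * L c)),
        \<sigma> (\<epsilon> c (Suc j mod (2 * L c))) = (Suc j mod (2 * L c) < L c))"
      using data[OF c] j unfolding boundary_lift_def bd(1)[OF c] snd_bd[symmetric] by blast
    then show ?thesis
      by (cases "j < L c"; cases "Suc j mod (2 * L c) < L c") (simp_all add: sgn[simplified])
  qed
  define \<alpha> where "\<alpha> c = map (\<epsilon> c) [0..<L c]" for c
  \<comment> \<open>The second half of the boundary word is an inverse, so reading it from the back
    yields a directed path.\<close>
  define \<beta> where "\<beta> c = map (\<lambda>i. \<epsilon> c (2 * L c - 1 - i)) [0..<L c]" for c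
  have \<alpha>: "directed_path s t (\<alpha> c)" if c: "c \<in> faces Y" for c
    unfolding directed_path_def
  proof (intro conjI allI impI)
    show "\<alpha> c \<noteq> []" using rel(3)[OF c] by (simp add: \<alpha>_def)
    fix i assume "Suc i < length (\<alpha> c)"
    then show "t (\<alpha> c ! i) = s (\<alpha> c ! Suc i)" using step[OF c, of i] by (simp add: \<alpha>_def)
  qed
  have \<beta>: "directed_path s t (\<beta> c)" if c: "c \<in> faces Y" for c
    unfolding directed_path_def
  proof (intro conjI allI impI)
    show "\<beta> c \<noteq> []" using rel(3)[OF c] by (simp add: \<beta>_def)
    fix i assume i: "Suc i < length (\<beta> c)"
    define j where "j = 2 * L c - 1 - Suc i"
    have j: "j < 2 * L c" "L c \<le> j" "Suc j = 2 * L c - 1 - i" "Suc j < 2 * L c"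
      using i by (auto simp: j_def \<beta>_def)
    then have "\<beta> c ! i = \<epsilon> c (Suc j)" "\<beta> c ! Suc i = \<epsilon> c j"
      using i by (auto simp: \<beta>_def j_def)
    then show "t (\<beta> c ! i) = s (\<beta> c ! Suc i)"
      using step[OF c j(1)] j(2,4) by simp
  qed
  have hd_last: "hd (\<alpha> c) = \<epsilon> c 0" "last (\<alpha> c) = \<epsilon> c (L c - 1)"
    "hd (\<beta> c) = \<epsilon> c (2 * L c - 1)" "last (\<beta> c) = \<epsilon> c (L c)" if c: "c \<in> faces Y" for c
    using rel(3)[OF c] by (simp_all add: \<alpha>_def \<beta>_def hd_map last_map mult_2)
  have bottom: "s (hd (\<alpha> c)) = s (hd (\<beta> c))" if c: "c \<in> faces Y" for c
  proof -
    have "\<not> 2 * L c - 1 < L c" "2 * L c - 1 < 2 * L c" "Suc (2 * L c - 1) = 2 * L c"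
      using rel(3)[OF c] by linarith+
    then show ?thesis using step[OF c, of "2 * L c - 1"] rel(3)[OF c] by (simp add: hd_last[OF c])
  qed
  have top: "t (last (\<alpha> c)) = t (last (\<beta> c))" if c: "c \<in> faces Y" for c
    using step[OF c, of "L c - 1"] rel(3)[OF c] by (simp add: hd_last[OF c])
  have len: "length (\<alpha> c) = length (\<beta> c)" for c by (simp add: \<alpha>_def \<beta>_def)
  have mset: "mset (map fst (bdry Y c)) = mset (\<alpha> c) + mset (\<beta> c)" if c: "c \<in> faces Y" for c
  proof -
    have "rev (\<beta> c) = map (\<epsilon> c) [L c..<2 * L c]"
      by (intro nth_equalityI) (auto simp: \<beta>_def rev_nth)
    then have "\<alpha> c @ rev (\<beta> c) = map (\<epsilon> c) [0..<2 * L c]"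
      using upt_add_eq_append[of 0 "L c" "L c"] by (simp add: \<alpha>_def mult_2)
    then have "mset (map (\<epsilon> c) [0..<2 * L c]) = mset (\<alpha> c) + mset (\<beta> c)"
      by (metis mset_append mset_rev)
    then show ?thesis using data[OF c] by (simp add: boundary_lift_def bd(1)[OF c])
  qed
  have corner: "c = c'" if c: "c \<in> faces Y" "c' \<in> faces Y" and \<tau>: "\<tau> c = \<tau> c'"
    and j: "j < 2 * L c" and v: "init_vert Y (\<epsilon> c j, \<sigma> (\<epsilon> c j) = snd (bdry X (\<tau> c) ! j)) =
      init_vert Y (\<epsilon> c' j, \<sigma> (\<epsilon> c' j) = snd (bdry X (\<tau> c') ! j))" for c c' j
  proof (rule corner_injective[OF Y imm c])
    show "continuous_on (cball 0 1) (H c)" "continuous_on (cball 0 1) (H c')"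
      using data c by (auto simp: boundary_lift_def)
    show "norm (circ (2 * L c) (real j)) = 1" by simp
    show "face_char Y c (H c (circ (2 * L c) (real j))) = face_char Y c' (H c' (circ (2 * L c) (real j)))"
      using data[OF c(1)] data[OF c(2)] j v \<tau> bd(1)[OF c(1)] bd(1)[OF c(2)] by (simp add: boundary_lift_def)
    fix z :: complex
    show "norm (H c z) \<le> 1" "norm (H c' z) \<le> 1" if "norm z \<le> 1"
      using data[OF c(1)] data[OF c(2)] that by (simp_all add: boundary_lift_def)
    show "norm (H c z) < 1 \<and> f (Face_pt c (H c z)) = Face_pt (\<tau> c) z"
      "norm (H c' z) < 1 \<and> f (Face_pt c' (H c' z)) = Face_pt (\<tau> c) z" if "norm z < 1"
      using data[OF c(1)] data[OF c(2)] that \<tau> by (simp_all add: boundary_lift_def)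
  qed
  \<comment> \<open>The bottom vertex is the corner at position 0.\<close>
  have corner_bottom: "c = c'" if c: "c \<in> faces Y" "c' \<in> faces Y" and \<tau>: "\<tau> c = \<tau> c'"
    and v: "s (hd (\<alpha> c)) = s (hd (\<alpha> c'))" for c c'
  proof (rule corner[OF c \<tau>, of 0])
    have "L c > 0" "L c' > 0" using rel(3) c by auto
    then show "0 < 2 * L c" "init_vert Y (\<epsilon> c 0, \<sigma> (\<epsilon> c 0) = snd (bdry X (\<tau> c) ! 0)) =
      init_vert Y (\<epsilon> c' 0, \<sigma> (\<epsilon> c' 0) = snd (bdry X (\<tau> c') ! 0))"
      using v bd(2)[OF c(1), of 0] bd(2)[OF c(2), of 0] by (simp_all add: hd_last c s_def)
  qed
  \<comment> \<open>The top vertex is the corner at position \<open>L c\<close>: the letter there is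
    traversed backwards and so starts at \<open>t\<close> of its edge.\<close>
  have corner_top: "c = c'" if c: "c \<in> faces Y" "c' \<in> faces Y" and \<tau>: "\<tau> c = \<tau> c'"
    and v: "t (last (\<alpha> c)) = t (last (\<alpha> c'))" for c c'
  proof (rule corner[OF c \<tau>, of "L c"])
    have L: "L c > 0" "L c' = L c" using rel(3) c \<tau> by (auto simp: L_def)
    then show "L c < 2 * L c" by simp
    show "init_vert Y (\<epsilon> c (L c), \<sigma> (\<epsilon> c (L c)) = snd (bdry X (\<tau> c) ! L c)) =
      init_vert Y (\<epsilon> c' (L c), \<sigma> (\<epsilon> c' (L c)) = snd (bdry X (\<tau> c') ! L c))"
      using v L bd(3)[OF c(1), of "L c"] bd(3)[OF c(2), of "L c"] sgn(3)[simplified]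
      unfolding top[OF c(1)] top[OF c(2)] by (simp add: hd_last c)
  qed
  have lab: "lab (hd (\<alpha> c)) = hd (fst (rels P ! \<tau> c))" "lab (hd (\<beta> c)) = hd (snd (rels P ! \<tau> c))"
    "lab (last (\<alpha> c)) = last (fst (rels P ! \<tau> c))" "lab (last (\<beta> c)) = last (snd (rels P ! \<tau> c))"
    if c: "c \<in> faces Y" for c
  proof -
    have *: "lab (\<epsilon> c j) = fst (bdry X (\<tau> c) ! j)" if "j < 2 * L c" for j
      using data[OF c] that by (simp add: boundary_lift_def bd(1)[OF c])
    have ne: "fst (rels P ! \<tau> c) \<noteq> []" "snd (rels P ! \<tau> c) \<noteq> []" "L c = length (fst (rels P ! \<tau> c))"
      using rel(2,3)[OF c] by (auto simp: L_def)
    show "lab (hd (\<alpha> c)) = hd (fst (rels P ! \<tau> c))"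
      using *[of 0] bd(2)[OF c, of 0] rel(3)[OF c] ne by (simp add: hd_last[OF c] hd_conv_nth)
    show "lab (hd (\<beta> c)) = hd (snd (rels P ! \<tau> c))"
      using *[of "2 * L c - 1"] bd(3)[OF c, of "2 * L c - 1"] rel(3)[OF c] ne
      by (simp add: hd_last[OF c] hd_conv_nth)
    have "L c - 1 < 2 * L c" using rel(3)[OF c] by linarith
    then show "lab (last (\<alpha> c)) = last (fst (rels P ! \<tau> c))"
      using *[of "L c - 1"] bd(2)[OF c, of "L c - 1"] rel(3)[OF c] ne
      by (simp add: hd_last[OF c] last_conv_nth)
    show "lab (last (\<beta> c)) = last (snd (rels P ! \<tau> c))"
      using *[of "L c"] bd(3)[OF c, of "L c"] rel(2,3)[OF c] ne
      by (simp add: hd_last[OF c] last_conv_nth)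
  qed

  from assms(6) show "euler_char Y \<le> 0 \<or> contractible_space (realization Y)"
  proof
    assume nc: "no_cycles (T_graph P)"
    have "bigon_complex Y s t \<alpha> \<beta>"
      unfolding bigon_complex_def
    proof (intro conjI ballI allI impI)
      fix C assume C: "C \<subseteq> faces Y \<and> C \<noteq> {}"
      then have cC: "c \<in> faces Y" if "c \<in> C" for c using that by blast
      show "\<exists>c\<in>C. \<exists>e\<in>{hd (\<alpha> c), hd (\<beta> c)}. hd (\<alpha> c) \<noteq> hd (\<beta> c) \<and>
          (\<forall>c'\<in>C. e \<in> {hd (\<alpha> c'), hd (\<beta> c')} \<longrightarrow> c' = c)"
        by (rule leaf_condition[OF nc, of C \<tau> lab "\<lambda>c. hd (\<alpha> c)" s "\<lambda>c. s (hd (\<alpha> c))"])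
          (use C cC rel(1) lab(1,2) bottom corner_bottom in \<open>auto simp: T_graph_def split_beta\<close>)
    qed (use Y fin conn st \<alpha> \<beta> len bottom top mset in auto)
    then show ?thesis by (rule bigon_complex_euler_char_or_contractible)
  next
    assume nc: "no_cycles (I_graph P)"
    \<comment> \<open>Swapping \<open>s\<close> and \<open>t\<close> turns top vertices into bottom
      ones and last letters into first ones, as I(P) requires.\<close>
    have "bigon_complex Y t s (\<lambda>c. rev (\<alpha> c)) (\<lambda>c. rev (\<beta> c))"
      unfolding bigon_complex_def
    proof (intro conjI ballI allI impI)
      fix C assume C: "C \<subseteq> faces Y \<and> C \<noteq> {}"
      then have cC: "c \<in> faces Y" if "c \<in> C" for c using that by blast
      show "\<exists>c\<in>C. \<exists>e\<in>{hd (rev (\<alpha> c)), hd (rev (\<beta> c))}. hd (rev (\<alpha> c)) \<noteq> hd (rev (\<beta> c)) \<and>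
          (\<forall>c'\<in>C. e \<in> {hd (rev (\<alpha> c')), hd (rev (\<beta> c'))} \<longrightarrow> c' = c)"
        unfolding hd_rev
        by (rule leaf_condition[OF nc, of C \<tau> lab "\<lambda>c. last (\<alpha> c)" t "\<lambda>c. t (last (\<alpha> c))"])
          (use C cC rel(1) lab(3,4) top corner_top in \<open>auto simp: I_graph_def split_beta\<close>)
    qed (use Y fin conn st directed_path_rev[OF \<alpha>] directed_path_rev[OF \<beta>] len bottom top mset in
        \<open>auto simp: hd_rev last_rev\<close>)
    then show ?thesis by (rule bigon_complex_euler_char_or_contractible)
  qed
qed

end
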